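(* Let $K$ be a field and let $G$ be a Cohen-Macaulay Cameron-Walker graph. Then all powers of the vertex cover ideal $I_G$ of $G$ have linear resolutions.
   Context: For a finite simple graph $G$ with $V(G)=\{x_1,\ldots,x_N\}$ and $S=K[x_1,\ldots,x_N]$: a vertex cover is a subset of $V(G)$ meeting every edge, minimal if no proper subset is a vertex cover; the vertex cover ideal $I_G\subset S$ is generated by the monomials $\prod_{x_i\in C}x_i$, $C$ running over the minimal vertex covers of $G$. $G$ is Cohen-Macaulay if $S/(x_ix_j:\{x_i,x_j\}\in E(G))$ is a Cohen-Macaulay ring. A Cameron-Walker graph consists of a connected bipartite graph with vertex partition $(X,Y)$ such that at least one leaf (pendant edge to a new vertex of degree $1$) is attached to each vertex of $X$, and possibly (zero or more) pendant triangles are attached to each vertex of $Y$; a pendant triangle at $y$ is a triangle on $y$ and two new vertices of degree $2$. *)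

theory Defs
  imports
    "HOL-Algebra.Algebra"
    "HOL-Algebra.Algebraic_Closure_Type"
    "HOL-Library.Poly_Mapping"
    "HOL-Library.Extended_Nat"
    "Jordan_Normal_Form.Matrix"
begin

section \<open>Cohen-Macaulay rings\<close>

text \<open>
  Localization of a commutative ring \<open>R\<close> at a multiplicatively closed set \<open>S\<close>. Elements are
  equivalence classes of pairs \<open>(a, s)\<close>, standing for the fraction \<open>a/s\<close>.
\<close>

definition frac_rel :: "('a, 'b) ring_scheme \<Rightarrow> 'a set \<Rightarrow> (('a \<times> 'a) \<times> ('a \<times> 'a)) set" where
  "frac_rel R S =
     {((a, s), (b, t)) | a s b t. a \<in> carrier R \<and> s \<in> S \<and> b \<in> carrier R \<and> t \<in> S \<and>
        (\<exists>u\<in>S. u \<otimes>\<^bsub>R\<^esub> (a \<otimes>\<^bsub>R\<^esub> t) = u \<otimes>\<^bsub>R\<^esub> (b \<otimes>\<^bsub>R\<^esub> s))}"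

definition fraction :: "('a, 'b) ring_scheme \<Rightarrow> 'a set \<Rightarrow> 'a \<Rightarrow> 'a \<Rightarrow> ('a \<times> 'a) set" where
  "fraction R S a s = frac_rel R S `` {(a, s)}"

definition localization :: "('a, 'b) ring_scheme \<Rightarrow> 'a set \<Rightarrow> ('a \<times> 'a) set ring" where
  "localization R S =
     \<lparr>carrier = (carrier R \<times> S) // frac_rel R S,
      monoid.mult = (\<lambda>P Q. \<Union>(a, s)\<in>P. \<Union>(b, t)\<in>Q. fraction R S (a \<otimes>\<^bsub>R\<^esub> b) (s \<otimes>\<^bsub>R\<^esub> t)),
      one = fraction R S \<one>\<^bsub>R\<^esub> \<one>\<^bsub>R\<^esub>,
      ring.zero = fraction R S \<zero>\<^bsub>R\<^esub> \<one>\<^bsub>R\<^esub>,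
      add = (\<lambda>P Q. \<Union>(a, s)\<in>P. \<Union>(b, t)\<in>Q.
               fraction R S ((a \<otimes>\<^bsub>R\<^esub> t) \<oplus>\<^bsub>R\<^esub> (b \<otimes>\<^bsub>R\<^esub> s)) (s \<otimes>\<^bsub>R\<^esub> t))\<rparr>"

definition krull_dim :: "('a, 'b) ring_scheme \<Rightarrow> enat" where
  "krull_dim R =
     Sup {enat n | n. \<exists>p :: nat \<Rightarrow> 'a set.
            (\<forall>i\<le>n. primeideal (p i) R) \<and> (\<forall>i<n. p i \<subset> p (Suc i))}"

text \<open>The implication below says that \<open>xs ! i\<close> is a nonzerodivisor modulo its predecessors.\<close>

definition regular_sequence :: "('a, 'b) ring_scheme \<Rightarrow> 'a list \<Rightarrow> bool" where
  "regular_sequence R xs \<longleftrightarrow>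
     set xs \<subseteq> carrier R \<and>
     (\<forall>i<length xs. \<forall>b\<in>carrier R.
        xs ! i \<otimes>\<^bsub>R\<^esub> b \<in> Idl\<^bsub>R\<^esub> (set (take i xs)) \<longrightarrow> b \<in> Idl\<^bsub>R\<^esub> (set (take i xs))) \<and>
     Idl\<^bsub>R\<^esub> (set xs) \<noteq> carrier R"

definition depth :: "('a, 'b) ring_scheme \<Rightarrow> 'a set \<Rightarrow> enat" where
  "depth R I = Sup {enat (length xs) | xs. set xs \<subseteq> I \<and> regular_sequence R xs}"

definition cohen_macaulay_local :: "('a, 'b) ring_scheme \<Rightarrow> bool" where
  "cohen_macaulay_local R \<longleftrightarrow>
     cring R \<and> noetherian_ring R \<and>
     (\<exists>M. {M'. maximalideal M' R} = {M} \<and> depth R M = krull_dim R)"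

definition cohen_macaulay :: "('a, 'b) ring_scheme \<Rightarrow> bool" where
  "cohen_macaulay R \<longleftrightarrow>
     cring R \<and> noetherian_ring R \<and>
     (\<forall>M. maximalideal M R \<longrightarrow> cohen_macaulay_local (localization R (carrier R - M)))"


section \<open>Polynomial rings and linear resolutions\<close>

text \<open>
  The polynomial ring over \<open>'k\<close> with one variable for each element of \<open>'v\<close>.
\<close>

type_synonym ('v, 'k) mpoly = "('v \<Rightarrow>\<^sub>0 nat) \<Rightarrow>\<^sub>0 'k"

abbreviation mpoly_ring :: "('v, 'k::field) mpoly ring" where
  "mpoly_ring \<equiv> ring_of_type_algebra"

definition pvar :: "'v \<Rightarrow> ('v, 'k::field) mpoly" where
  "pvar v = Poly_Mapping.single (Poly_Mapping.single v 1) 1"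

definition mon_degree :: "('v::finite \<Rightarrow>\<^sub>0 nat) \<Rightarrow> nat" where
  "mon_degree m = (\<Sum>v\<in>UNIV. Poly_Mapping.lookup m v)"

text \<open>The zero polynomial is homogeneous of every degree, negative ones included.\<close>

definition homogeneous :: "int \<Rightarrow> ('v::finite, 'k::field) mpoly \<Rightarrow> bool" where
  "homogeneous d p \<longleftrightarrow> (\<forall>m\<in>Poly_Mapping.keys p. int (mon_degree m) = d)"

text \<open>
  Write \<open>S\<close> for the polynomial ring. The list \<open>D i\<close> consists of the degrees of a homogeneous basis
  of the \<open>i\<close>-th free module \<open>F\<^sub>i\<close>, so \<open>F\<^sub>i\<close> is the direct sum of the \<open>S(-D i ! j)\<close>. The map from
  \<open>F\<^sub>i\<^sub>+\<^sub>1\<close> to \<open>F\<^sub>i\<close> has the matrix \<open>\<phi> i\<close>, and the augmentation from \<open>F\<^sub>0\<close> onto the ideal \<open>I\<close> has the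
  row vector \<open>g\<close>; all these maps have degree 0.
\<close>

definition graded_free_resolution ::
  "('v::finite, 'k::field) mpoly set \<Rightarrow> (nat \<Rightarrow> int list) \<Rightarrow>
   ('v, 'k) mpoly vec \<Rightarrow> (nat \<Rightarrow> ('v, 'k) mpoly mat) \<Rightarrow> bool" where
  "graded_free_resolution I D g \<phi> \<longleftrightarrow>
     g \<in> carrier_vec (length (D 0)) \<and>
     (\<forall>j<length (D 0). homogeneous (D 0 ! j) (g $ j)) \<and>
     (\<forall>i. \<phi> i \<in> carrier_mat (length (D i)) (length (D (Suc i)))) \<and>
     (\<forall>i. \<forall>r<length (D i). \<forall>c<length (D (Suc i)).
        homogeneous (D (Suc i) ! c - D i ! r) (\<phi> i $$ (r, c))) \<and>
     (\<lambda>v. g \<bullet> v) ` carrier_vec (length (D 0)) = I \<and>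
     {v \<in> carrier_vec (length (D 0)). g \<bullet> v = 0} =
       (\<lambda>w. \<phi> 0 *\<^sub>v w) ` carrier_vec (length (D 1)) \<and>
     (\<forall>i. {v \<in> carrier_vec (length (D (Suc i))). \<phi> i *\<^sub>v v = 0\<^sub>v (length (D i))} =
       (\<lambda>w. \<phi> (Suc i) *\<^sub>v w) ` carrier_vec (length (D (Suc (Suc i)))))"

text \<open>
  Minimality: the image of \<open>F\<^sub>i\<^sub>+\<^sub>1\<close> lies in the product of the graded maximal ideal with \<open>F\<^sub>i\<close>,
  that is, every matrix entry has constant term 0.
\<close>

definition minimal_graded_free_resolution ::
  "('v::finite, 'k::field) mpoly set \<Rightarrow> (nat \<Rightarrow> int list) \<Rightarrow>
   ('v, 'k) mpoly vec \<Rightarrow> (nat \<Rightarrow> ('v, 'k) mpoly mat) \<Rightarrow> bool" where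
  "minimal_graded_free_resolution I D g \<phi> \<longleftrightarrow>
     graded_free_resolution I D g \<phi> \<and>
     (\<forall>i. \<forall>r<length (D i). \<forall>c<length (D (Suc i)). Poly_Mapping.lookup (\<phi> i $$ (r, c)) 0 = 0)"

definition has_linear_resolution :: "('v::finite, 'k::field) mpoly set \<Rightarrow> bool" where
  "has_linear_resolution I \<longleftrightarrow>
     (\<exists>D g \<phi>. minimal_graded_free_resolution I D g \<phi> \<and>
        (\<exists>d. \<forall>i. \<forall>e\<in>set (D i). e = d + int i))"


section \<open>Graphs\<close>

text \<open>
  A finite simple graph is given by its set of edges, each a set of two vertices; its vertex set is
  the whole finite type \<open>'v\<close>.
\<close>

definition vertex_cover :: "'v set set \<Rightarrow> 'v set \<Rightarrow> bool" where
  "vertex_cover E C \<longleftrightarrow> (\<forall>e\<in>E. e \<inter> C \<noteq> {})"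

definition minimal_vertex_cover :: "'v set set \<Rightarrow> 'v set \<Rightarrow> bool" where
  "minimal_vertex_cover E C \<longleftrightarrow> vertex_cover E C \<and> (\<forall>C'. C' \<subset> C \<longrightarrow> \<not> vertex_cover E C')"

definition cover_ideal :: "'v::finite set set \<Rightarrow> ('v, 'k::field) mpoly set" where
  "cover_ideal E = Idl\<^bsub>mpoly_ring\<^esub> {\<Prod>v\<in>C. pvar v | C. minimal_vertex_cover E C}"

definition edge_ideal :: "'v::finite set set \<Rightarrow> ('v, 'k::field) mpoly set" where
  "edge_ideal E = Idl\<^bsub>mpoly_ring\<^esub> {pvar u * pvar v | u v. {u, v} \<in> E}"

definition cohen_macaulay_graph :: "'k::field itself \<Rightarrow> 'v::finite set set \<Rightarrow> bool" where
  "cohen_macaulay_graph _ E \<longleftrightarrow> cohen_macaulay (mpoly_ring Quot (edge_ideal E :: ('v, 'k) mpoly set))"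

text \<open>Connectedness of the graph with vertex set \<open>W\<close> and edge set \<open>B\<close>.\<close>

definition connected_graph :: "'v set \<Rightarrow> 'v set set \<Rightarrow> bool" where
  "connected_graph W B \<longleftrightarrow> W \<noteq> {} \<and> (\<forall>u\<in>W. \<forall>v\<in>W. (u, v) \<in> {(a, b). {a, b} \<in> B}\<^sup>*)"

definition bipartite_graph :: "'v set \<Rightarrow> 'v set \<Rightarrow> 'v set set \<Rightarrow> bool" where
  "bipartite_graph VX VY B \<longleftrightarrow> VX \<inter> VY = {} \<and> B \<subseteq> {{x, y} | x y. x \<in> VX \<and> y \<in> VY}"

text \<open>
  \<open>B\<close> is the edge set of the bipartite graph on \<open>VX \<union> VY\<close>. \<open>L\<close> is the set of the attached leaves, the
  leaf \<open>l\<close> being attached to \<open>f l\<close>; every vertex in \<open>VX\<close> has a leaf as \<open>f\<close> is onto \<open>VX\<close>. \<open>T\<close> is the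
  set of the pairs of new vertices of the pendant triangles, the pair \<open>t\<close> forming a triangle
  with \<open>h t\<close>.
\<close>

definition cameron_walker_graph :: "'v::finite set set \<Rightarrow> bool" where
  "cameron_walker_graph E \<longleftrightarrow>
     (\<exists>VX VY B L f T h.
        bipartite_graph VX VY B \<and> connected_graph (VX \<union> VY) B \<and>
        f ` L = VX \<and>
        disjoint T \<and> (\<forall>t\<in>T. card t = 2) \<and> h ` T \<subseteq> VY \<and>
        L \<inter> (VX \<union> VY) = {} \<and> \<Union>T \<inter> (VX \<union> VY) = {} \<and> L \<inter> \<Union>T = {} \<and>
        VX \<union> VY \<union> L \<union> \<Union>T = UNIV \<and>
        E = B \<union> {{l, f l} | l. l \<in> L} \<union> T \<union> {{h t, a} | t a. t \<in> T \<and> a \<in> t})"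

end

theory Submission
  imports Defs
begin

text \<open>
  Let \<open>S\<close> be the polynomial ring on the vertices. Algebra turns the Cohen-Macaulay hypothesis into a
  statement about minimal covers, this determines the shape of the graph and of the powers of its
  cover ideal, and a general construction provides the linear resolutions.

  Cohen-Macaulay graphs are unmixed, meaning that all minimal vertex covers have the same size
  (\<open>cohen_macaulay_cover_card_eq\<close>). Let \<open>C\<close> and \<open>C'\<close> be minimal covers and localize \<open>S/I\<close>, for the edge
  ideal \<open>I\<close>, at the ideal of the origin. Adding the variables outside \<open>C\<close> one at a time to the prime
  ideal generated by \<open>C\<close> gives a chain of primes, so the dimension is at least the size of the
  complement of \<open>C\<close>. The depth is at most the size \<open>d\<close> of the complement of \<open>C'\<close>: the product \<open>a\<close> of the
  variables outside \<open>C'\<close> is killed by all variables in \<open>C'\<close>; a regular sequence with more than \<open>d\<close>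
  elements, even after raising its members to high powers, satisfies a polynomial relation modulo the
  variables in \<open>C'\<close>; multiplying this relation by \<open>a\<close> and cancelling the regular elements one after the
  other leaves \<open>a\<close> in the ideal generated by the high powers, which is absurd since \<open>a\<close> has
  degree \<open>d\<close>.

  Comparing three minimal covers shows that an unmixed Cameron-Walker graph with more than one vertex has
  exactly one leaf at each vertex of \<open>X\<close> and exactly one triangle at each vertex of \<open>Y\<close>. Hence its
  vertices are partitioned into cliques, each with at most one vertex, its hub, that has neighbours
  outside the clique, and the edges between different cliques form a bipartite graph on the hubs. The
  graph with a single vertex fits this description as well.

  For such a graph the minimal covers omit exactly one vertex from each clique, never both ends of an
  edge. Counting omissions, the generators of the \<open>k\<close>-th power of the cover ideal correspond to the
  functions \<open>\<alpha>\<close> on the vertices with sum \<open>k\<close> on each clique and \<open>\<alpha> x + \<alpha> y \<le> k\<close> on each edge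
  between hubs (\<open>cover_ideal_power\<close>); that every such \<open>\<alpha>\<close> is a sum of \<open>k\<close> such omission patterns uses
  bipartiteness. Ordered lexicographically with the hubs in \<open>Y\<close> first, these monomials have linear
  quotients: at the first vertex where two of them differ, a unit can be moved inside the clique
  (\<open>exchange\<close>).

  Finally, linear quotients give a linear resolution. Call a list of homogeneous vectors of the same
  degree good if, for each vector, the polynomials whose product with it lies in the span of its
  predecessors form an ideal generated by variables. The syzygies of a good list are generated by linear
  ones that can again be ordered into a good list (\<open>linear_quotients_syzygy_step\<close>), so the construction
  can be iterated forever.
\<close>

abbreviation lookup :: "('a \<Rightarrow>\<^sub>0 'b::zero) \<Rightarrow> 'a \<Rightarrow> 'b" where "lookup \<equiv> Poly_Mapping.lookup"
abbreviation single :: "'a \<Rightarrow> 'b \<Rightarrow> 'a \<Rightarrow>\<^sub>0 'b::zero" where "single \<equiv> Poly_Mapping.single"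
abbreviation keys :: "('a \<Rightarrow>\<^sub>0 'b::zero) \<Rightarrow> 'a set" where "keys \<equiv> Poly_Mapping.keys"

section \<open>Homogeneous components and ideals generated by variables\<close>

lemma finite_obtain_sorted_list:
  fixes f :: "'a \<Rightarrow> 'b::linorder"
  assumes "finite S"
  shows "\<exists>ps. distinct ps \<and> set ps = S \<and> sorted (map f ps)"
proof -
  obtain xs where "set xs = S" "distinct xs"
    using finite_distinct_list[OF assms] by blast
  then show ?thesis
    by (intro exI[of _ "sort_key f xs"]) simp
qed

lemma mon_degree_add: "mon_degree (a + b) = mon_degree a + mon_degree b"
  by (simp add: mon_degree_def lookup_add sum.distrib)

definition homogeneous_part :: "nat \<Rightarrow> ('v::finite, 'k::field) mpoly \<Rightarrow> ('v, 'k) mpoly" where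
  "homogeneous_part n p = (\<Sum>m\<in>{m \<in> keys p. mon_degree m = n}.
     single m (lookup p m))"

lemma lookup_homogeneous_part:
  "lookup (homogeneous_part n p) m = (if mon_degree m = n then lookup p m else 0)"
proof -
  have "lookup (homogeneous_part n p) m =
      (\<Sum>m'\<in>{m \<in> keys p. mon_degree m = n}.
         if m' = m then lookup p m' else 0)"
    unfolding homogeneous_part_def lookup_sum
    by (intro sum.cong refl) (simp add: lookup_single when_def)
  also have "\<dots> = (if mon_degree m = n then lookup p m else 0)"
    by (subst sum.delta) (auto simp: in_keys_iff)
  finally show ?thesis .
qed

lemma keys_homogeneous_part: "keys (homogeneous_part n p) = {m \<in> keys p. mon_degree m = n}"
  by (auto simp: in_keys_iff lookup_homogeneous_part split: if_splits)

lemma homogeneous_part_add: "homogeneous_part n (p + q) = homogeneous_part n p + homogeneous_part n q"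
  by (rule poly_mapping_eqI) (simp add: lookup_homogeneous_part lookup_add)

lemma homogeneous_part_zero [simp]: "homogeneous_part n 0 = 0"
  by (simp add: homogeneous_part_def)

lemma homogeneous_part_sum: "homogeneous_part n (\<Sum>i\<in>A. f i) = (\<Sum>i\<in>A. homogeneous_part n (f i))"
  by (induction A rule: infinite_finite_induct) (auto simp: homogeneous_part_add)

lemma homogeneous_homogeneous_part: "homogeneous (int n) (homogeneous_part n p)"
  by (auto simp: homogeneous_def keys_homogeneous_part)

lemma homogeneous_part_homogeneous: "homogeneous (int n) p \<Longrightarrow> homogeneous_part n p = p"
  by (rule poly_mapping_eqI) (auto simp: lookup_homogeneous_part homogeneous_def in_keys_iff)

lemma homogeneous_mult:
  assumes "homogeneous a p" "homogeneous b q"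
  shows "homogeneous (a + b) (p * q)"
  using assms keys_mult[of p q] unfolding homogeneous_def by (fastforce simp: mon_degree_add)

text \<open>
  Multiplication by a homogeneous polynomial shifts degrees, so the part of \<open>q\<close> outside degree \<open>n\<close>
  contributes nothing to degree \<open>d + n\<close>.
\<close>

lemma homogeneous_part_mult_homogeneous:
  assumes "homogeneous (int d) p"
  shows "homogeneous_part (d + n) (p * q) = p * homogeneous_part n q"
proof -
  define r where "r = q - homogeneous_part n q"
  have r: "mon_degree m \<noteq> n" if "m \<in> keys r" for m
    using that by (auto simp: r_def in_keys_iff lookup_minus lookup_homogeneous_part split: if_splits)
  have "mon_degree m \<noteq> d + n" if "m \<in> keys (p * r)" for m
    using that keys_mult[of p r] assms r unfolding homogeneous_def
    by (fastforce simp: mon_degree_add)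
  then have 1: "homogeneous_part (d + n) (p * r) = 0"
    unfolding homogeneous_part_def by (intro sum.neutral) auto
  have 2: "homogeneous_part (d + n) (p * homogeneous_part n q) = p * homogeneous_part n q"
    using homogeneous_mult[OF assms homogeneous_homogeneous_part[of n q]]
    by (intro homogeneous_part_homogeneous) simp
  have "p * q = p * homogeneous_part n q + p * r"
    by (simp add: r_def algebra_simps)
  then show ?thesis
    using 1 2 by (simp add: homogeneous_part_add)
qed

lemma pvar_homogeneous: "homogeneous 1 (pvar v)"
  by (auto simp: homogeneous_def pvar_def mon_degree_def lookup_single when_def)

text \<open>
  The ideal generated by the variables in \<open>A\<close>, described by its monomials; \<open>vars_ideal_lin_comb\<close> gives
  the description by generators.
\<close>

definition vars_ideal :: "'v set \<Rightarrow> ('v, 'k::field) mpoly set" where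
  "vars_ideal A = {p. \<forall>m\<in>keys p. \<exists>v\<in>A. lookup m v \<noteq> 0}"

lemma vars_ideal_zero [simp]: "0 \<in> vars_ideal A"
  by (simp add: vars_ideal_def)

lemma vars_ideal_add: "p \<in> vars_ideal A \<Longrightarrow> q \<in> vars_ideal A \<Longrightarrow> p + q \<in> vars_ideal A"
  using keys_add[of p q] unfolding vars_ideal_def by blast

lemma vars_ideal_mult: "q \<in> vars_ideal A \<Longrightarrow> p * q \<in> vars_ideal A"
proof -
  assume q: "q \<in> vars_ideal A"
  have "\<exists>v\<in>A. lookup m v \<noteq> 0" if m: "m \<in> keys (p * q)" for m
  proof -
    obtain a b where "m = a + b" "b \<in> keys q"
      using keys_mult[of p q] m by blast
    then show ?thesis using q by (auto simp: vars_ideal_def lookup_add)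
  qed
  then show ?thesis by (simp add: vars_ideal_def)
qed

lemma vars_ideal_uminus: "p \<in> vars_ideal A \<Longrightarrow> - p \<in> vars_ideal A"
  by (auto simp: vars_ideal_def in_keys_iff)

lemma vars_ideal_sum: "(\<And>i. i \<in> S \<Longrightarrow> f i \<in> vars_ideal A) \<Longrightarrow> (\<Sum>i\<in>S. f i) \<in> vars_ideal A"
  by (induction S rule: infinite_finite_induct) (auto intro: vars_ideal_add)

lemma pvar_in_vars_ideal: "v \<in> A \<Longrightarrow> pvar v \<in> vars_ideal A"
  by (auto simp: vars_ideal_def pvar_def lookup_single intro!: bexI[of _ v])

lemma mpoly_sum_single:
  "p = (\<Sum>m\<in>keys p. single m (lookup p m))"
  by (rule poly_mapping_eqI) (auto simp: lookup_sum lookup_single when_def sum.delta in_keys_iff)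

lemma pvar_dvd_single:
  fixes a :: "'k::field"
  assumes "lookup m v \<noteq> 0"
  shows "single m a =
    single (m - single v 1) a * pvar v"
proof -
  have "m - single v 1 + single v 1 = m"
    using assms
    by (intro poly_mapping_eqI) (auto simp: lookup_add lookup_minus lookup_single when_def)
  then show ?thesis by (simp add: pvar_def mult_single)
qed

text \<open>
  Every monomial of \<open>p\<close> is a multiple of some variable in \<open>A\<close>; grouping the monomials by a choice of such
  a variable gives the coefficients.
\<close>

lemma vars_ideal_lin_comb:
  assumes "p \<in> vars_ideal A" "finite A"
  shows "\<exists>c. p = (\<Sum>v\<in>A. c v * pvar v)"
proof -
  obtain w where w: "w m \<in> A" "lookup m (w m) \<noteq> 0"
    if "m \<in> keys p" for m
    using assms(1) unfolding vars_ideal_def by (auto simp: Bex_def) metis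
  define t where "t m = single (m - single (w m) 1)
    (lookup p m)" for m
  have t: "single m (lookup p m) = t m * pvar (w m)"
    if "m \<in> keys p" for m
    unfolding t_def by (rule pvar_dvd_single) (rule w(2)[OF that])
  have "p = (\<Sum>m\<in>keys p. t m * pvar (w m))"
    by (subst mpoly_sum_single[of p]) (intro sum.cong refl t)
  also have "\<dots> = (\<Sum>v\<in>A. \<Sum>m\<in>{m \<in> keys p. w m = v}. t m * pvar (w m))"
    by (rule sum.group[symmetric]) (use assms(2) w in auto)
  also have "\<dots> = (\<Sum>v\<in>A. (\<Sum>m\<in>{m \<in> keys p. w m = v}. t m) * pvar v)"
    by (intro sum.cong refl) (simp add: sum_distrib_right)
  finally show ?thesis
    by (intro exI[of _ "\<lambda>v. \<Sum>m\<in>{m \<in> keys p. w m = v}. t m"])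
qed

lemma lookup_mult_single_add:
  fixes p :: "('v, 'k::field) mpoly"
  shows "lookup (p * single n 1) (m + n) = lookup p m"
proof -
  have eq: "p * single n 1 =
    (\<Sum>l\<in>keys p. single (l + n) (lookup p l))"
    by (subst mpoly_sum_single[of p]) (simp add: sum_distrib_right mult_single)
  show ?thesis
    unfolding eq by (auto simp: lookup_sum lookup_single when_def sum.delta in_keys_iff)
qed

lemma vars_ideal_prime_pvar:
  assumes "p * pvar v \<in> vars_ideal A" "v \<notin> A"
  shows "p \<in> vars_ideal A"
proof -
  have "\<exists>a\<in>A. lookup m a \<noteq> 0" if "m \<in> keys p" for m
  proof -
    have "m + single v 1 \<in> keys (p * pvar v)"
      using that by (simp add: in_keys_iff pvar_def lookup_mult_single_add del: single_one)
    with assms(1) obtain a where "a \<in> A" "lookup (m + single v 1) a \<noteq> 0"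
      unfolding vars_ideal_def by blast
    then show ?thesis
      using assms(2) by (auto simp: lookup_add lookup_single when_def intro!: bexI[of _ a] split: if_splits)
  qed
  then show ?thesis by (auto simp: vars_ideal_def)
qed

section \<open>Lists of vectors with linear quotients and their syzygies\<close>

text \<open>
  Matrices and vectors are functions on the natural numbers of which only the entries below the given
  bounds matter. This avoids index bookkeeping in the iterated construction.
\<close>

definition syzygies :: "nat \<Rightarrow> nat \<Rightarrow> (nat \<Rightarrow> nat \<Rightarrow> 'a::comm_ring_1) \<Rightarrow> (nat \<Rightarrow> 'a) set" where
  "syzygies r m \<phi> = {w. \<forall>i<r. (\<Sum>c<m. \<phi> i c * w c) = 0}"

text \<open>
  The set on the left is the ideal of those \<open>f\<close> for which \<open>f\<close> times column \<open>j\<close> lies in the span of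
  the earlier columns. For a row of monomials this is the usual notion of linear quotients; stating
  it through syzygies lets the same notion apply to the matrices of a resolution.
\<close>

definition linear_quotients ::
  "nat \<Rightarrow> nat \<Rightarrow> (nat \<Rightarrow> nat \<Rightarrow> ('v::finite, 'k::field) mpoly) \<Rightarrow> (nat \<Rightarrow> 'v set) \<Rightarrow> bool" where
  "linear_quotients r m \<phi> V \<longleftrightarrow>
     (\<forall>j<m. {w j | w. w \<in> syzygies r m \<phi> \<and> (\<forall>i. j < i \<longrightarrow> i < m \<longrightarrow> w i = 0)} = vars_ideal (V j))"

lemma syzygies_diff: "w \<in> syzygies r m \<phi> \<Longrightarrow> u \<in> syzygies r m \<phi> \<Longrightarrow> (\<lambda>i. w i - u i) \<in> syzygies r m \<phi>"
  by (simp add: syzygies_def sum_subtractf right_diff_distrib)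

lemma syzygies_scale: "w \<in> syzygies r m \<phi> \<Longrightarrow> (\<lambda>i. a * w i) \<in> syzygies r m \<phi>"
  by (simp add: syzygies_def mult.left_commute[of _ a] sum_distrib_left[symmetric])

lemma syzygies_sum:
  assumes "\<And>t. t \<in> T \<Longrightarrow> w t \<in> syzygies r m \<phi>"
  shows "(\<lambda>i. \<Sum>t\<in>T. a t * w t i) \<in> syzygies r m \<phi>"
proof -
  have "(\<Sum>c<m. \<phi> i c * (\<Sum>t\<in>T. a t * w t c)) = 0" if "i < r" for i
  proof -
    have "(\<Sum>c<m. \<phi> i c * (\<Sum>t\<in>T. a t * w t c)) = (\<Sum>t\<in>T. a t * (\<Sum>c<m. \<phi> i c * w t c))"
      by (simp add: sum_distrib_left mult.left_commute) (rule sum.swap)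
    also have "\<dots> = 0"
      using assms that by (intro sum.neutral) (simp add: syzygies_def)
    finally show ?thesis .
  qed
  then show ?thesis by (simp add: syzygies_def)
qed

text \<open>
  A variable times column \<open>j\<close> lies in the span of the earlier columns. All columns are homogeneous of the
  same degree, so passing to the linear parts of the coefficients of such a relation leaves a relation.
\<close>

lemma linear_syzygy_exists:
  assumes lq: "linear_quotients r m \<phi> V"
    and hom: "\<And>i c. i < r \<Longrightarrow> c < m \<Longrightarrow> homogeneous (int d) (\<phi> i c)"
    and j: "j < m" and v: "v \<in> V j"
  shows "\<exists>w. w \<in> syzygies r m \<phi> \<and> w j = pvar v \<and> (\<forall>i. j < i \<longrightarrow> i < m \<longrightarrow> w i = 0) \<and>
           (\<forall>i. homogeneous 1 (w i))"
proof -
  have "pvar v \<in> {w j | w. w \<in> syzygies r m \<phi> \<and> (\<forall>i. j < i \<longrightarrow> i < m \<longrightarrow> w i = 0)}"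
    using lq j v pvar_in_vars_ideal[OF v] unfolding linear_quotients_def by blast
  then obtain w where w: "w \<in> syzygies r m \<phi>" "w j = pvar v" "\<And>i. j < i \<Longrightarrow> i < m \<Longrightarrow> w i = 0"
    by auto
  have "(\<lambda>i. homogeneous_part 1 (w i)) \<in> syzygies r m \<phi>"
    unfolding syzygies_def
  proof (clarify)
    fix i assume i: "i < r"
    have "(\<Sum>c<m. \<phi> i c * homogeneous_part 1 (w c)) = homogeneous_part (d + 1) (\<Sum>c<m. \<phi> i c * w c)"
      unfolding homogeneous_part_sum by (intro sum.cong refl homogeneous_part_mult_homogeneous[symmetric] hom i) simp
    also have "\<dots> = 0" using w(1) i by (simp add: syzygies_def)
    finally show "(\<Sum>c<m. \<phi> i c * homogeneous_part 1 (w c)) = 0" .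
  qed
  moreover have "homogeneous_part 1 (w j) = pvar v"
    unfolding w(2) by (rule homogeneous_part_homogeneous) (simp add: pvar_homogeneous)
  moreover have "\<forall>i. homogeneous 1 (homogeneous_part 1 (w i))"
    by (metis homogeneous_homogeneous_part of_nat_1)
  ultimately show ?thesis using w(3) by (intro exI[of _ "\<lambda>i. homogeneous_part 1 (w i)"]) auto
qed

text \<open>
  For each column \<open>j\<close> and each variable \<open>v\<close> in \<open>V j\<close>, a syzygy \<open>\<sigma> (j, v)\<close> with leading entry \<open>v\<close> in
  position \<open>j\<close>. Listed by increasing \<open>j\<close>, these syzygies are the columns of the next matrix \<open>\<psi>\<close>.
\<close>

locale linear_syzygies =
  fixes r m :: nat and \<phi> :: "nat \<Rightarrow> nat \<Rightarrow> ('v::finite, 'k::field) mpoly" and V :: "nat \<Rightarrow> 'v set"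
    and ps :: "(nat \<times> 'v) list" and \<sigma> :: "nat \<times> 'v \<Rightarrow> nat \<Rightarrow> ('v, 'k) mpoly"
  assumes lq: "linear_quotients r m \<phi> V"
    and ps: "distinct ps" "set ps = (SIGMA j:{..<m}. V j)" "sorted (map fst ps)"
    and \<sigma>: "\<And>q. q \<in> set ps \<Longrightarrow> \<sigma> q \<in> syzygies r m \<phi>"
      "\<And>q. q \<in> set ps \<Longrightarrow> \<sigma> q (fst q) = pvar (snd q)"
      "\<And>q i. q \<in> set ps \<Longrightarrow> fst q < i \<Longrightarrow> i < m \<Longrightarrow> \<sigma> q i = 0"
begin

abbreviation m' :: nat where "m' \<equiv> length ps"

abbreviation \<psi> :: "nat \<Rightarrow> nat \<Rightarrow> ('v, 'k) mpoly" where "\<psi> i c \<equiv> \<sigma> (ps ! c) i"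

abbreviation P :: "(nat \<times> 'v) set" where "P \<equiv> set ps"

lemma set_ps: "P = (SIGMA j:{..<m}. V j)"
  by (rule ps(2))

lemma nth_ps: "c < m' \<Longrightarrow> ps ! c \<in> P"
  by simp

lemma sum_nth_ps: "(\<Sum>c<m'. f (ps ! c)) = (\<Sum>q\<in>P. f q)" for f :: "nat \<times> 'v \<Rightarrow> ('v, 'k) mpoly"
proof -
  have "bij_betw ((!) ps) {..<m'} P"
    using ps(1) by (metis bij_betw_nth)
  from sum.reindex_bij_betw[OF this, of f] show ?thesis .
qed

lemma fst_nth_mono: "a \<le> b \<Longrightarrow> b < m' \<Longrightarrow> fst (ps ! a) \<le> fst (ps ! b)"
  using sorted_nth_mono[OF ps(3), of a b] by simp

text \<open>
  The variables that make up the quotient ideal of the column \<open>\<sigma> (j, v)\<close>: those listed before \<open>v\<close> in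
  the block of \<open>j\<close>.
\<close>

definition next_vars :: "nat \<Rightarrow> 'v set" where
  "next_vars c = {v. \<exists>b<c. ps ! b = (fst (ps ! c), v)}"

text \<open>
  A syzygy supported on the first \<open>n\<close> positions is a combination of the \<open>\<sigma> q\<close> with leading position below
  \<open>n\<close>: its last entry is a combination of variables, and subtracting the corresponding \<open>\<sigma> q\<close>
  shortens the support. Keeping track of the support is what later puts combinations into the span of
  \<^emph>\<open>earlier\<close> columns.
\<close>

lemma syzygies_spanned: "\<exists>u. (\<forall>i<m. w i = (\<Sum>q\<in>P. \<sigma> q i * u q)) \<and> (\<forall>q\<in>P. n \<le> fst q \<longrightarrow> u q = 0)"
  if "w \<in> syzygies r m \<phi>" "\<forall>i. n \<le> i \<longrightarrow> i < m \<longrightarrow> w i = 0" "n \<le> m" for n w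
  using that
proof (induction n arbitrary: w)
  case 0
  then show ?case by (intro exI[of _ "\<lambda>_. 0"]) auto
next
  case (Suc n)
  have n: "n < m" using Suc.prems(3) by simp
  have "w n \<in> {w n | w. w \<in> syzygies r m \<phi> \<and> (\<forall>i. n < i \<longrightarrow> i < m \<longrightarrow> w i = 0)}"
    using Suc.prems by auto
  then have "w n \<in> vars_ideal (V n)"
    using lq n unfolding linear_quotients_def by blast
  then obtain c where c: "w n = (\<Sum>v\<in>V n. c v * pvar v)"
    using vars_ideal_lin_comb[of "w n" "V n"] by auto
  define w' where "w' i = w i - (\<Sum>v\<in>V n. c v * \<sigma> (n, v) i)" for i
  have inP: "(n, v) \<in> P" if "v \<in> V n" for v using that n by (simp add: set_ps)
  have w'1: "w' \<in> syzygies r m \<phi>"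
    unfolding w'_def by (intro syzygies_diff syzygies_sum Suc.prems \<sigma> inP)
  have w'2: "w' i = 0" if "n \<le> i" "i < m" for i
  proof (cases "i = n")
    case True
    show ?thesis unfolding True w'_def c using \<sigma>(2)[OF inP] by simp
  next
    case False
    then have "(\<Sum>v\<in>V n. c v * \<sigma> (n, v) i) = 0"
      using that \<sigma>(3)[OF inP] by (intro sum.neutral) auto
    then show ?thesis using Suc.prems(2) that False by (simp add: w'_def)
  qed
  obtain u where u: "\<And>i. i < m \<Longrightarrow> w' i = (\<Sum>q\<in>P. \<sigma> q i * u q)"
      "\<And>q. q \<in> P \<Longrightarrow> n \<le> fst q \<Longrightarrow> u q = 0"
    using Suc.IH[OF w'1] w'2 n by auto
  define u' where "u' q = (if fst q = n then c (snd q) else u q)" for q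
  have "w i = (\<Sum>q\<in>P. \<sigma> q i * u' q)" if i: "i < m" for i
  proof -
    have "(\<Sum>q\<in>P. \<sigma> q i * u' q) = (\<Sum>q\<in>P. \<sigma> q i * u q) + (\<Sum>q\<in>P. if fst q = n then \<sigma> q i * c (snd q) else 0)"
      unfolding sum.distrib[symmetric] by (intro sum.cong refl) (auto simp: u'_def u(2))
    also have "(\<Sum>q\<in>P. if fst q = n then \<sigma> q i * c (snd q) else 0) =
        (\<Sum>q\<in>(\<lambda>v. (n, v)) ` V n. \<sigma> q i * c (snd q))"
      using n finite_set by (intro sum.mono_neutral_cong_right) (auto simp: set_ps)
    also have "\<dots> = (\<Sum>v\<in>V n. c v * \<sigma> (n, v) i)"
      by (subst sum.reindex) (auto simp: inj_on_def mult.commute)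
    finally show ?thesis using u(1)[OF i] by (simp add: w'_def diff_eq_eq)
  qed
  moreover have "u' q = 0" if "q \<in> P" "Suc n \<le> fst q" for q
    using that u(2) by (simp add: u'_def)
  ultimately show ?case by blast
qed
lemma syzygies_eq_image: "syzygies r m \<phi> = {w. \<exists>u. \<forall>i<m. w i = (\<Sum>c<m'. \<psi> i c * u c)}" (is "_ = ?R")
proof (intro equalityI subsetI)
  fix w assume w: "w \<in> syzygies r m \<phi>"
  obtain u where u: "\<And>i. i < m \<Longrightarrow> w i = (\<Sum>q\<in>P. \<sigma> q i * u q)"
    using syzygies_spanned[OF w, of m] by auto
  have "w i = (\<Sum>c<m'. \<psi> i c * u (ps ! c))" if "i < m" for i
    unfolding u[OF that] sum_nth_ps[symmetric] by (intro sum.cong) auto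
  then show "w \<in> ?R" by (intro CollectI exI[of _ "\<lambda>c. u (ps ! c)"]) blast
next
  fix w assume "w \<in> ?R"
  then obtain u where u: "\<And>i. i < m \<Longrightarrow> w i = (\<Sum>c<m'. \<psi> i c * u c)" by auto
  have "(\<lambda>i. \<Sum>c<m'. u c * \<psi> i c) \<in> syzygies r m \<phi>"
    by (rule syzygies_sum[of "{..<m'}" "\<lambda>c i. \<psi> i c"]) (simp add: \<sigma>(1))
  then show "w \<in> syzygies r m \<phi>"
    using u by (simp add: syzygies_def mult.commute)
qed
text \<open>
  Let \<open>\<sigma> (j, v)\<close> be column \<open>c\<close>. In a relation with last coefficient \<open>f\<close> at this column, comparing entries in
  position \<open>j\<close> shows that \<open>f v\<close> is a combination of the variables preceding \<open>v\<close> in its block; an ideal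
  generated by variables is prime, so \<open>f\<close> itself is. Conversely, for such a variable \<open>x\<close>, the syzygy
  \<open>x \<sigma> (j, v) - v \<sigma> (j, x)\<close> vanishes from position \<open>j\<close> on, hence is spanned by earlier columns.
\<close>

lemma leading_entries_next_syzygies:
  assumes c: "c < m'"
  shows "{w c | w. w \<in> syzygies m m' \<psi> \<and> (\<forall>i. c < i \<longrightarrow> i < m' \<longrightarrow> w i = 0)} = vars_ideal (next_vars c)"
  (is "?L = _")
proof (intro equalityI subsetI)
  fix f assume "f \<in> ?L"
  then obtain w where w: "f = w c" "w \<in> syzygies m m' \<psi>" "\<And>i. c < i \<Longrightarrow> i < m' \<Longrightarrow> w i = 0"
    by auto
  define j where "j = fst (ps ! c)"
  define v where "v = snd (ps ! c)"
  have j: "j < m" using nth_ps[OF c] by (auto simp: j_def set_ps)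
  have summand: "\<psi> j b * w b \<in> vars_ideal (next_vars c)" if b: "b < m'" "b \<noteq> c" for b
  proof (cases "b < c")
    case False
    then show ?thesis using w(3)[of b] b by simp
  next
    case True
    show ?thesis
    proof (cases "fst (ps ! b) = j")
      case True
      then have "\<psi> j b = pvar (snd (ps ! b))"
        using \<sigma>(2)[OF nth_ps[OF b(1)]] by simp
      moreover have "snd (ps ! b) \<in> next_vars c"
        unfolding next_vars_def using True \<open>b < c\<close> by (auto simp: j_def intro!: exI[of _ b] prod_eqI)
      ultimately show ?thesis
        using vars_ideal_mult[OF pvar_in_vars_ideal, of _ "next_vars c" "w b"]
        by (simp add: mult.commute[of _ "w b"])
    next
      case False
      then have "fst (ps ! b) < j" using fst_nth_mono[of b c] \<open>b < c\<close> c by (simp add: j_def)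
      then show ?thesis using \<sigma>(3)[OF nth_ps[OF b(1)]] j by simp
    qed
  qed
  have "(\<Sum>b<m'. \<psi> j b * w b) = 0" using w(2) j by (simp add: syzygies_def)
  then have "\<psi> j c * w c + (\<Sum>b\<in>{..<m'} - {c}. \<psi> j b * w b) = 0"
    using sum.remove[of "{..<m'}" c "\<lambda>b. \<psi> j b * w b"] c by simp
  then have "\<psi> j c * w c = - (\<Sum>b\<in>{..<m'} - {c}. \<psi> j b * w b)"
    by (simp add: eq_neg_iff_add_eq_0)
  then have "\<psi> j c * w c \<in> vars_ideal (next_vars c)"
    using summand by (auto intro!: vars_ideal_uminus vars_ideal_sum)
  moreover have "\<psi> j c = pvar v"
    using \<sigma>(2)[OF nth_ps[OF c]] by (simp add:  j_def v_def)
  ultimately have "f * pvar v \<in> vars_ideal (next_vars c)" by (simp add: w(1) mult.commute)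
  moreover have "v \<notin> next_vars c"
    unfolding next_vars_def v_def using ps(1) c
    by (auto simp: distinct_conv_nth )
  ultimately show "f \<in> vars_ideal (next_vars c)" by (rule vars_ideal_prime_pvar)
next
  fix f :: "('v, 'k) mpoly" assume f: "f \<in> vars_ideal (next_vars c)"
  define j where "j = fst (ps ! c)"
  define v where "v = snd (ps ! c)"
  have jv: "(j, v) \<in> P" "ps ! c = (j, v)" using nth_ps[OF c] by (auto simp: j_def v_def)
  have j: "j < m" using jv by (auto simp: set_ps)
  obtain a where a: "f = (\<Sum>v\<in>next_vars c. a v * pvar v)" using vars_ideal_lin_comb[OF f] by auto
  have next_in_P: "(j, x) \<in> P" if x: "x \<in> next_vars c" for x
  proof -
    obtain b where b: "b < c" "ps ! b = (j, x)" using x by (auto simp: next_vars_def j_def)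
    then show ?thesis using nth_ps[of b] c by simp
  qed
  define g where "g i = f * \<sigma> (j, v) i - (\<Sum>x\<in>next_vars c. (a x * pvar v) * \<sigma> (j, x) i)" for i
  have g1: "g \<in> syzygies r m \<phi>"
    unfolding g_def by (intro syzygies_diff syzygies_sum syzygies_scale \<sigma> jv next_in_P)
  have g2: "g i = 0" if "j \<le> i" "i < m" for i
  proof (cases "i = j")
    case True
    have "(\<Sum>x\<in>next_vars c. (a x * pvar v) * \<sigma> (j, x) j) = f * pvar v"
      unfolding a sum_distrib_right using \<sigma>(2)[OF next_in_P] by (intro sum.cong) (auto simp: mult_ac)
    then show ?thesis using \<sigma>(2)[OF jv(1)] by (simp add: g_def True)
  next
    case False
    then have "\<sigma> (j, v) i = 0" "(\<Sum>x\<in>next_vars c. (a x * pvar v) * \<sigma> (j, x) i) = 0"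
      using that \<sigma>(3)[OF jv(1)] \<sigma>(3)[OF next_in_P] by (auto intro!: sum.neutral)
    then show ?thesis by (simp add: g_def)
  qed
  obtain u where u: "\<And>i. i < m \<Longrightarrow> g i = (\<Sum>q\<in>P. \<sigma> q i * u q)"
      "\<And>q. q \<in> P \<Longrightarrow> j \<le> fst q \<Longrightarrow> u q = 0"
    using syzygies_spanned[OF g1, of j] g2 j by auto
  define w where "w q = (if q = (j, v) then f else if q \<in> Pair j ` next_vars c then - (a (snd q) * pvar v) else - u q)" for q
  have nv: "v \<notin> next_vars c"
    unfolding next_vars_def v_def using ps(1) c
    by (auto simp: distinct_conv_nth )
  have "(\<Sum>b<m'. \<psi> i b * w (ps ! b)) = 0" if i: "i < m" for i
  proof -
    have "(\<Sum>b<m'. \<psi> i b * w (ps ! b)) = (\<Sum>q\<in>P. \<sigma> q i * w q)" by (rule sum_nth_ps[of "\<lambda>q. \<sigma> q i * w q"])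
    also have "\<dots> = (\<Sum>q\<in>P. (if q = (j, v) then f * \<sigma> q i else 0) +
        (if q \<in> Pair j ` next_vars c then - (a (snd q) * pvar v) * \<sigma> q i else 0) - \<sigma> q i * u q)"
      using u(2) nv jv(1) by (intro sum.cong refl) (auto simp: w_def)
    also have "\<dots> = f * \<sigma> (j, v) i +
        (\<Sum>q\<in>Pair j ` next_vars c. - (a (snd q) * pvar v) * \<sigma> q i) - g i"
    proof -
      have "(\<Sum>q\<in>P. if q = (j, v) then f * \<sigma> q i else 0) = f * \<sigma> (j, v) i"
        using finite_set jv(1) by (simp add: sum.delta)
      moreover have "(\<Sum>q\<in>P. if q \<in> Pair j ` next_vars c then - (a (snd q) * pvar v) * \<sigma> q i else 0) =
          (\<Sum>q\<in>Pair j ` next_vars c. - (a (snd q) * pvar v) * \<sigma> q i)"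
        using finite_set next_in_P by (intro sum.mono_neutral_cong_right) auto
      ultimately show ?thesis by (simp only: sum_subtractf sum.distrib u(1)[OF i])
    qed
    also have "(\<Sum>q\<in>Pair j ` next_vars c. - (a (snd q) * pvar v) * \<sigma> q i) =
        - (\<Sum>x\<in>next_vars c. (a x * pvar v) * \<sigma> (j, x) i)"
      by (subst sum.reindex) (auto simp: inj_on_def sum_negf)
    finally show ?thesis by (simp add: g_def)
  qed
  then have "(\<lambda>b. w (ps ! b)) \<in> syzygies m m' \<psi>" by (simp add: syzygies_def)
  moreover have "w (ps ! i) = 0" if "c < i" "i < m'" for i
  proof -
    have "j \<le> fst (ps ! i)" using fst_nth_mono[of c i] that by (simp add: j_def)
    moreover have "ps ! i \<noteq> (j, v)"
      using that ps(1) c jv(2) by (metis  nat_neq_iff nth_eq_iff_index_eq)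
    moreover have "ps ! i \<notin> Pair j ` next_vars c"
    proof
      assume "ps ! i \<in> Pair j ` next_vars c"
      then obtain b where "b < c" "ps ! b = ps ! i" by (auto simp: next_vars_def j_def)
      then show False using that ps(1) by (metis less_trans  nat_neq_iff nth_eq_iff_index_eq)
    qed
    ultimately show ?thesis using u(2)[OF nth_ps[OF that(2)]] by (simp add: w_def)
  qed
  moreover have "w (ps ! c) = f" by (simp add: w_def jv(2))
  ultimately show "f \<in> ?L" by (intro CollectI exI[of _ "\<lambda>b. w (ps ! b)"]) auto
qed

lemma linear_quotients_next: "linear_quotients m m' \<psi> next_vars"
  using leading_entries_next_syzygies by (simp add: linear_quotients_def)

end

lemma linear_quotients_syzygy_step:
  fixes \<phi> :: "nat \<Rightarrow> nat \<Rightarrow> ('v::finite, 'k::field) mpoly"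
  assumes lq: "linear_quotients r m \<phi> V"
    and hom: "\<And>i c. i < r \<Longrightarrow> c < m \<Longrightarrow> homogeneous (int d) (\<phi> i c)"
  shows "\<exists>m' \<psi> V'. linear_quotients m m' \<psi> V' \<and> (\<forall>i<m. \<forall>c<m'. homogeneous 1 (\<psi> i c)) \<and>
           syzygies r m \<phi> = {w. \<exists>u. \<forall>i<m. w i = (\<Sum>c<m'. \<psi> i c * u c)}"
proof -
  have "finite (SIGMA j:{..<m}. V j)" by auto
  then obtain ps where ps: "distinct ps" "set ps = (SIGMA j:{..<m}. V j)" "sorted (map fst ps)"
    using finite_obtain_sorted_list by blast
  have "\<exists>w. w \<in> syzygies r m \<phi> \<and> w (fst q) = pvar (snd q) \<and>
      (\<forall>i. fst q < i \<longrightarrow> i < m \<longrightarrow> w i = 0) \<and> (\<forall>i. homogeneous 1 (w i))" if "q \<in> set ps" for q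
    using linear_syzygy_exists[OF lq hom, of "fst q" "snd q"] that by (auto simp: ps(2))
  then obtain \<sigma> where \<sigma>: "\<forall>q\<in>set ps. \<sigma> q \<in> syzygies r m \<phi> \<and> \<sigma> q (fst q) = pvar (snd q) \<and>
      (\<forall>i. fst q < i \<longrightarrow> i < m \<longrightarrow> \<sigma> q i = 0) \<and> (\<forall>i. homogeneous 1 (\<sigma> q i))"
    by metis
  have hom\<sigma>: "\<forall>i<m. \<forall>c<length ps. homogeneous 1 (\<sigma> (ps ! c) i)"
    using \<sigma> nth_mem by blast
  interpret linear_syzygies r m \<phi> V ps \<sigma>
    by (rule linear_syzygies.intro[OF lq ps]) (use \<sigma> in simp_all)
  show ?thesis
    using linear_quotients_next hom\<sigma> syzygies_eq_image by blast
qed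

section \<open>Monomial ideals with linear quotients have linear resolutions\<close>

definition monomial_ideal :: "('v \<Rightarrow>\<^sub>0 nat) set \<Rightarrow> ('v, 'k::field) mpoly set" where
  "monomial_ideal U = {p. \<forall>m\<in>keys p. \<exists>u\<in>U. \<exists>n. m = u + n}"

lemma monomial_ideal_zero [simp]: "0 \<in> monomial_ideal U"
  by (simp add: monomial_ideal_def)

lemma monomial_ideal_add:
  "p \<in> monomial_ideal U \<Longrightarrow> q \<in> monomial_ideal U \<Longrightarrow> p + q \<in> monomial_ideal U"
  using keys_add[of p q] unfolding monomial_ideal_def by blast

lemma monomial_ideal_uminus: "p \<in> monomial_ideal U \<Longrightarrow> - p \<in> monomial_ideal U"
  by (auto simp: monomial_ideal_def in_keys_iff)

lemma monomial_ideal_mult: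
  assumes "q \<in> monomial_ideal U"
  shows "p * q \<in> monomial_ideal U"
proof -
  have "\<exists>u\<in>U. \<exists>n. m = u + n" if m: "m \<in> keys (p * q)" for m
  proof -
    obtain a b where ab: "m = a + b" "b \<in> keys q"
      using keys_mult[of p q] m by blast
    then obtain u n where "u \<in> U" "b = u + n" using assms by (auto simp: monomial_ideal_def)
    then show ?thesis using ab by (intro bexI[of _ u] exI[of _ "a + n"]) (auto simp: ac_simps)
  qed
  then show ?thesis by (simp add: monomial_ideal_def)
qed

lemma monomial_ideal_sum:
  "(\<And>i. i \<in> S \<Longrightarrow> f i \<in> monomial_ideal U) \<Longrightarrow> (\<Sum>i\<in>S. f i) \<in> monomial_ideal U"
  by (induction S rule: infinite_finite_induct) (auto intro: monomial_ideal_add)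

lemma single_in_monomial_ideal: "u \<in> U \<Longrightarrow> single (u + n) a \<in> monomial_ideal U"
  by (auto simp: monomial_ideal_def)

lemma single_in_monomial_ideal': "u \<in> U \<Longrightarrow> single u a \<in> monomial_ideal U"
  using single_in_monomial_ideal[of u U 0 a] by simp

lemma monomial_ideal_lin_comb:
  assumes "p \<in> monomial_ideal U" "finite U"
  shows "\<exists>c. p = (\<Sum>u\<in>U. single u 1 * c u)"
proof -
  have "\<exists>u n. m \<in> keys p \<longrightarrow> u \<in> U \<and> m = u + n" for m
    using assms(1) unfolding monomial_ideal_def by blast
  then obtain w n where w: "w m \<in> U" "m = w m + n m" if "m \<in> keys p" for m
    by metis
  define t where "t m = single (n m) (lookup p m)" for m
  have t: "single m (lookup p m) = single (w m) 1 * t m"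
    if "m \<in> keys p" for m
    using w(2)[OF that] by (simp add: t_def mult_single)
  have "p = (\<Sum>m\<in>keys p. single (w m) 1 * t m)"
    by (subst mpoly_sum_single[of p]) (intro sum.cong refl t)
  also have "\<dots> = (\<Sum>u\<in>U. \<Sum>m\<in>{m \<in> keys p. w m = u}. single (w m) 1 * t m)"
    by (rule sum.group[symmetric]) (use assms(2) w in auto)
  also have "\<dots> = (\<Sum>u\<in>U. single u 1 * (\<Sum>m\<in>{m \<in> keys p. w m = u}. t m))"
    by (intro sum.cong refl) (simp add: sum_distrib_left)
  finally show ?thesis
    by (intro exI[of _ "\<lambda>u. \<Sum>m\<in>{m \<in> keys p. w m = u}. t m"])
qed

text \<open>
  The hypothesis says that for each \<open>i < j\<close> some variable \<open>v\<close> divides \<open>us ! i / gcd (us ! i) (us ! j)\<close>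
  and satisfies \<open>v * us ! j = w * us ! l\<close> for an earlier monomial \<open>us ! l\<close> and a variable \<open>w\<close>.
\<close>

lemma monomials_linear_quotients:
  fixes us :: "('v::finite \<Rightarrow>\<^sub>0 nat) list"
  assumes lq: "\<And>i j. i < j \<Longrightarrow> j < length us \<Longrightarrow>
      \<exists>l<j. \<exists>v w. lookup (us ! j) v < lookup (us ! i) v \<and>
        us ! l + single w 1 = us ! j + single v 1"
  shows "linear_quotients 1 (length us) (\<lambda>_ c. single (us ! c) (1 :: 'k::field))
     (\<lambda>j. {v. \<exists>l<j. \<exists>w. us ! l + single w 1 = us ! j + single v 1})"
    (is "linear_quotients 1 ?n ?\<phi> ?V")
  unfolding linear_quotients_def
proof (intro allI impI equalityI subsetI)
  fix j and f :: "('v, 'k) mpoly" assume j: "j < ?n"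
    and "f \<in> {w j | w. w \<in> syzygies 1 ?n ?\<phi> \<and> (\<forall>i. j < i \<longrightarrow> i < ?n \<longrightarrow> w i = 0)}"
  then obtain w where w: "f = w j" "w \<in> syzygies 1 ?n ?\<phi>" "\<And>i. j < i \<Longrightarrow> i < ?n \<Longrightarrow> w i = 0"
    by auto
  define U where "U = {us ! i | i. i < j}"
  have "(\<Sum>c<?n. ?\<phi> 0 c * w c) = 0" using w(2) by (simp add: syzygies_def)
  then have "?\<phi> 0 j * w j + (\<Sum>c\<in>{..<?n} - {j}. ?\<phi> 0 c * w c) = 0"
    using sum.remove[of "{..<?n}" j "\<lambda>c. ?\<phi> 0 c * w c"] j by simp
  then have eq: "f * ?\<phi> 0 j = - (\<Sum>c\<in>{..<?n} - {j}. w c * ?\<phi> 0 c)"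
    by (simp add: eq_neg_iff_add_eq_0 w(1) mult.commute)
  have "w c * ?\<phi> 0 c \<in> monomial_ideal U" if "c \<in> {..<?n} - {j}" for c
  proof (cases "c < j")
    case True
    then show ?thesis
      by (intro monomial_ideal_mult single_in_monomial_ideal') (auto simp: U_def)
  next
    case False
    then show ?thesis using w(3)[of c] that by simp
  qed
  then have mem: "f * ?\<phi> 0 j \<in> monomial_ideal U"
    unfolding eq by (intro monomial_ideal_uminus monomial_ideal_sum)
  have "\<exists>v\<in>?V j. lookup m v \<noteq> 0" if m: "m \<in> keys f" for m
  proof -
    have "m + us ! j \<in> keys (f * ?\<phi> 0 j)"
      using m by (simp add: in_keys_iff lookup_mult_single_add)
    then obtain i n where i: "i < j" "m + us ! j = us ! i + n"
      using mem by (auto simp: monomial_ideal_def U_def)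
    obtain l v x where l: "l < j" "lookup (us ! j) v < lookup (us ! i) v"
        "us ! l + single x 1 = us ! j + single v 1"
      using lq[OF i(1) j] by blast
    have "lookup m v + lookup (us ! j) v =
        lookup (us ! i) v + lookup n v"
      using arg_cong[OF i(2), of "\<lambda>m. lookup m v"] by (simp add: lookup_add)
    then have "lookup m v \<noteq> 0" using l(2) by simp
    then show ?thesis using l by blast
  qed
  then show "f \<in> vars_ideal (?V j)" by (simp add: vars_ideal_def)
next
  fix j and f :: "('v, 'k) mpoly" assume j: "j < ?n" and f: "f \<in> vars_ideal (?V j)"
  obtain a where a: "f = (\<Sum>v\<in>?V j. a v * pvar v)" using vars_ideal_lin_comb[OF f] by auto
  have "\<forall>v\<in>?V j. \<exists>q. fst q < j \<and>
      us ! fst q + single (snd q) 1 = us ! j + single v 1"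
    by (intro ballI, elim CollectE exE conjE) (metis fst_conv snd_conv)
  from bchoice[OF this] obtain q where q: "\<And>v. v \<in> ?V j \<Longrightarrow> fst (q v) < j \<and>
      us ! fst (q v) + single (snd (q v)) 1 = us ! j + single v 1"
    by blast
  define l where "l v = fst (q v)" for v
  define x where "x v = snd (q v)" for v
  have lx: "l v < j" "us ! l v + single (x v) 1 = us ! j + single v 1"
    if "v \<in> ?V j" for v
    using q[OF that] by (simp_all add: l_def x_def)
  define \<tau> :: "'v \<Rightarrow> nat \<Rightarrow> ('v, 'k) mpoly"
    where "\<tau> v i = (if i = j then pvar v else 0) - (if i = l v then pvar (x v) else 0)" for v i
  have \<tau>: "\<tau> v \<in> syzygies 1 ?n ?\<phi>" if v: "v \<in> ?V j" for v
  proof -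
    have "(\<Sum>c<?n. ?\<phi> 0 c * \<tau> v c) = (\<Sum>c<?n. (if c = j then ?\<phi> 0 c * pvar v else 0)) -
        (\<Sum>c<?n. if c = l v then ?\<phi> 0 c * pvar (x v) else 0)"
      unfolding sum_subtractf[symmetric] by (intro sum.cong refl) (simp add: \<tau>_def right_diff_distrib)
    also have "\<dots> = ?\<phi> 0 j * pvar v - ?\<phi> 0 (l v) * pvar (x v)"
      using j lx(1)[OF v] by simp
    also have "\<dots> = 0" using lx(2)[OF v] by (simp add: pvar_def mult_single)
    finally show ?thesis by (simp add: syzygies_def)
  qed
  have "(\<lambda>i. \<Sum>v\<in>?V j. a v * \<tau> v i) \<in> syzygies 1 ?n ?\<phi>"
    by (intro syzygies_sum \<tau>)
  moreover have "(\<Sum>v\<in>?V j. a v * \<tau> v j) = f"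
  proof -
    have "\<tau> v j = pvar v" if "v \<in> ?V j" for v using lx(1)[OF that] by (simp add: \<tau>_def)
    then show ?thesis unfolding a by (intro sum.cong refl) simp
  qed
  moreover have "(\<Sum>v\<in>?V j. a v * \<tau> v i) = 0" if "j < i" for i
  proof -
    have "\<tau> v i = 0" if "v \<in> ?V j" for v using lx(1)[OF that] \<open>j < i\<close> by (simp add: \<tau>_def)
    then show ?thesis by (intro sum.neutral) simp
  qed
  ultimately show "f \<in> {w j | w. w \<in> syzygies 1 ?n ?\<phi> \<and> (\<forall>i. j < i \<longrightarrow> i < ?n \<longrightarrow> w i = 0)}"
    by (intro CollectI exI[of _ "\<lambda>i. \<Sum>v\<in>?V j. a v * \<tau> v i"]) auto
qed

text \<open>
  Iterating \<open>linear_quotients_syzygy_step\<close> by dependent choice. The resolution is continued forever;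
  eventually its modules are zero.
\<close>

lemma linear_resolution_exists:
  fixes \<phi> :: "nat \<Rightarrow> nat \<Rightarrow> ('v::finite, 'k::field) mpoly"
  assumes "linear_quotients r m \<phi> V"
    and "\<And>i c. i < r \<Longrightarrow> c < m \<Longrightarrow> homogeneous (int d) (\<phi> i c)"
  shows "\<exists>R M \<Phi>. R 0 = r \<and> M 0 = m \<and> \<Phi> 0 = \<phi> \<and> (\<forall>n. R (Suc n) = M n) \<and>
     (\<forall>n. \<forall>i<M n. \<forall>c<M (Suc n). homogeneous 1 (\<Phi> (Suc n) i c)) \<and>
     (\<forall>n. syzygies (R n) (M n) (\<Phi> n) =
        {w. \<exists>u. \<forall>i<M n. w i = (\<Sum>c<M (Suc n). \<Phi> (Suc n) i c * u c)})"
proof -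
  let ?P = "\<lambda>(n::nat) (r', m', \<phi>'). (n = 0 \<longrightarrow> (r', m', \<phi>') = (r, m, \<phi>)) \<and>
      (\<exists>V. linear_quotients r' m' \<phi>' V) \<and>
      (\<exists>d. \<forall>i<r'. \<forall>c<m'. homogeneous (int d) (\<phi>' i c))"
  let ?Q = "\<lambda>(r', m', \<phi>') (r'', m'', \<phi>''). r'' = m' \<and> (\<forall>i<m'. \<forall>c<m''. homogeneous 1 (\<phi>'' i c)) \<and>
      syzygies r' m' \<phi>' = {w. \<exists>u. \<forall>i<m'. w i = (\<Sum>c<m''. \<phi>'' i c * u c)}"
  have "\<exists>f. \<forall>n. ?P n (f n) \<and> ?Q (f n) (f (Suc n))"
  proof (rule dependent_nat_choice)
    show "\<exists>x. ?P 0 x" using assms by (intro exI[of _ "(r, m, \<phi>)"]) auto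
  next
    fix x :: "nat \<times> nat \<times> (nat \<Rightarrow> nat \<Rightarrow> ('v, 'k) mpoly)" and n assume P: "?P n x"
    obtain r' m' \<phi>' where x: "x = (r', m', \<phi>')" by (cases x) auto
    with P obtain V d where V: "linear_quotients r' m' \<phi>' V"
        "\<And>i c. i < r' \<Longrightarrow> c < m' \<Longrightarrow> homogeneous (int d) (\<phi>' i c)"
      by auto
    obtain m'' \<psi> V' where s: "linear_quotients m' m'' \<psi> V'" "\<And>i c. i < m' \<Longrightarrow> c < m'' \<Longrightarrow> homogeneous 1 (\<psi> i c)"
        "syzygies r' m' \<phi>' = {w. \<exists>u. \<forall>i<m'. w i = (\<Sum>c<m''. \<psi> i c * u c)}"
      using linear_quotients_syzygy_step[OF V] by blast
    have "?P (Suc n) (m', m'', \<psi>)" using s(1,2) by (auto intro!: exI[of _ "1::nat"])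
    moreover have "?Q x (m', m'', \<psi>)" using s(2,3) x by simp
    ultimately show "\<exists>y. ?P (Suc n) y \<and> ?Q x y" by blast
  qed
  then obtain f where f: "\<forall>n. ?P n (f n) \<and> ?Q (f n) (f (Suc n))" by (rule exE)
  have f0: "f 0 = (r, m, \<phi>)" using f[THEN spec, of 0] by (auto simp: case_prod_beta)
  have fS: "?Q (f n) (f (Suc n))" for n using f[THEN spec, of n] by (rule conjunct2)
  show ?thesis
    using f0 fS
    by (intro exI[of _ "\<lambda>n. fst (f n)"] exI[of _ "\<lambda>n. fst (snd (f n))"] exI[of _ "\<lambda>n. snd (snd (f n))"])
      (simp add: case_prod_beta)
qed

text \<open>
  The bridge from matrices as functions to the matrices of the definition of a resolution.
\<close>

lemma vec_image_eq:
  fixes M :: "nat \<Rightarrow> nat \<Rightarrow> 'a::comm_ring_1"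
  shows "(\<lambda>w. mat m n (\<lambda>(i, c). M i c) *\<^sub>v w) ` carrier_vec n =
    {v \<in> carrier_vec m. \<exists>u. \<forall>i<m. v $ i = (\<Sum>c<n. M i c * u c)}"
    (is "?L = ?R")
proof (intro equalityI subsetI)
  fix v assume "v \<in> ?L"
  then obtain w where w: "w \<in> carrier_vec n" "v = mat m n (\<lambda>(i, c). M i c) *\<^sub>v w" by auto
  then show "v \<in> ?R"
    by (auto intro!: mult_mat_vec_carrier[of _ m n])
      (auto simp: scalar_prod_def lessThan_atLeast0 intro!: exI[of _ "\<lambda>i. w $ i"] sum.cong)
next
  fix v assume "v \<in> ?R"
  then obtain u where u: "v \<in> carrier_vec m" "\<And>i. i < m \<Longrightarrow> v $ i = (\<Sum>c<n. M i c * u c)" by auto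
  have "v = mat m n (\<lambda>(i, c). M i c) *\<^sub>v vec n u"
    using u by (intro eq_vecI) (auto simp: scalar_prod_def lessThan_atLeast0 intro!: sum.cong)
  then show "v \<in> ?L" by auto
qed

lemma linear_quotients_imp_linear_resolution:
  fixes us :: "('v::finite \<Rightarrow>\<^sub>0 nat) list"
  assumes deg: "\<And>u. u \<in> set us \<Longrightarrow> mon_degree u = d"
  assumes lq: "\<And>i j. i < j \<Longrightarrow> j < length us \<Longrightarrow>
      \<exists>l<j. \<exists>v w. lookup (us ! j) v < lookup (us ! i) v \<and>
        us ! l + single w 1 = us ! j + single v 1"
  assumes "distinct us"
  shows "has_linear_resolution (monomial_ideal (set us) :: ('v, 'k::field) mpoly set)"
proof -
  define \<phi> :: "nat \<Rightarrow> nat \<Rightarrow> ('v, 'k) mpoly" where "\<phi> = (\<lambda>_ c. single (us ! c) 1)"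
  have hom: "homogeneous (int d) (\<phi> i c)" if "c < length us" for i c
    using deg[of "us ! c"] that by (auto simp: homogeneous_def \<phi>_def)
  define V where "V j = {v. \<exists>l<j. \<exists>w. us ! l + single w 1 = us ! j + single v 1}"
    for j
  have "linear_quotients 1 (length us) \<phi> V"
    unfolding \<phi>_def V_def by (rule monomials_linear_quotients) (rule lq)
  from linear_resolution_exists[where d = d, OF this] hom
  have "\<exists>R M \<Phi>. R 0 = 1 \<and> M 0 = length us \<and> \<Phi> 0 = \<phi> \<and> (\<forall>n. R (Suc n) = M n) \<and>
     (\<forall>n. \<forall>i<M n. \<forall>c<M (Suc n). homogeneous 1 (\<Phi> (Suc n) i c)) \<and>
     (\<forall>n. syzygies (R n) (M n) (\<Phi> n) =
        {w. \<exists>u. \<forall>i<M n. w i = (\<Sum>c<M (Suc n). \<Phi> (Suc n) i c * u c)})"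
    by blast
  then obtain R M \<Phi> where
    "R 0 = 1 \<and> M 0 = length us \<and> \<Phi> 0 = \<phi> \<and> (\<forall>n. R (Suc n) = M n) \<and>
     (\<forall>n. \<forall>i<M n. \<forall>c<M (Suc n). homogeneous 1 (\<Phi> (Suc n) i c)) \<and>
     (\<forall>n. syzygies (R n) (M n) (\<Phi> n) =
        {w. \<exists>u. \<forall>i<M n. w i = (\<Sum>c<M (Suc n). \<Phi> (Suc n) i c * u c)})"
    by (elim exE)
  then have R: "R 0 = 1" "M 0 = length us" "\<Phi> 0 = \<phi>" "\<And>n. R (Suc n) = M n"
    and hom1: "\<And>n i c. i < M n \<Longrightarrow> c < M (Suc n) \<Longrightarrow> homogeneous 1 (\<Phi> (Suc n) i c)"
    and syz: "\<And>n. syzygies (R n) (M n) (\<Phi> n) =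
        {w. \<exists>u. \<forall>i<M n. w i = (\<Sum>c<M (Suc n). \<Phi> (Suc n) i c * u c)}"
    by simp_all
  define D where "D i = replicate (M i) (int d + int i)" for i
  define g where "g = vec (M 0) (\<phi> 0)"
  define \<Psi> where "\<Psi> n = mat (M n) (M (Suc n)) (\<lambda>(i, c). \<Phi> (Suc n) i c)" for n
  have ker: "{v \<in> carrier_vec (M n). (\<lambda>i. v $ i) \<in> syzygies (R n) (M n) (\<Phi> n)} =
      (\<lambda>w. \<Psi> n *\<^sub>v w) ` carrier_vec (M (Suc n))" for n
    unfolding \<Psi>_def vec_image_eq syz by simp
  have gv: "g \<bullet> v = (\<Sum>c<length us. single (us ! c) 1 * v $ c)"
    if "v \<in> carrier_vec (M 0)" for v
    using that by (auto simp: g_def scalar_prod_def R \<phi>_def lessThan_atLeast0 intro!: sum.cong)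
  have 1: "(\<lambda>v. g \<bullet> v) ` carrier_vec (M 0) = monomial_ideal (set us)"
  proof (intro equalityI subsetI)
    fix p assume "p \<in> (\<lambda>v. g \<bullet> v) ` carrier_vec (M 0)"
    then obtain v where "v \<in> carrier_vec (M 0)" "p = g \<bullet> v" by auto
    then show "p \<in> monomial_ideal (set us)"
      by (auto simp: gv mult.commute[of "single _ _"]
          intro!: monomial_ideal_sum monomial_ideal_mult single_in_monomial_ideal')
  next
    fix p :: "('v, 'k) mpoly" assume "p \<in> monomial_ideal (set us)"
    from monomial_ideal_lin_comb[OF this] obtain c
      where c: "p = (\<Sum>u\<in>set us. single u 1 * c u)" by auto
    have "p = (\<Sum>i<length us. single (us ! i) 1 * c (us ! i))"
      unfolding c
      by (rule sum.reindex_bij_betw[symmetric]) (use assms(3) in \<open>auto intro: bij_betw_nth\<close>)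
    then have "p = g \<bullet> vec (M 0) (\<lambda>i. c (us ! i))" by (simp add: gv R)
    then show "p \<in> (\<lambda>v. g \<bullet> v) ` carrier_vec (M 0)" by (rule image_eqI) simp
  qed
  have 2: "{v \<in> carrier_vec (M 0). g \<bullet> v = 0} = (\<lambda>w. \<Psi> 0 *\<^sub>v w) ` carrier_vec (M 1)"
  proof -
    have "{v \<in> carrier_vec (M 0). g \<bullet> v = 0} =
        {v \<in> carrier_vec (M 0). (\<lambda>i. v $ i) \<in> syzygies (R 0) (M 0) (\<Phi> 0)}"
      by (intro Collect_cong conj_cong refl) (simp add: gv, simp add: syzygies_def R \<phi>_def)
    then show ?thesis using ker[of 0] by simp
  qed
  have 3: "{v \<in> carrier_vec (M (Suc n)). \<Psi> n *\<^sub>v v = 0\<^sub>v (M n)} =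
      (\<lambda>w. \<Psi> (Suc n) *\<^sub>v w) ` carrier_vec (M (Suc (Suc n)))" for n
    unfolding ker[of "Suc n", symmetric]
  proof (intro Collect_cong conj_cong refl)
    fix v :: "('v, 'k) mpoly vec" assume v: "v \<in> carrier_vec (M (Suc n))"
    have "(\<Psi> n *\<^sub>v v) $ i = (\<Sum>c<M (Suc n). \<Phi> (Suc n) i c * v $ c)" if "i < M n" for i
      using v that by (auto simp: \<Psi>_def scalar_prod_def lessThan_atLeast0 intro!: sum.cong)
    moreover have "dim_vec (\<Psi> n *\<^sub>v v) = M n" by (simp add: \<Psi>_def)
    ultimately show "\<Psi> n *\<^sub>v v = 0\<^sub>v (M n) \<longleftrightarrow>
        (\<lambda>i. v $ i) \<in> syzygies (R (Suc n)) (M (Suc n)) (\<Phi> (Suc n))"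
      by (simp add: vec_eq_iff syzygies_def R(4))
  qed
  have gr: "graded_free_resolution (monomial_ideal (set us)) D g \<Psi>"
    unfolding graded_free_resolution_def using 1 2 3 hom hom1
    by (auto simp: D_def \<Psi>_def g_def R)
  have 4: "lookup (\<Phi> (Suc n) i c) 0 = 0" if "i < M n" "c < M (Suc n)" for n i c
  proof (rule ccontr)
    assume "lookup (\<Phi> (Suc n) i c) 0 \<noteq> 0"
    then have "int (mon_degree (0 :: 'v \<Rightarrow>\<^sub>0 nat)) = 1"
      using hom1[OF that] unfolding homogeneous_def by (auto simp: in_keys_iff)
    then show False by (simp add: mon_degree_def)
  qed
  have "minimal_graded_free_resolution (monomial_ideal (set us)) D g \<Psi>"
    unfolding minimal_graded_free_resolution_def using gr 4 by (auto simp: D_def \<Psi>_def)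
  then show ?thesis
    unfolding has_linear_resolution_def by (intro exI[of _ D] exI[of _ g] exI[of _ \<Psi>] conjI exI[of _ "int d"])
      (auto simp: D_def)
qed

section \<open>Exponent vectors and monomial orders\<close>

definition mon_of :: "('v::finite \<Rightarrow> nat) \<Rightarrow> ('v \<Rightarrow>\<^sub>0 nat)" where
  "mon_of f = Abs_poly_mapping f"

lemma lookup_mon_of [simp]: "lookup (mon_of f) = f"
  by (simp add: mon_of_def)

lemma mon_of_add: "mon_of (\<lambda>v. f v + g v) = mon_of f + mon_of g"
  by (rule poly_mapping_eqI) (simp add: lookup_add)

lemma prod_pvar:
  fixes C :: "'v::finite set"
  shows "(\<Prod>v\<in>C. pvar v :: ('v, 'k::field) mpoly) =
    single (mon_of (\<lambda>v. if v \<in> C then 1 else 0)) 1"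
proof -
  have "finite C" by simp
  then show ?thesis
  proof induction
    case empty
    have "mon_of (\<lambda>v::'v. 0) = 0" by (rule poly_mapping_eqI) simp
    then show ?case by simp
  next
    case (insert v C)
    have "single v 1 + mon_of (\<lambda>v. if v \<in> C then 1 else 0) =
        mon_of (\<lambda>w. if w \<in> insert v C then 1 else 0)"
      using insert.hyps by (intro poly_mapping_eqI) (auto simp: lookup_add lookup_single when_def)
    then show ?case
      using insert by (simp add: pvar_def mult_single del: single_one)
  qed
qed

text \<open>
  Transport of monomials to variables indexed by natural numbers. The pure lexicographic order that
  exists there (smaller indices weigh more) becomes a monomial order on the given variables.
\<close>

definition relabel :: "('v::finite \<Rightarrow> nat) \<Rightarrow> ('v \<Rightarrow>\<^sub>0 nat) \<Rightarrow> (nat \<Rightarrow>\<^sub>0 nat)" where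
  "relabel \<iota> m = (\<Sum>v\<in>UNIV. single (\<iota> v) (lookup m v))"

lemma relabel_add: "relabel \<iota> (m + n) = relabel \<iota> m + relabel \<iota> n"
  by (simp add: relabel_def lookup_add single_add sum.distrib)

lemma lookup_relabel: "inj \<iota> \<Longrightarrow> lookup (relabel \<iota> m) (\<iota> v) = lookup m v"
  by (simp add: relabel_def lookup_sum lookup_single when_def inj_eq)

lemma lookup_relabel_notin: "i \<notin> range \<iota> \<Longrightarrow> lookup (relabel \<iota> m) i = 0"
  by (auto simp: relabel_def lookup_sum lookup_single when_def intro!: sum.neutral)

lemma inj_relabel: "inj \<iota> \<Longrightarrow> inj (relabel \<iota>)"
  by (intro injI poly_mapping_eqI) (metis lookup_relabel)

lemma relabel_less_iff:
  assumes "inj \<iota>"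
  shows "relabel \<iota> m < relabel \<iota> n \<longleftrightarrow>
    (\<exists>v. lookup m v < lookup n v \<and>
      (\<forall>w. \<iota> w < \<iota> v \<longrightarrow> lookup m w = lookup n w))"
proof -
  have "relabel \<iota> m < relabel \<iota> n \<longleftrightarrow>
     (\<exists>i. lookup (relabel \<iota> m) i < lookup (relabel \<iota> n) i \<and>
       (\<forall>j<i. lookup (relabel \<iota> m) j = lookup (relabel \<iota> n) j))"
    by (simp add: less_poly_mapping.rep_eq less_fun_def)
  also have "\<dots> \<longleftrightarrow> (\<exists>v. lookup m v < lookup n v \<and>
      (\<forall>w. \<iota> w < \<iota> v \<longrightarrow> lookup m w = lookup n w))"
    (is "?L \<longleftrightarrow> ?R")
  proof
    assume ?L
    then obtain i where i: "lookup (relabel \<iota> m) i < lookup (relabel \<iota> n) i"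
      "\<And>j. j < i \<Longrightarrow> lookup (relabel \<iota> m) j = lookup (relabel \<iota> n) j"
      by blast
    then obtain v where "i = \<iota> v" using lookup_relabel_notin[of i \<iota> n] by fastforce
    then show ?R using i(1) i(2)[of "\<iota> _"] by (auto simp: lookup_relabel[OF assms])
  next
    assume ?R
    then obtain v where v: "lookup m v < lookup n v"
      "\<And>w. \<iota> w < \<iota> v \<Longrightarrow> lookup m w = lookup n w"
      by blast
    have "lookup (relabel \<iota> m) j = lookup (relabel \<iota> n) j" if "j < \<iota> v" for j
    proof (cases "j \<in> range \<iota>")
      case True
      then show ?thesis using v(2) that by (auto simp: lookup_relabel[OF assms])
    qed (simp add: lookup_relabel_notin)
    then show ?L using v(1) by (intro exI[of _ "\<iota> v"]) (auto simp: lookup_relabel[OF assms])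
  qed
  finally show ?thesis .
qed

section \<open>Ideals of the polynomial ring\<close>

lemma mpoly_ring_simps [simp]:
  "carrier mpoly_ring = UNIV" "x \<otimes>\<^bsub>mpoly_ring\<^esub> y = x * y" "x \<oplus>\<^bsub>mpoly_ring\<^esub> y = x + y"
  "\<zero>\<^bsub>mpoly_ring\<^esub> = 0" "\<one>\<^bsub>mpoly_ring\<^esub> = 1"
  by (simp_all add: ring_of_type_algebra_def)

interpretation mpoly_cring: cring "mpoly_ring :: ('v::finite, 'k::field) mpoly ring"
  by (rule cring_from_type_algebra)

lemma mpoly_a_inv: "\<ominus>\<^bsub>mpoly_ring\<^esub> (x :: ('v::finite, 'k::field) mpoly) = - x"
  by (rule mpoly_cring.minus_equality) auto

lemma ideal_mpoly_iff:
  fixes J :: "('v::finite, 'k::field) mpoly set"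
  shows "ideal J mpoly_ring \<longleftrightarrow>
    0 \<in> J \<and> (\<forall>a\<in>J. \<forall>b\<in>J. a + b \<in> J) \<and> (\<forall>a. \<forall>b\<in>J. a * b \<in> J)" (is "_ \<longleftrightarrow> ?R")
proof
  assume "ideal J mpoly_ring"
  then interpret ideal J mpoly_ring .
  show ?R using zero_closed a_closed I_l_closed by simp
next
  assume R: ?R
  have inv: "inv\<^bsub>add_monoid mpoly_ring\<^esub> a = - a" for a :: "('v, 'k) mpoly"
    using mpoly_a_inv[of a] unfolding a_inv_def .
  have "- a \<in> J" if "a \<in> J" for a using R that by (metis mult_minus1)
  then have "subgroup J (add_monoid (mpoly_ring :: ('v, 'k) mpoly ring))"
    using R inv by unfold_locales auto
  moreover have "a * b \<in> J" if "a \<in> J" for a b using R that by (metis mult.commute)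
  ultimately show "ideal J mpoly_ring"
    using R by (intro idealI) (auto simp: mpoly_cring.ring_axioms)
qed

lemma ideal_monomial_ideal: "ideal (monomial_ideal U :: ('v::finite, 'k::field) mpoly set) mpoly_ring"
  by (auto simp: ideal_mpoly_iff intro: monomial_ideal_add monomial_ideal_mult)

lemma ideal_mpoly_sum:
  fixes J :: "('v::finite, 'k::field) mpoly set"
  assumes "ideal J mpoly_ring" "\<And>i. i \<in> S \<Longrightarrow> f i \<in> J"
  shows "(\<Sum>i\<in>S. f i) \<in> J"
  using assms(2) by (induction S rule: infinite_finite_induct) (use assms(1) in \<open>auto simp: ideal_mpoly_iff\<close>)

text \<open>
  Monomial ideals are handled through their monomials; this identifies them with the ideals generated in
  the ring.
\<close>

lemma genideal_monomials:
  fixes U :: "('v::finite \<Rightarrow>\<^sub>0 nat) set"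
  assumes "finite U"
  shows "Idl\<^bsub>mpoly_ring\<^esub> {single u (1::'k::field) | u. u \<in> U} = monomial_ideal U"
proof (intro equalityI)
  show "Idl\<^bsub>mpoly_ring\<^esub> {single u (1::'k) | u. u \<in> U} \<subseteq> monomial_ideal U"
    unfolding genideal_def using ideal_monomial_ideal[of U]
    by (intro Inter_lower) (auto intro: single_in_monomial_ideal')
  show "monomial_ideal U \<subseteq> Idl\<^bsub>mpoly_ring\<^esub> {single u (1::'k) | u. u \<in> U}"
    unfolding genideal_def
  proof (intro subsetI InterI)
    fix p :: "('v, 'k) mpoly" and J
    assume p: "p \<in> monomial_ideal U"
      and "J \<in> {J. ideal J mpoly_ring \<and> {single u (1::'k) | u. u \<in> U} \<subseteq> J}"
    then have J: "ideal J mpoly_ring" "\<And>u. u \<in> U \<Longrightarrow> single u 1 \<in> J" by auto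
    obtain c where c: "p = (\<Sum>u\<in>U. single u 1 * c u)"
      using monomial_ideal_lin_comb[OF p assms] by blast
    show "p \<in> J"
      unfolding c using J by (intro ideal_mpoly_sum) (auto simp: ideal_mpoly_iff mult.commute)
  qed
qed

lemma monomial_ideal_prod:
  fixes U W :: "('v::finite \<Rightarrow>\<^sub>0 nat) set"
  assumes "finite U" "finite W"
  shows "ideal_prod mpoly_ring (monomial_ideal U :: ('v, 'k::field) mpoly set) (monomial_ideal W) =
    monomial_ideal {u + w | u w. u \<in> U \<and> w \<in> W}" (is "?L = monomial_ideal ?UW")
proof (intro equalityI subsetI)
  fix p assume "p \<in> ?L"
  then show "p \<in> monomial_ideal ?UW"
  proof (induction rule: ideal_prod.induct)
    case (prod i j)
    have "\<exists>x\<in>?UW. \<exists>n. m = x + n" if m: "m \<in> keys (i * j)" for m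
    proof -
      obtain a b where ab: "m = a + b" "a \<in> keys i" "b \<in> keys j"
        using keys_mult[of i j] m by blast
      obtain u n where u: "u \<in> U" "a = u + n" using ab(2) prod(1) by (auto simp: monomial_ideal_def)
      obtain w n' where w: "w \<in> W" "b = w + n'" using ab(3) prod(2) by (auto simp: monomial_ideal_def)
      show ?thesis using u w ab(1) by (intro bexI[of _ "u + w"] exI[of _ "n + n'"]) (auto simp: ac_simps)
    qed
    then show ?case by (simp add: monomial_ideal_def)
  next
    case (sum s1 s2)
    then show ?case by (simp add: monomial_ideal_add)
  qed
next
  fix p :: "('v, 'k) mpoly" assume p: "p \<in> monomial_ideal ?UW"
  have "?UW = (\<lambda>(u, w). u + w) ` (U \<times> W)" by auto
  then have "finite ?UW" using assms by simp
  then obtain c where c: "p = (\<Sum>x\<in>?UW. single x 1 * c x)"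
    using monomial_ideal_lin_comb[OF p] by blast
  show "p \<in> ?L"
    unfolding c
  proof (rule ideal_mpoly_sum)
    show "ideal ?L mpoly_ring"
      by (intro mpoly_cring.ideal_prod_is_ideal ideal_monomial_ideal)
    fix x assume "x \<in> ?UW"
    then obtain u w where x: "x = u + w" "u \<in> U" "w \<in> W" by blast
    have "single u 1 \<otimes>\<^bsub>mpoly_ring\<^esub> (c x * single w 1) \<in> ?L"
      by (intro ideal_prod.prod monomial_ideal_mult single_in_monomial_ideal' x)
    then show "single x 1 * c x \<in> ?L"
      by (simp add: x(1) mult_ac mult_single flip: mult.assoc)
  qed
qed

section \<open>Powers of the cover ideal of a clique-partitioned graph\<close>

lemma exists_ranking:
  fixes f :: "'v::finite \<Rightarrow> nat"
  shows "\<exists>\<iota> :: 'v \<Rightarrow> nat. inj \<iota> \<and> (\<forall>u v. f u < f v \<longrightarrow> \<iota> u < \<iota> v)"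
proof -
  obtain ps where ps: "distinct ps" "set ps = (UNIV :: 'v set)" "sorted (map f ps)"
    using finite_obtain_sorted_list[of UNIV f] by auto
  have "\<forall>v. \<exists>i<length ps. ps ! i = v" using ps(2) by (metis UNIV_I in_set_conv_nth)
  then obtain \<iota> where \<iota>: "\<And>v. \<iota> v < length ps" "\<And>v. ps ! \<iota> v = v" by metis
  have "\<iota> u < \<iota> v" if "f u < f v" for u v
  proof (rule ccontr)
    assume "\<not> \<iota> u < \<iota> v"
    then have "f v \<le> f u"
      using sorted_nth_mono[OF ps(3), of "\<iota> v" "\<iota> u"] \<iota> by simp
    with that show False by simp
  qed
  moreover have "inj \<iota>" using \<iota>(2) by (metis injI)
  ultimately show ?thesis by blast
qed

text \<open>
  Two vertices lie in the same clique if they have the same image under \<open>c\<close>; only the hubs, which form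
  \<open>VX \<union> VY\<close>, may have neighbours outside their clique, and \<open>free\<close> says that each clique has a
  vertex that is not a hub.
\<close>

locale clique_partitioned_graph =
  fixes E B :: "'v::finite set set" and c :: "'v \<Rightarrow> 'v" and VX VY :: "'v set"
  assumes edges: "E = {{u, v} | u v. u \<noteq> v \<and> c u = c v} \<union> B"
    and crossing: "B \<subseteq> {{x, y} | x y. x \<in> VX \<and> y \<in> VY}"
    and disj: "VX \<inter> VY = {}"
    and hubs: "\<And>x. x \<in> VX \<union> VY \<Longrightarrow> c x = x"
    and free: "\<And>v. \<exists>w. c w = c v \<and> w \<notin> VX \<union> VY"
begin

text \<open>
  Sums of \<open>k\<close> independent sets that meet every clique, written as multiplicity functions; see
  \<open>choices_Suc_decompose\<close>.
\<close>

definition choices :: "nat \<Rightarrow> ('v \<Rightarrow> nat) set" where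
  "choices k = {\<alpha>. (\<forall>v. (\<Sum>w | c w = c v. \<alpha> w) = k) \<and>
     (\<forall>x\<in>VX. \<forall>y\<in>VY. {x, y} \<in> B \<longrightarrow> \<alpha> x + \<alpha> y \<le> k)}"

text \<open>
  If \<open>\<alpha>\<close> counts how often each vertex is omitted by \<open>k\<close> covers, then \<open>k - \<alpha>\<close> is the exponent of the product
  of the cover monomials.
\<close>

definition cover_monomials :: "nat \<Rightarrow> ('v \<Rightarrow>\<^sub>0 nat) set" where
  "cover_monomials k = (\<lambda>\<alpha>. mon_of (\<lambda>v. k - \<alpha> v)) ` choices k"

lemma choices_sum: "\<alpha> \<in> choices k \<Longrightarrow> (\<Sum>w | c w = c v. \<alpha> w) = k"
  by (simp add: choices_def)

lemma choices_cross: "\<alpha> \<in> choices k \<Longrightarrow> x \<in> VX \<Longrightarrow> y \<in> VY \<Longrightarrow> {x, y} \<in> B \<Longrightarrow> \<alpha> x + \<alpha> y \<le> k"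
  by (simp add: choices_def)

lemma choices_le: "\<alpha> \<in> choices k \<Longrightarrow> \<alpha> v \<le> k"
  using choices_sum[of \<alpha> k v] member_le_sum[of v "{w. c w = c v}" \<alpha>] by simp

lemma choices_pair_le: "\<alpha> \<in> choices k \<Longrightarrow> u \<noteq> v \<Longrightarrow> c u = c v \<Longrightarrow> \<alpha> u + \<alpha> v \<le> k"
  using choices_sum[of \<alpha> k v] sum_mono2[of "{w. c w = c v}" "{u, v}" \<alpha>] by simp

lemma finite_choices: "finite (choices k)"
proof (rule finite_subset)
  show "choices k \<subseteq> Pi\<^sub>E UNIV (\<lambda>_. {..k})" using choices_le by fastforce
  show "finite (Pi\<^sub>E UNIV (\<lambda>_ :: 'v. {..k}))" by (intro finite_PiE) auto
qed

lemma finite_cover_monomials: "finite (cover_monomials k)"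
  by (simp add: cover_monomials_def finite_choices)

lemma choices_add:
  assumes "\<alpha> \<in> choices k" "\<beta> \<in> choices l"
  shows "(\<lambda>v. \<alpha> v + \<beta> v) \<in> choices (k + l)"
proof -
  have "\<alpha> x + \<beta> x + (\<alpha> y + \<beta> y) \<le> k + l" if "x \<in> VX" "y \<in> VY" "{x, y} \<in> B" for x y
    using choices_cross[OF assms(1) that] choices_cross[OF assms(2) that] by simp
  then show ?thesis using assms by (simp add: choices_def sum.distrib)
qed

text \<open>
  An independent set that can be split off takes the hub of a clique with hub in \<open>VX\<close> as soon as
  \<open>\<alpha>\<close> is positive there, but the hub of a clique with hub in \<open>VY\<close> only if \<open>\<alpha>\<close> vanishes on the rest of
  the clique, that is, if \<open>\<alpha>\<close> is \<open>k + 1\<close> at the hub. On a crossing edge with \<open>\<alpha> x + \<alpha> y = k + 1\<close>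
  exactly one end is then taken, so the bound drops to \<open>k\<close>; and both ends are never taken, since
  \<open>\<alpha> x > 0\<close> excludes \<open>\<alpha> y = k + 1\<close>.
\<close>

lemma choices_Suc_decompose:
  assumes \<alpha>: "\<alpha> \<in> choices (Suc k)"
  shows "\<exists>\<beta>\<in>choices k. \<exists>\<chi>\<in>choices 1. \<alpha> = (\<lambda>v. \<beta> v + \<chi> v)"
proof -
  \<comment> \<open>\<open>s\<close> is the vertex to be taken from the clique \<open>p\<close>\<close>
  define good where "good p s \<longleftrightarrow> c s = p \<and> \<alpha> s \<noteq> 0 \<and>
     (if p \<in> VX \<and> \<alpha> p \<noteq> 0 then s = p else s \<in> VY \<longrightarrow> (\<forall>w. c w = p \<longrightarrow> w \<noteq> s \<longrightarrow> \<alpha> w = 0))" for p s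
  have "\<exists>s. good (c v) s" for v
  proof (cases "c v \<in> VX \<and> \<alpha> (c v) \<noteq> 0")
    case True
    then show ?thesis using hubs by (auto simp: good_def)
  next
    case False
    have "\<exists>w. c w = c v \<and> \<alpha> w \<noteq> 0"
    proof (rule ccontr)
      assume "\<not> ?thesis"
      then have "(\<Sum>w | c w = c v. \<alpha> w) = 0" by (intro sum.neutral) auto
      then show False using choices_sum[OF \<alpha>, of v] by simp
    qed
    then obtain w where w: "c w = c v" "\<alpha> w \<noteq> 0" by blast
    show ?thesis
    proof (cases "\<exists>s. c s = c v \<and> s \<notin> VY \<and> \<alpha> s \<noteq> 0")
      case True
      then show ?thesis using False by (auto simp: good_def)
    next
      case F: False
      then have "w \<in> VY" using w by blast
      have "\<alpha> x = 0" if "c x = c v" "x \<noteq> w" for x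
        using F that hubs \<open>w \<in> VY\<close> w by (metis UnCI)
      then show ?thesis using False w by (intro exI[of _ w]) (auto simp: good_def)
    qed
  qed
  then have "\<forall>p\<in>range c. \<exists>s. good p s" by blast
  from bchoice[OF this] obtain s where s: "good (c v) (s (c v))" for v by blast
  define \<chi> :: "'v \<Rightarrow> nat" where "\<chi> v = (if s (c v) = v then 1 else 0)" for v
  have cs: "c (s (c v)) = c v" and sne: "\<alpha> (s (c v)) \<noteq> 0" for v
    using s[of v] by (auto simp: good_def)
  have \<chi>le: "\<chi> v \<le> \<alpha> v" for v
    using sne[of v] by (cases "s (c v) = v") (simp_all add: \<chi>_def)
  define \<beta> where "\<beta> v = \<alpha> v - \<chi> v" for v
  have \<alpha>eq: "\<alpha> = (\<lambda>v. \<beta> v + \<chi> v)" using \<chi>le by (auto simp: \<beta>_def)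
  have \<chi>sum: "(\<Sum>w | c w = c v. \<chi> w) = 1" for v
  proof -
    have "(\<Sum>w | c w = c v. \<chi> w) = (\<Sum>w | c w = c v. if w = s (c v) then 1 else 0)"
      by (intro sum.cong) (auto simp: \<chi>_def)
    also have "\<dots> = 1" using cs by simp
    finally show ?thesis .
  qed
  have \<beta>sum: "(\<Sum>w | c w = c v. \<beta> w) = k" for v
    using choices_sum[OF \<alpha>, of v] \<chi>sum[of v] unfolding \<alpha>eq sum.distrib by simp
  have VX: "\<chi> x = 1 \<longleftrightarrow> \<alpha> x \<noteq> 0" if "x \<in> VX" for x
    using s[of x] hubs[of x] that sne[of x] by (auto simp: good_def \<chi>_def split: if_splits)
  have VY: "\<chi> y = 1 \<longleftrightarrow> \<alpha> y = Suc k" if y: "y \<in> VY" for y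
  proof
    assume "\<chi> y = 1"
    then have "s y = y" using hubs[of y] y by (simp add: \<chi>_def split: if_splits)
    moreover have cy: "c y = y" using hubs y by blast
    ultimately have "good y y" using s[of y] by simp
    moreover have "y \<notin> VX" using y disj by blast
    ultimately have "\<forall>w. c w = y \<longrightarrow> w \<noteq> y \<longrightarrow> \<alpha> w = 0"
      using y by (simp add: good_def)
    then have "(\<Sum>w | c w = c y. \<alpha> w) = (\<Sum>w | c w = c y. if w = y then \<alpha> y else 0)"
      using hubs[of y] y by (intro sum.cong) auto
    then show "\<alpha> y = Suc k" using choices_sum[OF \<alpha>, of y] by simp
  next
    assume a: "\<alpha> y = Suc k"
    have "c (s y) = c y" "\<alpha> (s y) \<noteq> 0" using cs[of y] sne[of y] hubs[of y] y by simp_all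
    then have "s y = y"
      using choices_pair_le[OF \<alpha>, of "s y" y] a by fastforce
    then show "\<chi> y = 1" using hubs[of y] y by (simp add: \<chi>_def)
  qed
  have le1: "\<chi> v \<le> 1" for v by (simp add: \<chi>_def)
  have "\<chi> x + \<chi> y \<le> 1 \<and> \<beta> x + \<beta> y \<le> k" if xy: "x \<in> VX" "y \<in> VY" "{x, y} \<in> B" for x y
    using choices_cross[OF \<alpha> xy] VX[OF xy(1)] VY[OF xy(2)] le1[of x] le1[of y]
      choices_le[OF \<alpha>, of x] choices_le[OF \<alpha>, of y] unfolding \<beta>_def by linarith
  then have "\<chi> \<in> choices 1" "\<beta> \<in> choices k"
    using \<chi>sum \<beta>sum by (simp_all add: choices_def)
  then show ?thesis using \<alpha>eq by blast
qed

lemma cover_monomials_Suc: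
  "cover_monomials (Suc k) = {u + w | u w. u \<in> cover_monomials k \<and> w \<in> cover_monomials 1}"
proof -
  have eq: "mon_of (\<lambda>v. Suc k - (\<beta> v + \<chi> v)) = mon_of (\<lambda>v. k - \<beta> v) + mon_of (\<lambda>v. 1 - \<chi> v)"
    if "\<beta> \<in> choices k" "\<chi> \<in> choices 1" for \<beta> \<chi>
  proof -
    have "Suc k - (\<beta> v + \<chi> v) = (k - \<beta> v) + (1 - \<chi> v)" for v
      using choices_le[OF that(1), of v] choices_le[OF that(2), of v] by simp
    then show ?thesis by (simp add: mon_of_add)
  qed
  show ?thesis
  proof (intro equalityI subsetI)
    fix m assume "m \<in> cover_monomials (Suc k)"
    then obtain \<alpha> where \<alpha>: "\<alpha> \<in> choices (Suc k)" "m = mon_of (\<lambda>v. Suc k - \<alpha> v)"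
      by (auto simp: cover_monomials_def)
    obtain \<beta> \<chi> where "\<beta> \<in> choices k" "\<chi> \<in> choices 1" "\<alpha> = (\<lambda>v. \<beta> v + \<chi> v)"
      using choices_Suc_decompose[OF \<alpha>(1)] by blast
    then show "m \<in> {u + w | u w. u \<in> cover_monomials k \<and> w \<in> cover_monomials 1}"
      using eq \<alpha>(2) by (auto simp: cover_monomials_def)
  next
    fix m assume "m \<in> {u + w | u w. u \<in> cover_monomials k \<and> w \<in> cover_monomials 1}"
    then obtain \<beta> \<chi> where bc: "\<beta> \<in> choices k" "\<chi> \<in> choices 1"
        "m = mon_of (\<lambda>v. k - \<beta> v) + mon_of (\<lambda>v. 1 - \<chi> v)"
      by (auto simp: cover_monomials_def)
    then show "m \<in> cover_monomials (Suc k)"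
      using choices_add[OF bc(1,2)] eq[OF bc(1,2)]
      by (auto simp: cover_monomials_def intro!: image_eqI[of _ _ "\<lambda>v. \<beta> v + \<chi> v"])
  qed
qed

lemma crossing_obtain:
  assumes "e \<in> B" obtains x y where "x \<in> VX" "y \<in> VY" "e = {x, y}"
  using assms crossing by blast

text \<open>
  A cover omits at most one vertex of a clique. A minimal one omits at least one, since otherwise the free
  vertex of the clique could be removed.
\<close>

lemma minimal_vertex_cover_iff:
  "minimal_vertex_cover E C \<longleftrightarrow> (\<lambda>v. if v \<in> C then 0 else 1) \<in> choices 1" (is "_ \<longleftrightarrow> ?\<chi> \<in> _")
proof
  assume min: "minimal_vertex_cover E C"
  then have cov: "\<And>e. e \<in> E \<Longrightarrow> e \<inter> C \<noteq> {}"
    by (simp add: minimal_vertex_cover_def vertex_cover_def)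
  have "(\<Sum>w | c w = c v. ?\<chi> w) = 1" for v
  proof -
    have "\<exists>w. c w = c v \<and> w \<notin> C"
    proof (rule ccontr)
      assume all: "\<not> ?thesis"
      obtain w where w: "c w = c v" "w \<notin> VX \<union> VY" using free by blast
      then have "w \<in> C" using all by blast
      have "e \<inter> (C - {w}) \<noteq> {}" if e: "e \<in> E" for e
      proof (cases "e \<in> B")
        case True
        then have "w \<notin> e" using w(2) by (elim crossing_obtain) auto
        then show ?thesis using cov[OF e] by auto
      next
        case False
        then obtain a b where ab: "e = {a, b}" "a \<noteq> b" "c a = c b" using e edges by auto
        show ?thesis
        proof (cases "w \<in> e")
          case True
          then have "c a = c v" "c b = c v" using ab w by auto
          then have "a \<in> C" "b \<in> C" using all by auto
          then show ?thesis using ab by auto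
        next
          case False
          then show ?thesis using cov[OF e] by auto
        qed
      qed
      then have "vertex_cover E (C - {w})" by (simp add: vertex_cover_def)
      then show False using min \<open>w \<in> C\<close> unfolding minimal_vertex_cover_def by blast
    qed
    then obtain w where w: "c w = c v" "w \<notin> C" by blast
    have "x \<in> C" if "c x = c v" "x \<noteq> w" for x
    proof -
      have "{x, w} \<in> E" unfolding edges
        by (intro UnI1 CollectI exI[of _ x] exI[of _ w]) (simp add: that w)
      then show ?thesis using cov[of "{x, w}"] w by auto
    qed
    then have "(\<Sum>x | c x = c v. ?\<chi> x) = (\<Sum>x | c x = c v. if x = w then 1 else 0)"
      using w by (intro sum.cong) auto
    also have "\<dots> = 1" using w by simp
    finally show ?thesis .
  qed
  moreover have "?\<chi> x + ?\<chi> y \<le> 1" if "{x, y} \<in> B" for x y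
    using cov[of "{x, y}"] that edges by auto
  ultimately show "?\<chi> \<in> choices 1" by (simp add: choices_def)
next
  assume \<chi>: "?\<chi> \<in> choices 1"
  have "e \<inter> C \<noteq> {}" if e: "e \<in> E" for e
  proof (cases "e \<in> B")
    case True
    then obtain x y where "x \<in> VX" "y \<in> VY" "e = {x, y}" by (rule crossing_obtain)
    then show ?thesis using choices_cross[OF \<chi>, of x y] True by (auto split: if_splits)
  next
    case False
    then obtain a b where ab: "e = {a, b}" "a \<noteq> b" "c a = c b" using e edges by auto
    then show ?thesis using choices_pair_le[OF \<chi>, of a b] by (auto split: if_splits)
  qed
  moreover have "\<not> vertex_cover E C'" if sub: "C' \<subset> C" for C'
  proof -
    obtain v where v: "v \<in> C" "v \<notin> C'" using sub by blast
    have "\<exists>w. c w = c v \<and> w \<notin> C"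
    proof (rule ccontr)
      assume "\<not> ?thesis"
      then have "(\<Sum>w | c w = c v. ?\<chi> w) = 0" by (intro sum.neutral) auto
      then show False using choices_sum[OF \<chi>, of v] by simp
    qed
    then obtain w where "c w = c v" "w \<notin> C" by blast
    then have "{v, w} \<in> E" "{v, w} \<inter> C' = {}" using v sub edges by auto
    then show ?thesis unfolding vertex_cover_def by blast
  qed
  ultimately show "minimal_vertex_cover E C"
    by (simp add: minimal_vertex_cover_def vertex_cover_def)
qed

lemma cover_ideal_eq: "(cover_ideal E :: ('v, 'k::field) mpoly set) = monomial_ideal (cover_monomials 1)"
proof -
  have "cover_monomials 1 = {mon_of (\<lambda>v. if v \<in> C then 1 else 0) | C. minimal_vertex_cover E C}"
  proof (intro equalityI subsetI)
    fix m assume "m \<in> cover_monomials 1"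
    then obtain \<chi> where \<chi>: "\<chi> \<in> choices 1" "m = mon_of (\<lambda>v. 1 - \<chi> v)"
      by (auto simp: cover_monomials_def)
    have "\<chi> = (\<lambda>v. if v \<in> {v. \<chi> v = 0} then 0 else 1)"
    proof (rule ext)
      fix v show "\<chi> v = (if v \<in> {v. \<chi> v = 0} then 0 else 1)"
        using choices_le[OF \<chi>(1), of v] by simp
    qed
    moreover from this have "(\<lambda>v. 1 - \<chi> v) = (\<lambda>v. if v \<in> {v. \<chi> v = 0} then 1 else 0)"
      by auto
    ultimately show "m \<in> {mon_of (\<lambda>v. if v \<in> C then 1 else 0) | C. minimal_vertex_cover E C}"
      using \<chi> minimal_vertex_cover_iff[of "{v. \<chi> v = 0}"] by (intro CollectI exI[of _ "{v. \<chi> v = 0}"]) metis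
  next
    fix m assume "m \<in> {mon_of (\<lambda>v. if v \<in> C then 1 else 0) | C. minimal_vertex_cover E C}"
    then obtain C where C: "minimal_vertex_cover E C" "m = mon_of (\<lambda>v. if v \<in> C then 1 else 0)" by blast
    have "(\<lambda>v. if v \<in> C then 1 else 0) = (\<lambda>v. 1 - (if v \<in> C then 0 else 1 :: nat))" by auto
    then show "m \<in> cover_monomials 1"
      using C minimal_vertex_cover_iff unfolding cover_monomials_def by simp
  qed
  then have "{\<Prod>v\<in>C. pvar v :: ('v, 'k) mpoly | C. minimal_vertex_cover E C} =
      {single u 1 | u. u \<in> cover_monomials 1}"
    by (auto simp: prod_pvar)
  then show ?thesis
    unfolding cover_ideal_def by (simp add: genideal_monomials finite_cover_monomials)
qed

lemma cover_ideal_power: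
  "(cover_ideal E :: ('v, 'k::field) mpoly set) [^]\<^bsub>ideals_set mpoly_ring\<^esub> k =
     monomial_ideal (cover_monomials k)"
proof (induction k)
  case 0
  have "(\<lambda>_. 0) \<in> choices 0" by (simp add: choices_def)
  moreover have "mon_of (\<lambda>v::'v. 0) = 0" by (rule poly_mapping_eqI) simp
  ultimately have "0 \<in> cover_monomials 0" by (force simp: cover_monomials_def)
  then have "(monomial_ideal (cover_monomials 0) :: ('v, 'k) mpoly set) = UNIV"
    by (force simp: monomial_ideal_def)
  then show ?case by (simp add: nat_pow_def ideals_set_def)
next
  case (Suc k)
  then show ?case
    using monomial_ideal_prod[OF finite_cover_monomials[of k] finite_cover_monomials[of 1], where 'k = 'k]
    by (simp add: nat_pow_def ideals_set_def cover_ideal_eq cover_monomials_Suc[symmetric] del: One_nat_def)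
qed

lemma mon_degree_cover_monomials:
  assumes "u \<in> cover_monomials k"
  shows "mon_degree u = k * card (UNIV :: 'v set) - k * card (range c)"
proof -
  obtain \<alpha> where \<alpha>: "\<alpha> \<in> choices k" "u = mon_of (\<lambda>v. k - \<alpha> v)"
    using assms by (auto simp: cover_monomials_def)
  have "(\<Sum>v\<in>UNIV. \<alpha> v) = (\<Sum>p\<in>range c. \<Sum>v\<in>{v \<in> UNIV. c v = p}. \<alpha> v)"
    by (rule sum.group[symmetric]) auto
  also have "\<dots> = (\<Sum>p\<in>range c. k)"
    using choices_sum[OF \<alpha>(1)] by (intro sum.cong) auto
  finally have "(\<Sum>v\<in>UNIV. \<alpha> v) = k * card (range c)" by simp
  then show ?thesis
    using choices_le[OF \<alpha>(1)] unfolding mon_degree_def \<alpha>(2) by (simp add: sum_subtractf_nat mult.commute)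
qed

text \<open>
  Let \<open>v\<close> be the first vertex where \<open>u\<close> and \<open>u'\<close> differ. The degrees on the clique of \<open>v\<close> agree, so \<open>u\<close>
  exceeds \<open>u'\<close> at a later vertex \<open>w\<close> of the clique, and \<open>u v / w\<close> is larger than \<open>u\<close>. If \<open>w\<close> is a hub, then
  it is in \<open>VX\<close>, since the hubs in \<open>VY\<close> come first; its neighbours \<open>y\<close> in \<open>VY\<close> precede \<open>v\<close>, so \<open>u\<close>
  and \<open>u'\<close> agree at \<open>y\<close>, and the constraint on the edge follows from that for \<open>u'\<close>.
\<close>

lemma exchange:
  assumes inj: "inj \<iota>"
    and Yfirst: "\<And>u v. u \<in> VY \<Longrightarrow> v \<notin> VY \<Longrightarrow> \<iota> u < \<iota> v"
    and u: "u \<in> cover_monomials k" and u': "u' \<in> cover_monomials k"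
    and less: "relabel \<iota> u < relabel \<iota> u'"
  shows "\<exists>u''\<in>cover_monomials k. \<exists>v w. lookup u v < lookup u' v \<and>
     u'' + single w 1 = u + single v 1 \<and> relabel \<iota> u < relabel \<iota> u''"
proof -
  obtain \<alpha> where \<alpha>: "\<alpha> \<in> choices k" "u = mon_of (\<lambda>v. k - \<alpha> v)"
    using u by (auto simp: cover_monomials_def)
  obtain \<alpha>' where \<alpha>': "\<alpha>' \<in> choices k" "u' = mon_of (\<lambda>v. k - \<alpha>' v)"
    using u' by (auto simp: cover_monomials_def)
  obtain v where "k - \<alpha> v < k - \<alpha>' v" "\<And>w. \<iota> w < \<iota> v \<Longrightarrow> k - \<alpha> w = k - \<alpha>' w"
    using less unfolding relabel_less_iff[OF inj] \<alpha>(2) \<alpha>'(2) by auto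
  then have v: "\<alpha>' v < \<alpha> v" and before: "\<And>w. \<iota> w < \<iota> v \<Longrightarrow> \<alpha> w = \<alpha>' w"
    using choices_le[OF \<alpha>(1)] choices_le[OF \<alpha>'(1)] by (simp, metis diff_diff_cancel)
  have "\<exists>w. c w = c v \<and> \<alpha> w < \<alpha>' w"
  proof (rule ccontr)
    assume "\<not> ?thesis"
    then have "(\<Sum>w | c w = c v. \<alpha>' w) < (\<Sum>w | c w = c v. \<alpha> w)"
      using v by (intro sum_strict_mono_ex1) (auto simp: not_less)
    then show False using choices_sum[OF \<alpha>(1)] choices_sum[OF \<alpha>'(1)] by simp
  qed
  then obtain w where w: "c w = c v" "\<alpha> w < \<alpha>' w" by blast
  have ne: "w \<noteq> v" using v w by auto
  have after: "\<iota> v < \<iota> w"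
    using before[of w] w(2) ne inj by (metis injD less_irrefl nat_neq_iff)
  define \<beta> where "\<beta> = \<alpha>(v := \<alpha> v - 1, w := \<alpha> w + 1)"
  have sumeq: "(\<Sum>x | c x = c z. \<beta> x) = (\<Sum>x | c x = c z. \<alpha> x)" for z
  proof (cases "c z = c v")
    case True
    have *: "{x. c x = c z} = insert v (insert w ({x. c x = c z} - {v, w}))" using True w by auto
    have "(\<Sum>x\<in>{x. c x = c z} - {v, w}. \<beta> x) = (\<Sum>x\<in>{x. c x = c z} - {v, w}. \<alpha> x)"
      by (intro sum.cong) (auto simp: \<beta>_def)
    then show ?thesis
      by (subst (1 2) *) (use ne v in \<open>auto simp: \<beta>_def\<close>)
  next
    case False
    then show ?thesis using w by (intro sum.cong) (auto simp: \<beta>_def)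
  qed
  have "\<beta> x + \<beta> y \<le> k" if xy: "x \<in> VX" "y \<in> VY" "{x, y} \<in> B" for x y
  proof -
    have "x \<noteq> y" using xy disj by auto
    have ylow: "y \<noteq> w"
    proof
      assume "y = w"
      then have "v \<in> VY" using Yfirst[of w v] after xy by (cases "v \<in> VY") auto
      then show False using hubs[of v] hubs[of w] w(1) ne \<open>y = w\<close> xy by simp
    qed
    show ?thesis
    proof (cases "x = w")
      case True
      have "v \<notin> VY" using hubs[of v] hubs[of w] w(1) ne True xy by auto
      then have "\<alpha> y = \<alpha>' y" using before Yfirst xy by blast
      moreover have "\<beta> x \<le> \<alpha>' x" using w True by (simp add: \<beta>_def)
      moreover have "\<beta> y \<le> \<alpha> y" using ylow by (simp add: \<beta>_def)
      ultimately show ?thesis using choices_cross[OF \<alpha>'(1) xy] by simp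
    next
      case False
      then have "\<beta> x \<le> \<alpha> x" "\<beta> y \<le> \<alpha> y" using ylow by (simp_all add: \<beta>_def)
      then show ?thesis using choices_cross[OF \<alpha>(1) xy] by simp
    qed
  qed
  then have \<beta>: "\<beta> \<in> choices k" using sumeq \<alpha>(1) by (simp add: choices_def)
  have wk: "\<alpha> w < k" using w(2) choices_le[OF \<alpha>'(1), of w] by simp
  define u'' where "u'' = mon_of (\<lambda>v. k - \<beta> v)"
  have "u'' + single w 1 = u + single v 1"
    unfolding u''_def \<alpha>(2)
    using wk v ne choices_le[OF \<alpha>(1), of v]
    by (intro poly_mapping_eqI) (auto simp: lookup_add lookup_single when_def \<beta>_def)
  moreover have "relabel \<iota> u < relabel \<iota> u''"
    unfolding relabel_less_iff[OF inj] u''_def \<alpha>(2)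
    using v after ne choices_le[OF \<alpha>(1), of v]
    by (intro exI[of _ v]) (auto simp: \<beta>_def)
  moreover have "lookup u v < lookup u' v"
    using v choices_le[OF \<alpha>(1), of v] by (simp add: \<alpha>(2) \<alpha>'(2))
  moreover have "u'' \<in> cover_monomials k" using \<beta> by (simp add: u''_def cover_monomials_def)
  ultimately show ?thesis by blast
qed

text \<open>
  The generators are listed in decreasing lexicographic order, whence the reversal of the sorted list.
\<close>

theorem cover_ideal_power_linear_resolution:
  "has_linear_resolution ((cover_ideal E :: ('v, 'k::field) mpoly set) [^]\<^bsub>ideals_set mpoly_ring\<^esub> (k :: nat))"
proof -
  obtain \<iota> :: "'v \<Rightarrow> nat" where \<iota>: "inj \<iota>"
      "\<And>u v. (if u \<in> VY then 0 else 1 :: nat) < (if v \<in> VY then 0 else 1) \<Longrightarrow> \<iota> u < \<iota> v"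
    using exists_ranking[of "\<lambda>v. if v \<in> VY then 0 else 1"] by blast
  have Yfirst: "\<iota> u < \<iota> v" if "u \<in> VY" "v \<notin> VY" for u v using that by (intro \<iota>(2)) auto
  obtain ps where ps: "distinct ps" "set ps = cover_monomials k" "sorted (map (relabel \<iota>) ps)"
    using finite_obtain_sorted_list[OF finite_cover_monomials] by blast
  define us where "us = rev ps"
  have us: "distinct us" "set us = cover_monomials k" using ps by (simp_all add: us_def)
  have mono: "relabel \<iota> (us ! j) \<le> relabel \<iota> (us ! i)" if "i \<le> j" "j < length us" for i j
    using sorted_rev_nth_mono[of "map (relabel \<iota>) us" i j] ps(3) that by (simp add: us_def rev_map)
  have "has_linear_resolution (monomial_ideal (set us) :: ('v, 'k) mpoly set)"
  proof (rule linear_quotients_imp_linear_resolution[where d = "k * card (UNIV :: 'v set) - k * card (range c)"])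
    fix i j assume ij: "i < j" "j < length us"
    have mem: "us ! j \<in> cover_monomials k" "us ! i \<in> cover_monomials k"
      using us(2) nth_mem ij by (metis, metis less_trans)
    have "us ! i \<noteq> us ! j" using us(1) ij by (simp add: nth_eq_iff_index_eq)
    then have "relabel \<iota> (us ! i) \<noteq> relabel \<iota> (us ! j)" using inj_relabel[OF \<iota>(1)] by (simp add: inj_eq)
    then have "relabel \<iota> (us ! j) < relabel \<iota> (us ! i)" using mono[of i j] ij by simp
    from exchange[OF \<iota>(1) Yfirst mem this] obtain u'' v w where u'': "u'' \<in> cover_monomials k"
      "lookup (us ! j) v < lookup (us ! i) v"
      "u'' + single w 1 = us ! j + single v 1"
      "relabel \<iota> (us ! j) < relabel \<iota> u''"
      by blast
    obtain l where l: "l < length us" "us ! l = u''" using u''(1) us(2) by (metis in_set_conv_nth)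
    have "l < j" using mono[of j l] u''(4) l by (meson leD not_less)
    then show "\<exists>l<j. \<exists>v w. lookup (us ! j) v < lookup (us ! i) v \<and>
        us ! l + single w 1 = us ! j + single v 1"
      using u'' l by blast
  qed (use us mon_degree_cover_monomials in auto)
  then show ?thesis by (simp add: us(2) cover_ideal_power)
qed

end

section \<open>Regular sequences at the origin\<close>

abbreviation constant_term :: "('v::finite, 'k::field) mpoly \<Rightarrow> 'k" where
  "constant_term p \<equiv> lookup p 0"

lemma vars_ideal_UNIV_iff:
  fixes p :: "('v::finite, 'k::field) mpoly"
  shows "p \<in> vars_ideal UNIV \<longleftrightarrow> constant_term p = 0"
proof -
  have "(\<exists>v. lookup m v \<noteq> 0) \<longleftrightarrow> m \<noteq> 0" for m :: "'v \<Rightarrow>\<^sub>0 nat"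
    by (metis lookup_zero poly_mapping_eqI)
  then show ?thesis by (auto simp: vars_ideal_def in_keys_iff)
qed

text \<open>
  Multiply the largest monomials of \<open>p\<close> and \<open>q\<close> that avoid the variables in \<open>A\<close>: no other pair of monomials
  has the same product, because a monomial avoiding \<open>A\<close> has only factors avoiding \<open>A\<close>.
\<close>

lemma vars_ideal_prime:
  fixes p q :: "('v::finite, 'k::field) mpoly"
  assumes "p * q \<in> vars_ideal A"
  shows "p \<in> vars_ideal A \<or> q \<in> vars_ideal A"
proof (rule ccontr)
  assume neg: "\<not> ?thesis"
  obtain \<iota> :: "'v \<Rightarrow> nat" where \<iota>: "inj \<iota>" using exists_ranking[of "\<lambda>_. 0"] by blast
  define key where "key = relabel \<iota>"
  have inj: "inj key" unfolding key_def using \<iota> by (rule inj_relabel)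
  define N where "N f = {m \<in> keys f. \<forall>v\<in>A. lookup m v = 0}" for f :: "('v, 'k) mpoly"
  have fin: "finite (N f)" for f by (simp add: N_def)
  have N: "f \<in> vars_ideal A \<longleftrightarrow> N f = {}" for f by (auto simp: vars_ideal_def N_def)
  have max: "\<exists>m\<in>N f. \<forall>n\<in>N f. key n \<le> key m" if "N f \<noteq> {}" for f
  proof -
    have "Max (key ` N f) \<in> key ` N f" using that fin by (intro Max_in) auto
    then obtain m where "Max (key ` N f) = key m" "m \<in> N f" by (rule imageE)
    moreover have "key n \<le> Max (key ` N f)" if "n \<in> N f" for n using that fin by (intro Max_ge) auto
    ultimately show ?thesis by (intro bexI[of _ m]) auto
  qed
  obtain a where a: "a \<in> N p" "\<And>n. n \<in> N p \<Longrightarrow> key n \<le> key a" using neg N max[of p] by blast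
  obtain b where b: "b \<in> N q" "\<And>n. n \<in> N q \<Longrightarrow> key n \<le> key b" using neg N max[of q] by blast
  have ab: "m = a \<and> n = b" if mn: "m \<in> keys p" "n \<in> keys q" "m + n = a + b" for m n
  proof -
    have "lookup m v = 0 \<and> lookup n v = 0" if "v \<in> A" for v
    proof -
      have "lookup (m + n) v = 0"
        unfolding mn(3) using a(1) b(1) that by (simp add: N_def lookup_add)
      then show ?thesis by (simp add: lookup_add)
    qed
    then have "m \<in> N p" "n \<in> N q" using mn by (simp_all add: N_def)
    then have le: "key m \<le> key a" "key n \<le> key b" using a b by blast+
    have eq: "key m + key n = key a + key b"
      using arg_cong[OF mn(3), of key] by (simp add: key_def relabel_add)
    have "key m = key a"
    proof (rule ccontr)
      assume "key m \<noteq> key a"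
      then have "key m + key n < key a + key b" using le by (intro add_less_le_mono) auto
      with eq show False by simp
    qed
    with eq have "key m = key a" "key n = key b" by simp_all
    then show ?thesis using inj by (simp add: inj_eq)
  qed
  have "lookup (p * q) (a + b) = lookup p a * lookup q b"
  proof -
    have "p * q = (\<Sum>m\<in>keys p. \<Sum>n\<in>keys q.
        single (m + n) (lookup p m * lookup q n))"
      by (subst mpoly_sum_single[of p], subst mpoly_sum_single[of q])
        (simp add: sum_product mult_single)
    then have "lookup (p * q) (a + b) = (\<Sum>m\<in>keys p. \<Sum>n\<in>keys q.
        if m + n = a + b then lookup p m * lookup q n else 0)"
      by (simp add: lookup_sum lookup_single when_def)
    also have "\<dots> = (\<Sum>m\<in>keys p. \<Sum>n\<in>keys q.
        if m = a \<and> n = b then lookup p m * lookup q n else 0)"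
    proof (intro sum.cong refl if_cong)
      fix m n assume "m \<in> keys p" "n \<in> keys q"
      then show "m + n = a + b \<longleftrightarrow> m = a \<and> n = b" using ab[of m n] by blast
    qed
    also have "\<dots> = (\<Sum>m\<in>keys p. if m = a then lookup p m * lookup q b else 0)"
      using b(1) by (intro sum.cong refl) (auto simp: N_def)
    also have "\<dots> = lookup p a * lookup q b"
      using a(1) by (simp add: N_def)
    finally show ?thesis .
  qed
  moreover have "lookup p a \<noteq> 0" "lookup q b \<noteq> 0"
    using a(1) b(1) by (simp_all add: N_def in_keys_iff)
  ultimately have "a + b \<in> keys (p * q)" by (simp add: in_keys_iff)
  then obtain v where "v \<in> A" "lookup (a + b) v \<noteq> 0"
    using assms unfolding vars_ideal_def by blast
  then show False using a(1) b(1) by (simp add: N_def lookup_add)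
qed

lemma constant_term_mult_neq_0:
  fixes p q :: "('v::finite, 'k::field) mpoly"
  shows "constant_term p \<noteq> 0 \<Longrightarrow> constant_term q \<noteq> 0 \<Longrightarrow> constant_term (p * q) \<noteq> 0"
  using vars_ideal_prime[of p q UNIV] unfolding vars_ideal_UNIV_iff by blast

text \<open>
  The contractions to the polynomial ring of ideals of its localization at the origin: a polynomial
  becomes a unit there exactly if its constant term is nonzero.
\<close>

definition local_ideal :: "('v::finite, 'k::field) mpoly set \<Rightarrow> bool" where
  "local_ideal J \<longleftrightarrow> ideal J mpoly_ring \<and> (\<forall>u b. constant_term u \<noteq> 0 \<longrightarrow> u * b \<in> J \<longrightarrow> b \<in> J)"

text \<open>
  The local ideal generated by \<open>J\<close> and \<open>x\<close>.
\<close>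

definition adjoin :: "('v::finite, 'k::field) mpoly set \<Rightarrow> ('v, 'k) mpoly \<Rightarrow> ('v, 'k) mpoly set" where
  "adjoin J x = {b. \<exists>u r. constant_term u \<noteq> 0 \<and> u * b - r * x \<in> J}"

lemma adjoinI: "constant_term u \<noteq> 0 \<Longrightarrow> u * b - r * x \<in> J \<Longrightarrow> b \<in> adjoin J x"
  unfolding adjoin_def by blast

lemma adjoinE:
  assumes "b \<in> adjoin J x"
  obtains u r where "constant_term u \<noteq> 0" "u * b - r * x \<in> J"
  using assms unfolding adjoin_def by blast

lemma
  assumes "local_ideal J"
  shows local_ideal_zero: "0 \<in> J"
    and local_ideal_add: "a \<in> J \<Longrightarrow> b \<in> J \<Longrightarrow> a + b \<in> J"
    and local_ideal_mult: "b \<in> J \<Longrightarrow> a * b \<in> J"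
    and local_ideal_diff: "a \<in> J \<Longrightarrow> b \<in> J \<Longrightarrow> a - b \<in> J"
    and local_ideal_cancel: "constant_term u \<noteq> 0 \<Longrightarrow> u * b \<in> J \<Longrightarrow> b \<in> J"
proof -
  show *: "0 \<in> J" "a \<in> J \<Longrightarrow> b \<in> J \<Longrightarrow> a + b \<in> J" "b \<in> J \<Longrightarrow> a * b \<in> J"
      "constant_term u \<noteq> 0 \<Longrightarrow> u * b \<in> J \<Longrightarrow> b \<in> J" for a b u
    using assms unfolding local_ideal_def ideal_mpoly_iff by blast+
  show "a \<in> J \<Longrightarrow> b \<in> J \<Longrightarrow> a - b \<in> J"
    using *(2)[of a "- b"] *(3)[of b "- 1"] by simp
qed

lemma local_ideal_adjoin:
  assumes J: "local_ideal J"
  shows "local_ideal (adjoin J x)"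
  unfolding local_ideal_def ideal_mpoly_iff
proof (intro conjI ballI allI impI)
  show "0 \<in> adjoin J x"
    by (rule adjoinI[of 1 _ 0]) (simp_all add: local_ideal_zero[OF J])
next
  fix a b assume "a \<in> adjoin J x" "b \<in> adjoin J x"
  then obtain u r v s where ur: "constant_term u \<noteq> 0" "u * a - r * x \<in> J"
      and vs: "constant_term v \<noteq> 0" "v * b - s * x \<in> J"
    by (elim adjoinE)
  have "v * (u * a - r * x) + u * (v * b - s * x) \<in> J"
    by (intro local_ideal_add[OF J] local_ideal_mult[OF J] ur vs)
  also have "v * (u * a - r * x) + u * (v * b - s * x) = (u * v) * (a + b) - (v * r + u * s) * x"
    by (simp add: algebra_simps)
  finally show "a + b \<in> adjoin J x"
    by (rule adjoinI[rotated]) (rule constant_term_mult_neq_0[OF ur(1) vs(1)])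
next
  fix a b assume "b \<in> adjoin J x"
  then obtain u r where ur: "constant_term u \<noteq> 0" "u * b - r * x \<in> J" by (elim adjoinE)
  have "a * (u * b - r * x) \<in> J" by (rule local_ideal_mult[OF J ur(2)])
  also have "a * (u * b - r * x) = u * (a * b) - (a * r) * x" by (simp add: algebra_simps)
  finally show "a * b \<in> adjoin J x" by (rule adjoinI[OF ur(1)])
next
  fix u b assume u: "constant_term u \<noteq> 0" and "u * b \<in> adjoin J x"
  then obtain v r where vr: "constant_term v \<noteq> 0" "v * (u * b) - r * x \<in> J" by (elim adjoinE)
  then have "(v * u) * b - r * x \<in> J" by (simp add: mult.assoc)
  then show "b \<in> adjoin J x" by (rule adjoinI[OF constant_term_mult_neq_0[OF vr(1) u]])
qed

lemma adjoin_superset: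
  assumes "b \<in> J"
  shows "b \<in> adjoin J x"
  by (rule adjoinI[of 1 _ 0]) (use assms in simp_all)

lemma adjoin_self:
  assumes J: "local_ideal J"
  shows "r * x \<in> adjoin J x"
  by (rule adjoinI[of 1 _ r]) (simp_all add: local_ideal_zero[OF J])

fun local_regular :: "('v::finite, 'k::field) mpoly set \<Rightarrow> ('v, 'k) mpoly list \<Rightarrow> bool" where
  "local_regular J [] \<longleftrightarrow> True"
| "local_regular J (x # xs) \<longleftrightarrow> (\<forall>b. x * b \<in> J \<longrightarrow> b \<in> J) \<and> local_regular (adjoin J x) xs"

text \<open>
  Multiplication by \<open>x\<close> gives an exact sequence from \<open>S/B\<close> to \<open>S/A\<close> to \<open>S/C\<close>, injective on the left and
  surjective on the right. A sequence that is regular on both outer terms is regular on the middle one,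
  and factoring out its first element preserves the exact sequence.
\<close>

lemma regular_extension:
  assumes "local_ideal A" "local_ideal B" "local_ideal C"
    and "\<And>b. x * b \<in> A \<longleftrightarrow> b \<in> B" "C = adjoin A x"
    and "local_regular B ys" "local_regular C ys"
  shows "local_regular A ys"
  using assms
proof (induction ys arbitrary: A B C)
  case Nil
  show ?case by simp
next
  case (Cons y ys)
  note A = Cons.prems(1) and B = Cons.prems(2) and C = Cons.prems(3) and xB = Cons.prems(4) and CA = Cons.prems(5)
  have yB: "b \<in> B" if "y * b \<in> B" for b using Cons.prems(6) that by simp
  have yC: "b \<in> C" if "y * b \<in> C" for b using Cons.prems(7) that by simp
  have sub: "b \<in> C" if "b \<in> A" for b unfolding CA using that by (rule adjoin_superset)
  have yA: "b \<in> A" if b: "y * b \<in> A" for b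
  proof -
    have "b \<in> C" by (rule yC[OF sub[OF b]])
    then obtain u r where ur: "constant_term u \<noteq> 0" "u * b - r * x \<in> A" unfolding CA by (elim adjoinE)
    have "u * (y * b) - y * (u * b - r * x) \<in> A"
      by (intro local_ideal_diff[OF A] local_ideal_mult[OF A] b ur)
    also have "u * (y * b) - y * (u * b - r * x) = x * (y * r)" by (simp add: algebra_simps)
    finally have "y * r \<in> B" using xB by blast
    then have "x * r \<in> A" using yB xB by blast
    then have "u * b - r * x + x * r \<in> A" using ur(2) by (intro local_ideal_add[OF A])
    then have "u * b \<in> A" by (simp add: mult.commute)
    then show ?thesis by (rule local_ideal_cancel[OF A ur(1)])
  qed
  have "local_regular (adjoin A y) ys"
  proof (rule Cons.IH)
    show "local_ideal (adjoin A y)" "local_ideal (adjoin B y)" "local_ideal (adjoin C y)"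
      by (rule local_ideal_adjoin; fact)+
    show "x * b \<in> adjoin A y \<longleftrightarrow> b \<in> adjoin B y" for b
    proof
      assume "x * b \<in> adjoin A y"
      then obtain u s where us: "constant_term u \<noteq> 0" "u * (x * b) - s * y \<in> A" by (elim adjoinE)
      have "u * b * x \<in> C" unfolding CA by (rule adjoin_self[OF A])
      then have "u * b * x - (u * (x * b) - s * y) \<in> C" by (rule local_ideal_diff[OF C _ sub[OF us(2)]])
      also have "u * b * x - (u * (x * b) - s * y) = y * s" by (simp add: algebra_simps)
      finally have "s \<in> C" by (rule yC)
      then obtain v r where vr: "constant_term v \<noteq> 0" "v * s - r * x \<in> A" unfolding CA by (elim adjoinE)
      have "v * (u * (x * b) - s * y) + y * (v * s - r * x) \<in> A"
        by (intro local_ideal_add[OF A] local_ideal_mult[OF A] us vr)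
      also have "v * (u * (x * b) - s * y) + y * (v * s - r * x) = x * ((v * u) * b - r * y)"
        by (simp add: algebra_simps)
      finally have "(v * u) * b - r * y \<in> B" using xB by blast
      then show "b \<in> adjoin B y" by (rule adjoinI[OF constant_term_mult_neq_0[OF vr(1) us(1)]])
    next
      assume "b \<in> adjoin B y"
      then obtain u s where us: "constant_term u \<noteq> 0" "u * b - s * y \<in> B" by (elim adjoinE)
      then have "x * (u * b - s * y) \<in> A" using xB by blast
      also have "x * (u * b - s * y) = u * (x * b) - (x * s) * y" by (simp add: algebra_simps)
      finally show "x * b \<in> adjoin A y" by (rule adjoinI[OF us(1)])
    qed
    show "adjoin C y = adjoin (adjoin A y) x"
    proof (intro equalityI subsetI)
      fix b assume "b \<in> adjoin C y"
      then obtain u s where us: "constant_term u \<noteq> 0" "u * b - s * y \<in> C" by (elim adjoinE)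
      then obtain v r where vr: "constant_term v \<noteq> 0" "v * (u * b - s * y) - r * x \<in> A"
        unfolding CA by (elim adjoinE)
      have "v * (u * b - s * y) - r * x = 1 * (v * u * b - r * x) - (v * s) * y" by (simp add: algebra_simps)
      with vr(2) have "1 * (v * u * b - r * x) - (v * s) * y \<in> A" by simp
      then have "v * u * b - r * x \<in> adjoin A y" by (rule adjoinI[rotated]) simp
      then show "b \<in> adjoin (adjoin A y) x"
        by (rule adjoinI[OF constant_term_mult_neq_0[OF vr(1) us(1)]])
    next
      fix b assume "b \<in> adjoin (adjoin A y) x"
      then obtain u r where ur: "constant_term u \<noteq> 0" "u * b - r * x \<in> adjoin A y" by (rule adjoinE)
      then obtain v s where vs: "constant_term v \<noteq> 0" "v * (u * b - r * x) - s * y \<in> A" by (elim adjoinE)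
      have "v * (u * b - r * x) - s * y = 1 * (v * u * b - s * y) - (v * r) * x" by (simp add: algebra_simps)
      with vs(2) have "1 * (v * u * b - s * y) - (v * r) * x \<in> A" by simp
      then have "v * u * b - s * y \<in> C" unfolding CA by (rule adjoinI[rotated]) simp
      then show "b \<in> adjoin C y"
        by (rule adjoinI[OF constant_term_mult_neq_0[OF vs(1) ur(1)]])
    qed
    show "local_regular (adjoin B y) ys" "local_regular (adjoin C y) ys"
      using Cons.prems(6,7) by simp_all
  qed
  then show ?case using yA by simp
qed

text \<open>
  The quotients by consecutive powers of \<open>x\<close> and by \<open>x\<close> form an exact sequence as above.
\<close>

lemma regular_power_head:
  assumes J: "local_ideal J" and x: "\<And>b. x * b \<in> J \<Longrightarrow> b \<in> J" and reg: "local_regular (adjoin J x) ys"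
  shows "local_regular (adjoin J (x ^ Suc k)) ys"
proof (induction k)
  case 0
  show ?case using reg by simp
next
  case (Suc k)
  show ?case
  proof (rule regular_extension[OF _ _ _ _ _ Suc reg])
    show "local_ideal (adjoin J (x ^ Suc (Suc k)))" "local_ideal (adjoin J (x ^ Suc k))" "local_ideal (adjoin J x)"
      by (rule local_ideal_adjoin[OF J])+
    show "x * b \<in> adjoin J (x ^ Suc (Suc k)) \<longleftrightarrow> b \<in> adjoin J (x ^ Suc k)" for b
    proof
      assume "x * b \<in> adjoin J (x ^ Suc (Suc k))"
      then obtain u r where ur: "constant_term u \<noteq> 0" "u * (x * b) - r * x ^ Suc (Suc k) \<in> J" by (elim adjoinE)
      have "u * (x * b) - r * x ^ Suc (Suc k) = x * (u * b - r * x ^ Suc k)" by (simp add: algebra_simps)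
      with ur(2) have "x * (u * b - r * x ^ Suc k) \<in> J" by simp
      then have "u * b - r * x ^ Suc k \<in> J" by (rule x)
      then show "b \<in> adjoin J (x ^ Suc k)" by (rule adjoinI[OF ur(1)])
    next
      assume "b \<in> adjoin J (x ^ Suc k)"
      then obtain u r where ur: "constant_term u \<noteq> 0" "u * b - r * x ^ Suc k \<in> J" by (elim adjoinE)
      have "x * (u * b - r * x ^ Suc k) \<in> J" by (rule local_ideal_mult[OF J ur(2)])
      also have "x * (u * b - r * x ^ Suc k) = u * (x * b) - r * x ^ Suc (Suc k)" by (simp add: algebra_simps)
      finally show "x * b \<in> adjoin J (x ^ Suc (Suc k))" by (rule adjoinI[OF ur(1)])
    qed
    show "adjoin J x = adjoin (adjoin J (x ^ Suc (Suc k))) x"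
    proof (intro equalityI subsetI)
      fix b assume "b \<in> adjoin J x"
      then obtain u r where ur: "constant_term u \<noteq> 0" "u * b - r * x \<in> J" by (elim adjoinE)
      then show "b \<in> adjoin (adjoin J (x ^ Suc (Suc k))) x"
        by (intro adjoinI[OF ur(1)] adjoin_superset)
    next
      fix b assume "b \<in> adjoin (adjoin J (x ^ Suc (Suc k))) x"
      then obtain u r where ur: "constant_term u \<noteq> 0" "u * b - r * x \<in> adjoin J (x ^ Suc (Suc k))" by (rule adjoinE)
      then obtain v s where vs: "constant_term v \<noteq> 0" "v * (u * b - r * x) - s * x ^ Suc (Suc k) \<in> J" by (elim adjoinE)
      have "v * (u * b - r * x) - s * x ^ Suc (Suc k) = v * u * b - (v * r + s * x ^ Suc k) * x"
        by (simp add: algebra_simps)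
      with vs(2) have "v * u * b - (v * r + s * x ^ Suc k) * x \<in> J" by simp
      then show "b \<in> adjoin J x" by (rule adjoinI[OF constant_term_mult_neq_0[OF vs(1) ur(1)]])
    qed
  qed
qed

lemma regular_powers:
  assumes "local_ideal J" "local_regular J xs"
  shows "local_regular J (map (\<lambda>x. x ^ Suc k) xs)"
  using assms
proof (induction xs arbitrary: J)
  case Nil
  show ?case by simp
next
  case (Cons x xs)
  have x: "b \<in> J" if "x * b \<in> J" for b using Cons.prems(2) that by simp
  have pow: "b \<in> J" if "x ^ n * b \<in> J" for n b
    using that by (induction n) (auto simp: mult.assoc intro: x)
  have "local_regular (adjoin J (x ^ Suc k)) xs"
    using Cons.prems x by (intro regular_power_head) simp_all
  then have "local_regular (adjoin J (x ^ Suc k)) (map (\<lambda>x. x ^ Suc k) xs)"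
    by (intro Cons.IH local_ideal_adjoin Cons.prems)
  then show ?case using pow[of "Suc k"] by simp
qed

section \<open>Algebraic relations and regular sequences\<close>

fun adjoin_list :: "('v::finite, 'k::field) mpoly set \<Rightarrow> ('v, 'k) mpoly list \<Rightarrow> ('v, 'k) mpoly set" where
  "adjoin_list J [] = J"
| "adjoin_list J (x # xs) = adjoin_list (adjoin J x) xs"

definition monomial_value :: "'a::comm_ring_1 list \<Rightarrow> nat list \<Rightarrow> 'a" where
  "monomial_value xs \<alpha> = prod_list (map2 (^) xs \<alpha>)"

lemma monomial_value_simps [simp]:
  "monomial_value [] \<alpha> = 1" "monomial_value (x # xs) (e # \<alpha>) = x ^ e * monomial_value xs \<alpha>"
  by (simp_all add: monomial_value_def)

text \<open>
  If a polynomial in a regular sequence with unit coefficients kills \<open>a\<close> modulo \<open>J\<close>, then \<open>a\<close> lies in the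
  ideal generated by \<open>J\<close> and the sequence. Take out the least power of the first element \<open>x\<close>,
  cancel it, and reduce modulo \<open>x\<close>: what remains is a nonempty relation in the other elements. The
  exponents are kept as lists in order to match this recursion.
\<close>

lemma regular_relation:
  fixes cf :: "nat list \<Rightarrow> ('v::finite, 'k::field) mpoly"
  assumes "local_ideal J" "local_regular J xs"
    and "finite F" "F \<noteq> {}" "\<And>\<alpha>. \<alpha> \<in> F \<Longrightarrow> length \<alpha> = length xs"
    and "\<And>\<alpha>. \<alpha> \<in> F \<Longrightarrow> constant_term (cf \<alpha>) \<noteq> 0"
    and "(\<Sum>\<alpha>\<in>F. cf \<alpha> * monomial_value xs \<alpha>) * a \<in> J"
  shows "a \<in> adjoin_list J xs"
  using assms
proof (induction xs arbitrary: J F cf)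
  case Nil
  have "\<alpha> = []" if "\<alpha> \<in> F" for \<alpha> using Nil.prems(5)[OF that] by simp
  then have F: "F = {[]}" using Nil.prems(4) by blast
  have "cf [] * a \<in> J" using Nil.prems(7) by (simp add: F)
  then have "a \<in> J" using local_ideal_cancel[OF Nil.prems(1) Nil.prems(6)] F by blast
  then show ?case by simp
next
  case (Cons x xs)
  note J = Cons.prems(1)
  have nzd: "b \<in> J" if "x ^ n * b \<in> J" for n b
    using that by (induction n) (use Cons.prems(2) in \<open>auto simp: mult.assoc\<close>)
  \<comment> \<open>the least exponent of \<open>x\<close>; the exponents attaining it form \<open>F0\<close>\<close>
  define e where "e = Min (hd ` F)"
  have eF: "e \<in> hd ` F" unfolding e_def using Cons.prems(3,4) by (intro Min_in) auto
  have emin: "e \<le> hd \<alpha>" if "\<alpha> \<in> F" for \<alpha> unfolding e_def using Cons.prems(3) that by (intro Min_le) auto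
  have ne: "\<alpha> \<noteq> []" if "\<alpha> \<in> F" for \<alpha> using Cons.prems(5)[OF that] by auto
  define F0 where "F0 = {\<alpha> \<in> F. hd \<alpha> = e}"
  define T where "T = (\<Sum>\<alpha>\<in>F0. cf \<alpha> * monomial_value xs (tl \<alpha>))"
  define r where "r = (\<Sum>\<alpha>\<in>F - F0. cf \<alpha> * x ^ (hd \<alpha> - Suc e) * monomial_value xs (tl \<alpha>))"
  have val: "monomial_value (x # xs) \<alpha> = x ^ hd \<alpha> * monomial_value xs (tl \<alpha>)" if "\<alpha> \<in> F" for \<alpha>
    using ne[OF that] by (cases \<alpha>) simp_all
  have "(\<Sum>\<alpha>\<in>F. cf \<alpha> * monomial_value (x # xs) \<alpha>) =
      (\<Sum>\<alpha>\<in>F - F0. cf \<alpha> * monomial_value (x # xs) \<alpha>) + (\<Sum>\<alpha>\<in>F0. cf \<alpha> * monomial_value (x # xs) \<alpha>)"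
    by (rule sum.subset_diff) (use Cons.prems(3) in \<open>auto simp: F0_def\<close>)
  also have "(\<Sum>\<alpha>\<in>F0. cf \<alpha> * monomial_value (x # xs) \<alpha>) = x ^ e * T"
    unfolding T_def sum_distrib_left by (intro sum.cong refl) (simp add: F0_def val)
  also have "(\<Sum>\<alpha>\<in>F - F0. cf \<alpha> * monomial_value (x # xs) \<alpha>) = x ^ Suc e * r"
    unfolding r_def sum_distrib_left
  proof (intro sum.cong refl)
    fix \<alpha> assume \<alpha>: "\<alpha> \<in> F - F0"
    then have "hd \<alpha> \<noteq> e" "\<alpha> \<in> F" by (auto simp: F0_def)
    then have "Suc e \<le> hd \<alpha>" using emin[of \<alpha>] by linarith
    then have "x ^ hd \<alpha> = x ^ Suc e * x ^ (hd \<alpha> - Suc e)"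
      by (simp only: power_add[symmetric] le_add_diff_inverse)
    moreover have "monomial_value (x # xs) \<alpha> = x ^ hd \<alpha> * monomial_value xs (tl \<alpha>)" using val \<alpha> by blast
    ultimately show "cf \<alpha> * monomial_value (x # xs) \<alpha> =
        x ^ Suc e * (cf \<alpha> * x ^ (hd \<alpha> - Suc e) * monomial_value xs (tl \<alpha>))"
      by (simp only: mult_ac)
  qed
  finally have "(\<Sum>\<alpha>\<in>F. cf \<alpha> * monomial_value (x # xs) \<alpha>) * a = x ^ e * (T * a + r * a * x)"
    by (simp add: algebra_simps)
  with Cons.prems(7) have "x ^ e * (T * a + r * a * x) \<in> J" by simp
  then have "T * a + r * a * x \<in> J" by (rule nzd)
  then have "1 * (T * a) - (- r * a) * x \<in> J" by simp
  then have Ta: "T * a \<in> adjoin J x" by (rule adjoinI[rotated]) simp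
  have inj: "inj_on tl F0"
  proof (rule inj_onI)
    fix \<alpha> \<beta> assume "\<alpha> \<in> F0" "\<beta> \<in> F0" "tl \<alpha> = tl \<beta>"
    then show "\<alpha> = \<beta>" using ne by (metis (mono_tags, lifting) F0_def list.expand mem_Collect_eq)
  qed
  define cf' where "cf' \<beta> = cf (e # \<beta>)" for \<beta>
  have cons: "e # tl \<alpha> = \<alpha>" if "\<alpha> \<in> F0" for \<alpha> using that ne[of \<alpha>] by (cases \<alpha>) (simp_all add: F0_def)
  have T': "T = (\<Sum>\<beta>\<in>tl ` F0. cf' \<beta> * monomial_value xs \<beta>)"
    unfolding T_def by (subst sum.reindex[OF inj]) (simp add: cf'_def cons)
  have "a \<in> adjoin_list (adjoin J x) xs"
  proof (rule Cons.IH[where F = "tl ` F0" and cf = cf'])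
    show "local_ideal (adjoin J x)" by (rule local_ideal_adjoin[OF J])
    show "local_regular (adjoin J x) xs" using Cons.prems(2) by simp
    show "finite (tl ` F0)" using Cons.prems(3) by (simp add: F0_def)
    show "tl ` F0 \<noteq> {}" using eF by (auto simp: F0_def)
    fix \<beta> assume "\<beta> \<in> tl ` F0"
    then obtain \<alpha> where \<alpha>: "\<beta> = tl \<alpha>" "\<alpha> \<in> F0" by (rule imageE)
    then have "\<alpha> \<in> F" by (simp add: F0_def)
    then show "length \<beta> = length xs" using Cons.prems(5)[of \<alpha>] \<alpha> by simp
    show "constant_term (cf' \<beta>) \<noteq> 0" unfolding cf'_def \<alpha>(1) cons[OF \<alpha>(2)] by (rule Cons.prems(6)) fact
  next
    show "(\<Sum>\<alpha>\<in>tl ` F0. cf' \<alpha> * monomial_value xs \<alpha>) * a \<in> adjoin J x"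
      using Ta T' by simp
  qed
  then show ?case by simp
qed

lemma linear_dependence:
  fixes g :: "'a \<Rightarrow> 'b \<Rightarrow> 'k::field"
  assumes "finite B" "finite A" "card B < card A"
  shows "\<exists>c. (\<exists>\<alpha>\<in>A. c \<alpha> \<noteq> 0) \<and> (\<forall>\<beta>\<in>B. (\<Sum>\<alpha>\<in>A. c \<alpha> * g \<alpha> \<beta>) = 0)"
  using assms
proof (induction B arbitrary: A g rule: finite_induct)
  case empty
  then have "A \<noteq> {}" by auto
  then show ?case by (intro exI[of _ "\<lambda>_. 1"]) auto
next
  case (insert b B)
  show ?case
  proof (cases "\<forall>\<alpha>\<in>A. g \<alpha> b = 0")
    case True
    obtain c where c: "\<exists>\<alpha>\<in>A. c \<alpha> \<noteq> 0" "\<forall>\<beta>\<in>B. (\<Sum>\<alpha>\<in>A. c \<alpha> * g \<alpha> \<beta>) = 0"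
      using insert.IH[of A g] insert.prems insert.hyps by auto
    have "(\<Sum>\<alpha>\<in>A. c \<alpha> * g \<alpha> b) = 0" using True by (intro sum.neutral) simp
    then show ?thesis using c by (intro exI[of _ c]) simp
  next
    case False
    then obtain a where a: "a \<in> A" "g a b \<noteq> 0" by blast
    \<comment> \<open>Gaussian elimination of the equation \<open>b\<close> with pivot \<open>a\<close>\<close>
    define g' where "g' \<alpha> \<beta> = g \<alpha> \<beta> - g \<alpha> b / g a b * g a \<beta>" for \<alpha> \<beta>
    have "card B < card (A - {a})" using insert.prems insert.hyps a(1) by simp
    then obtain c where c: "\<exists>\<alpha>\<in>A - {a}. c \<alpha> \<noteq> 0" "\<And>\<beta>. \<beta> \<in> B \<Longrightarrow> (\<Sum>\<alpha>\<in>A - {a}. c \<alpha> * g' \<alpha> \<beta>) = 0"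
      using insert.IH[of "A - {a}" g'] insert.prems(1) by auto
    define s where "s = (\<Sum>\<alpha>\<in>A - {a}. c \<alpha> * g \<alpha> b) / g a b"
    define c' where "c' = c(a := - s)"
    have c': "(\<Sum>\<alpha>\<in>A. c' \<alpha> * g \<alpha> \<beta>) = (\<Sum>\<alpha>\<in>A - {a}. c \<alpha> * g \<alpha> \<beta>) - s * g a \<beta>" for \<beta>
    proof -
      have "(\<Sum>\<alpha>\<in>A. c' \<alpha> * g \<alpha> \<beta>) = c' a * g a \<beta> + (\<Sum>\<alpha>\<in>A - {a}. c' \<alpha> * g \<alpha> \<beta>)"
        by (rule sum.remove[OF insert.prems(1) a(1)])
      also have "(\<Sum>\<alpha>\<in>A - {a}. c' \<alpha> * g \<alpha> \<beta>) = (\<Sum>\<alpha>\<in>A - {a}. c \<alpha> * g \<alpha> \<beta>)"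
        by (intro sum.cong) (auto simp: c'_def)
      finally show ?thesis by (simp add: c'_def)
    qed
    have "(\<Sum>\<alpha>\<in>A. c' \<alpha> * g \<alpha> b) = 0" unfolding c' using a(2) by (simp add: s_def)
    moreover have "(\<Sum>\<alpha>\<in>A. c' \<alpha> * g \<alpha> \<beta>) = 0" if "\<beta> \<in> B" for \<beta>
    proof -
      have "(\<Sum>\<alpha>\<in>A - {a}. c \<alpha> * g' \<alpha> \<beta>) = (\<Sum>\<alpha>\<in>A - {a}. c \<alpha> * g \<alpha> \<beta>) - s * g a \<beta>"
      proof -
        have "s * g a \<beta> = (\<Sum>\<alpha>\<in>A - {a}. c \<alpha> * (g \<alpha> b / g a b * g a \<beta>))"
          unfolding s_def sum_divide_distrib sum_distrib_right by (intro sum.cong) simp_all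
        then show ?thesis by (simp add: g'_def right_diff_distrib sum_subtractf)
      qed
      then show ?thesis using c(2)[OF that] c' by simp
    qed
    moreover have "\<exists>\<alpha>\<in>A. c' \<alpha> \<noteq> 0" using c(1) by (auto simp: c'_def)
    ultimately show ?thesis by (intro exI[of _ c']) simp
  qed
qed

lemma mon_degree_prod_power:
  fixes ps :: "('v::finite, 'k::field) mpoly list"
  assumes "\<And>p m. p \<in> set ps \<Longrightarrow> m \<in> keys p \<Longrightarrow> mon_degree m \<le> D"
    and "length \<alpha> = length ps" "\<And>e. e \<in> set \<alpha> \<Longrightarrow> e \<le> t" "m \<in> keys (monomial_value ps \<alpha>)"
  shows "mon_degree m \<le> length ps * (t * D)"
  using assms
proof (induction ps arbitrary: \<alpha> m)
  case Nil
  then show ?case by (simp add: mon_degree_def)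
next
  case (Cons p ps)
  obtain e \<beta> where \<alpha>: "\<alpha> = e # \<beta>" using Cons.prems(2) by (cases \<alpha>) auto
  have pow: "mon_degree m \<le> n * D" if "m \<in> keys (p ^ n)" for m n
    using that
  proof (induction n arbitrary: m)
    case 0
    then show ?case by (simp add: mon_degree_def)
  next
    case (Suc n)
    then obtain a b where ab: "m = a + b" "a \<in> keys p" "b \<in> keys (p ^ n)"
      using keys_mult[of p "p ^ n"] by auto
    then show ?case using Suc.IH[of b] Cons.prems(1)[of p a] by (simp add: mon_degree_add)
  qed
  obtain a b where ab: "m = a + b" "a \<in> keys (p ^ e)" "b \<in> keys (monomial_value ps \<beta>)"
    using keys_mult[of "p ^ e" "monomial_value ps \<beta>"] Cons.prems(4) by (auto simp: \<alpha>)
  have "e \<le> t" using Cons.prems(3) by (simp add: \<alpha>)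
  then have "e * D \<le> t * D" by simp
  moreover have "mon_degree b \<le> length ps * (t * D)"
    by (rule Cons.IH[OF _ _ _ ab(3)]) (use Cons.prems in \<open>auto simp: \<alpha>\<close>)
  ultimately have "mon_degree m \<le> t * D + length ps * (t * D)"
    using pow[OF ab(2)] unfolding ab(1) mon_degree_add by linarith
  then show ?case by simp
qed

text \<open>
  More polynomials than variables are algebraically dependent, here modulo the variables in \<open>C\<close>. Among
  the monomials in the \<open>n\<close> polynomials with exponents at most \<open>t\<close> there are \<open>(t + 1) ^ n\<close>; modulo the
  variables in \<open>C\<close> they live in a space of dimension at most \<open>(n t D + 1) ^ d\<close>, which is smaller for
  large \<open>t\<close> as \<open>d < n\<close>.
\<close>

lemma algebraic_dependence:
  fixes ps :: "('v::finite, 'k::field) mpoly list"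
  assumes "card (UNIV - C) < length ps"
  shows "\<exists>F cf. finite F \<and> F \<noteq> {} \<and> (\<forall>\<alpha>\<in>F. length \<alpha> = length ps \<and> constant_term (cf \<alpha>) \<noteq> 0) \<and>
     (\<Sum>\<alpha>\<in>F. cf \<alpha> * monomial_value ps \<alpha>) \<in> vars_ideal C"
proof -
  define n where "n = length ps"
  define d where "d = card (UNIV - C)"
  define D where "D = Max (insert 0 (mon_degree ` (\<Union>p\<in>set ps. keys p)))"
  have D: "mon_degree m \<le> D" if "p \<in> set ps" "m \<in> keys p" for p m
    unfolding D_def using that by (intro Max_ge) auto
  \<comment> \<open>\<open>n t D + 1 \<le> (n D + 1) (t + 1)\<close>, so \<open>t = (n D + 1) ^ d\<close> makes the dimension at most \<open>t (t + 1) ^ d\<close>\<close>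
  define t where "t = (n * D + 1) ^ d"
  define K where "K = n * (t * D)"
  define A where "A = {\<alpha>. set \<alpha> \<subseteq> {..t} \<and> length \<alpha> = n}"
  define B where "B = {m :: 'v \<Rightarrow>\<^sub>0 nat. mon_degree m \<le> K \<and> (\<forall>v\<in>C. lookup m v = 0)}"
  have finA: "finite A" unfolding A_def by (rule finite_lists_length_eq) simp
  have cardA: "card A = (t + 1) ^ n" unfolding A_def by (subst card_lists_length_eq) simp_all
  \<comment> \<open>monomials in \<open>B\<close> are determined by their exponents outside \<open>C\<close>\<close>
  define \<rho> where "\<rho> m = restrict (lookup m) (UNIV - C)" for m :: "'v \<Rightarrow>\<^sub>0 nat"
  have inj: "inj_on \<rho> B"
  proof (rule inj_onI, rule poly_mapping_eqI)
    fix m m' v assume m: "m \<in> B" "m' \<in> B" "\<rho> m = \<rho> m'"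
    show "lookup m v = lookup m' v"
    proof (cases "v \<in> C")
      case True
      then show ?thesis using m(1,2) by (simp add: B_def)
    next
      case False
      then show ?thesis using fun_cong[OF m(3), of v] by (simp add: \<rho>_def)
    qed
  qed
  have img: "\<rho> ` B \<subseteq> Pi\<^sub>E (UNIV - C) (\<lambda>_. {..K})"
  proof (rule image_subsetI)
    fix m assume "m \<in> B"
    then have "lookup m v \<le> K" for v
      using member_le_sum[of v UNIV "lookup m"] by (simp add: B_def mon_degree_def)
    then show "\<rho> m \<in> Pi\<^sub>E (UNIV - C) (\<lambda>_. {..K})" by (auto simp: \<rho>_def)
  qed
  have finP: "finite (Pi\<^sub>E (UNIV - C) (\<lambda>_ :: 'v. {..K}))" by (intro finite_PiE) auto
  have finB: "finite B" using inj_on_finite[OF inj img finP] .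
  have "card B \<le> (K + 1) ^ d"
    using card_inj_on_le[OF inj img finP] by (simp add: card_PiE d_def)
  also have "(K + 1) ^ d \<le> ((n * D + 1) * (t + 1)) ^ d"
    by (intro power_mono) (simp_all add: K_def algebra_simps)
  also have "\<dots> = t * (t + 1) ^ d" by (simp only: power_mult_distrib t_def[symmetric])
  also have "\<dots> < (t + 1) * (t + 1) ^ d" by simp
  also have "\<dots> = (t + 1) ^ Suc d" by simp
  also have "\<dots> \<le> (t + 1) ^ n" using assms by (intro power_increasing) (simp_all add: n_def d_def)
  finally have "card B < card A" by (simp add: cardA)
  then obtain c where c: "\<exists>\<alpha>\<in>A. c \<alpha> \<noteq> 0"
      "\<And>m. m \<in> B \<Longrightarrow> (\<Sum>\<alpha>\<in>A. c \<alpha> * lookup (monomial_value ps \<alpha>) m) = (0 :: 'k)"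
    using linear_dependence[OF finB finA, of "\<lambda>\<alpha>. lookup (monomial_value ps \<alpha>)"] by blast
  define F where "F = {\<alpha> \<in> A. c \<alpha> \<noteq> 0}"
  define cf :: "nat list \<Rightarrow> ('v, 'k) mpoly" where "cf \<alpha> = single 0 (c \<alpha>)" for \<alpha>
  define f where "f = (\<Sum>\<alpha>\<in>F. cf \<alpha> * monomial_value ps \<alpha>)"
  have look: "lookup (cf \<alpha> * p) m = c \<alpha> * lookup p m" for \<alpha> p m
  proof -
    have "cf \<alpha> * p = Poly_Mapping.map ((*) (c \<alpha>)) p" by (simp add: cf_def mult_map_scale_conv_mult)
    then show ?thesis by (simp add: Poly_Mapping.map.rep_eq when_def)
  qed
  have keys: "mon_degree m \<le> K" if "\<alpha> \<in> A" "m \<in> keys (monomial_value ps \<alpha>)" for \<alpha> m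
    unfolding K_def n_def
    by (rule mon_degree_prod_power[OF _ _ _ that(2)]) (use D that(1) in \<open>auto simp: A_def n_def\<close>)
  have fl: "lookup f m = (\<Sum>\<alpha>\<in>A. c \<alpha> * lookup (monomial_value ps \<alpha>) m)" for m
    unfolding f_def lookup_sum look F_def by (intro sum.mono_neutral_cong_left finA) auto
  have "\<exists>v\<in>C. lookup m v \<noteq> 0" if m: "m \<in> keys f" for m
  proof (rule ccontr)
    assume neg: "\<not> ?thesis"
    have "mon_degree m \<le> K"
    proof (rule ccontr)
      assume "\<not> ?thesis"
      then have "lookup (monomial_value ps \<alpha>) m = 0" if "\<alpha> \<in> A" for \<alpha>
        using keys[OF that] by (auto simp: in_keys_iff)
      then have "lookup f m = 0" unfolding fl by (intro sum.neutral) simp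
      with m show False by (simp add: in_keys_iff)
    qed
    then have "m \<in> B" using neg by (simp add: B_def)
    then have "lookup f m = 0" using c(2) fl by simp
    with m show False by (simp add: in_keys_iff)
  qed
  then have "f \<in> vars_ideal C" by (simp add: vars_ideal_def)
  moreover have "finite F" "F \<noteq> {}" using finA c(1) by (auto simp: F_def)
  moreover have "length \<alpha> = length ps \<and> constant_term (cf \<alpha>) \<noteq> 0" if "\<alpha> \<in> F" for \<alpha>
    using that by (simp add: F_def A_def n_def cf_def)
  ultimately show ?thesis unfolding f_def by blast
qed

section \<open>Regular sequences modulo an edge ideal\<close>

definition edge_monomials :: "'v::finite set set \<Rightarrow> ('v \<Rightarrow>\<^sub>0 nat) set" where
  "edge_monomials E = {single u 1 + single v 1 | u v. {u, v} \<in> E}"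

lemma edge_ideal_eq: "(edge_ideal E :: ('v::finite, 'k::field) mpoly set) = monomial_ideal (edge_monomials E)"
proof -
  have "edge_monomials E \<subseteq> (\<lambda>(u, v). single u 1 + single v 1) ` (UNIV \<times> UNIV)"
    unfolding edge_monomials_def by auto
  then have fin: "finite (edge_monomials E)" by (rule finite_subset) simp
  have "{pvar u * pvar v :: ('v, 'k) mpoly | u v. {u, v} \<in> E} =
      {single m 1 | m. m \<in> edge_monomials E}"
    unfolding edge_monomials_def pvar_def by (auto simp: mult_single simp del: single_one)
  then show ?thesis unfolding edge_ideal_def by (simp add: genideal_monomials[OF fin])
qed

text \<open>
  The local ideal generated by an ideal \<open>I\<close>.
\<close>

definition localize :: "('v::finite, 'k::field) mpoly set \<Rightarrow> ('v, 'k) mpoly set" where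
  "localize I = {b. \<exists>u. constant_term u \<noteq> 0 \<and> u * b \<in> I}"

lemma local_ideal_localize:
  assumes I: "ideal I mpoly_ring"
  shows "local_ideal (localize I)"
proof -
  have I': "0 \<in> I" "\<And>a b. a \<in> I \<Longrightarrow> b \<in> I \<Longrightarrow> a + b \<in> I" "\<And>a b. b \<in> I \<Longrightarrow> a * b \<in> I"
    using I unfolding ideal_mpoly_iff by blast+
  show ?thesis
    unfolding local_ideal_def ideal_mpoly_iff
  proof (intro conjI ballI allI impI)
    show "0 \<in> localize I" unfolding localize_def using I'(1) by (intro CollectI exI[of _ 1]) simp
  next
    fix a b assume "a \<in> localize I" "b \<in> localize I"
    then obtain u v where uv: "constant_term u \<noteq> 0" "u * a \<in> I" "constant_term v \<noteq> 0" "v * b \<in> I"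
      unfolding localize_def by blast
    have "v * (u * a) + u * (v * b) \<in> I" using uv I' by blast
    then have "(u * v) * (a + b) \<in> I" by (simp add: algebra_simps)
    then show "a + b \<in> localize I"
      unfolding localize_def using constant_term_mult_neq_0[OF uv(1,3)] by blast
  next
    fix a b assume "b \<in> localize I"
    then obtain u where u: "constant_term u \<noteq> 0" "u * b \<in> I" unfolding localize_def by blast
    have "a * (u * b) \<in> I" using u I' by blast
    then have "u * (a * b) \<in> I" by (simp add: mult.left_commute)
    then show "a * b \<in> localize I" unfolding localize_def using u(1) by blast
  next
    fix u b assume u: "constant_term u \<noteq> 0" and "u * b \<in> localize I"
    then obtain v where v: "constant_term v \<noteq> 0" "v * (u * b) \<in> I" unfolding localize_def by blast
    then have "(v * u) * b \<in> I" by (simp add: mult.assoc)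
    then show "b \<in> localize I" unfolding localize_def using constant_term_mult_neq_0[OF v(1) u] by blast
  qed
qed

lemma adjoin_list_obtain:
  fixes J Q :: "('v::finite, 'k::field) mpoly set"
  assumes "a \<in> adjoin_list J xs" "ideal Q mpoly_ring" "\<And>x. x \<in> set xs \<Longrightarrow> x \<in> Q"
  shows "\<exists>u q. constant_term u \<noteq> 0 \<and> q \<in> Q \<and> u * a - q \<in> J"
  using assms
proof (induction xs arbitrary: J)
  case Nil
  then show ?case by (intro exI[of _ 1] exI[of _ 0]) (simp add: ideal_mpoly_iff)
next
  case (Cons x xs)
  obtain u q where uq: "constant_term u \<noteq> 0" "q \<in> Q" "u * a - q \<in> adjoin J x"
    using Cons.IH[of "adjoin J x"] Cons.prems by auto
  obtain v r where vr: "constant_term v \<noteq> 0" "v * (u * a - q) - r * x \<in> J"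
    using uq(3) by (rule adjoinE)
  have "v * (u * a - q) - r * x = (v * u) * a - (v * q + r * x)" by (simp add: algebra_simps)
  with vr(2) have "(v * u) * a - (v * q + r * x) \<in> J" by simp
  moreover have "v * q + r * x \<in> Q" using Cons.prems(2) Cons.prems(3)[of x] uq(2) by (simp add: ideal_mpoly_iff)
  ultimately show ?case using constant_term_mult_neq_0[OF vr(1) uq(1)] by blast
qed

lemma ideal_high_degree: "ideal {q :: ('v::finite, 'k::field) mpoly. \<forall>m\<in>keys q. N \<le> mon_degree m} mpoly_ring"
  unfolding ideal_mpoly_iff
proof (intro conjI ballI allI)
  fix a b :: "('v, 'k) mpoly"
  assume "a \<in> {q. \<forall>m\<in>keys q. N \<le> mon_degree m}" "b \<in> {q. \<forall>m\<in>keys q. N \<le> mon_degree m}"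
  then show "a + b \<in> {q. \<forall>m\<in>keys q. N \<le> mon_degree m}" using keys_add[of a b] by blast
next
  fix a b :: "('v, 'k) mpoly"
  assume b: "b \<in> {q. \<forall>m\<in>keys q. N \<le> mon_degree m}"
  show "a * b \<in> {q. \<forall>m\<in>keys q. N \<le> mon_degree m}"
  proof (intro CollectI ballI)
    fix m assume "m \<in> keys (a * b)"
    then obtain m' n where mn: "m = m' + n" "n \<in> keys b" using keys_mult[of a b] by blast
    then have "N \<le> mon_degree n" using b by blast
    then show "N \<le> mon_degree m" by (simp add: mn(1) mon_degree_add)
  qed
qed simp

lemma power_high_degree:
  fixes x :: "('v::finite, 'k::field) mpoly"
  assumes "constant_term x = 0" "m \<in> keys (x ^ n)"
  shows "n \<le> mon_degree m"
  using assms(2)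
proof (induction n arbitrary: m)
  case (Suc n)
  obtain a b where ab: "m = a + b" "a \<in> keys x" "b \<in> keys (x ^ n)"
    using keys_mult[of x "x ^ n"] Suc.prems by auto
  have "x \<in> vars_ideal UNIV" using assms(1) by (simp add: vars_ideal_UNIV_iff)
  then obtain v where "lookup a v \<noteq> 0" using ab(2) unfolding vars_ideal_def by blast
  then have "1 \<le> mon_degree a" using member_le_sum[of v UNIV "lookup a"] by (simp add: mon_degree_def)
  then show ?case using Suc.IH[OF ab(3)] by (simp add: ab(1) mon_degree_add)
qed simp

text \<open>
  The product \<open>a\<close> of the variables outside \<open>C\<close> is annihilated modulo the edge ideal by every variable in \<open>C\<close>,
  by minimality of \<open>C\<close>. A longer regular sequence would, after raising its members to the power
  \<open>N + 1\<close> with \<open>N\<close> the degree of \<open>a\<close>, satisfy a relation modulo these variables. Then \<open>a\<close> would be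
  congruent modulo the localized edge ideal to a polynomial all of whose monomials have degree above \<open>N\<close>.
  Comparing the coefficients at the monomial \<open>a\<close> makes it divisible by an edge monomial, so some edge
  would lie outside the cover \<open>C\<close>.
\<close>

lemma regular_length_le:
  fixes ps :: "('v::finite, 'k::field) mpoly list"
  assumes simple: "\<And>e. e \<in> E \<Longrightarrow> \<exists>u v. u \<noteq> v \<and> e = {u, v}" and C: "minimal_vertex_cover E C"
    and ps: "\<And>x. x \<in> set ps \<Longrightarrow> constant_term x = 0"
    and reg: "local_regular (localize (edge_ideal E)) ps"
  shows "length ps \<le> card (UNIV - C)"
proof (rule ccontr)
  assume long: "\<not> ?thesis"
  define I :: "('v, 'k) mpoly set" where "I = edge_ideal E"
  have I: "I = monomial_ideal (edge_monomials E)" unfolding I_def by (rule edge_ideal_eq)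
  have idI: "ideal I mpoly_ring" unfolding I by (rule ideal_monomial_ideal)
  define a0 where "a0 = mon_of (\<lambda>v. if v \<in> C then 0 else 1)"
  define a :: "('v, 'k) mpoly" where "a = single a0 1"
  define N where "N = mon_degree a0"
  define qs where "qs = map (\<lambda>x. x ^ Suc N) ps"
  have reg': "local_regular (localize I) qs"
    unfolding qs_def I_def by (intro regular_powers local_ideal_localize idI[unfolded I_def] reg)
  have "card (UNIV - C) < length qs" using long by (simp add: qs_def)
  then obtain F cf where F: "finite F" "F \<noteq> {}" "\<And>\<alpha>. \<alpha> \<in> F \<Longrightarrow> length \<alpha> = length qs"
      "\<And>\<alpha>. \<alpha> \<in> F \<Longrightarrow> constant_term (cf \<alpha>) \<noteq> 0" "(\<Sum>\<alpha>\<in>F. cf \<alpha> * monomial_value qs \<alpha>) \<in> vars_ideal C"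
    using algebraic_dependence[of C qs] by blast
  define f where "f = (\<Sum>\<alpha>\<in>F. cf \<alpha> * monomial_value qs \<alpha>)"
  have "f * a \<in> I"
    unfolding I monomial_ideal_def
  proof (intro CollectI ballI)
    fix m assume "m \<in> keys (f * a)"
    then obtain m' where m': "m = m' + a0" "m' \<in> keys f"
      using keys_mult[of f a] by (auto simp: a_def)
    then obtain v where v: "v \<in> C" "lookup m' v \<noteq> 0"
      using F(5) unfolding f_def vars_ideal_def by blast
    have "\<not> vertex_cover E (C - {v})" "vertex_cover E C"
      using C v(1) unfolding minimal_vertex_cover_def by blast+
    then obtain e where e: "e \<in> E" "e \<inter> (C - {v}) = {}" "e \<inter> C \<noteq> {}"
      unfolding vertex_cover_def by blast
    obtain p q where xy: "p \<noteq> q" "e = {p, q}" using simple[OF e(1)] by blast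
    have "v \<in> {p, q}" using e(2,3) unfolding xy(2) by blast
    then obtain w where w': "{p, q} = {v, w}" "w \<noteq> v" using xy(1) by (metis doubleton_eq_iff insertE singletonD)
    have "w \<notin> C" using e(2) w'(2) unfolding xy(2) w'(1) by blast
    moreover have "{v, w} \<in> E" using e(1) unfolding xy(2) w'(1) .
    ultimately have "\<exists>w. w \<notin> C \<and> {v, w} \<in> E" by blast
    then obtain w where w: "w \<notin> C" "{v, w} \<in> E" by blast
    have vw: "v \<noteq> w" using v w by blast
    define x where "x = single v 1 + single w (1 :: nat)"
    have lm: "lookup m z = lookup m' z + (if z \<in> C then 0 else 1)" for z
      by (simp add: m'(1) a0_def lookup_add)
    have le: "lookup x z \<le> lookup m z" for z
    proof -
      have xz: "lookup x z = (if v = z then 1 else 0) + (if w = z then 1 else 0)"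
        by (simp add: x_def lookup_add lookup_single when_def)
      consider "z = v" | "z = w" | "z \<noteq> v" "z \<noteq> w" by blast
      then show ?thesis
      proof cases
        case 1
        then show ?thesis using vw v(2) xz lm[of z] by simp
      next
        case 2
        then show ?thesis using vw w(1) xz lm[of z] by simp
      qed (simp add: xz)
    qed
    have "m = x + (m - x)"
      by (rule poly_mapping_eqI) (simp only: lookup_add lookup_minus le_add_diff_inverse[OF le])
    moreover have "x \<in> edge_monomials E"
      unfolding edge_monomials_def x_def using w(2) by blast
    ultimately show "\<exists>u\<in>edge_monomials E. \<exists>n. m = u + n" by blast
  qed
  then have "f * a \<in> localize I" unfolding localize_def by (intro CollectI exI[of _ 1]) simp
  then have fa: "(\<Sum>\<alpha>\<in>F. cf \<alpha> * monomial_value qs \<alpha>) * a \<in> localize I" unfolding f_def .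
  have aq: "a \<in> adjoin_list (localize I) qs"
  proof (rule regular_relation[where F = F and cf = cf])
    show "local_ideal (localize I)" by (rule local_ideal_localize[OF idI])
  qed (fact reg' F fa)+
  have "x \<in> {q. \<forall>m\<in>keys q. Suc N \<le> mon_degree m}" if x: "x \<in> set qs" for x
  proof (intro CollectI ballI)
    obtain y where y: "x = y ^ Suc N" "y \<in> set ps" using x unfolding qs_def set_map by (rule imageE)
    fix m assume "m \<in> keys x"
    then show "Suc N \<le> mon_degree m" unfolding y(1) by (rule power_high_degree[OF ps[OF y(2)]])
  qed
  from adjoin_list_obtain[OF aq ideal_high_degree this] obtain u q where uq: "constant_term u \<noteq> 0"
      "q \<in> {q. \<forall>m\<in>keys q. Suc N \<le> mon_degree m}" "u * a - q \<in> localize I"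
    by blast
  then obtain v where v: "constant_term v \<noteq> 0" "v * (u * a - q) \<in> I" unfolding localize_def by blast
  have "v * q \<in> {q. \<forall>m\<in>keys q. Suc N \<le> mon_degree m}"
    using ideal_high_degree[of "Suc N"] uq(2) unfolding ideal_mpoly_iff by blast
  then have "a0 \<notin> keys (v * q)" by (auto simp: N_def)
  then have "lookup (v * (u * a - q)) a0 = lookup ((v * u) * a) (0 + a0)"
    by (simp add: right_diff_distrib lookup_minus in_keys_iff mult.assoc)
  also have "\<dots> = constant_term (v * u)" unfolding a_def by (rule lookup_mult_single_add)
  also have "\<dots> \<noteq> 0" by (rule constant_term_mult_neq_0[OF v(1) uq(1)])
  finally have "a0 \<in> keys (v * (u * a - q))" by (simp add: in_keys_iff)
  then obtain x y n where xy: "{x, y} \<in> E" "a0 = single x 1 + single y 1 + n"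
    using v(2) unfolding I monomial_ideal_def edge_monomials_def by blast
  have "lookup a0 x \<noteq> 0" "lookup a0 y \<noteq> 0"
    unfolding xy(2) by (simp_all add: lookup_add)
  then have out: "x \<notin> C" "y \<notin> C" by (auto simp: a0_def split: if_splits)
  have "vertex_cover E C" using C unfolding minimal_vertex_cover_def by (rule conjunct1)
  then have "{x, y} \<inter> C \<noteq> {}" unfolding vertex_cover_def using xy(1) by (rule bspec)
  then show False using out by simp
qed

text \<open>
  Throughout, \<open>R\<close> is the quotient ring by \<open>I\<close>, \<open>M\<close> the maximal ideal of the origin, \<open>D\<close> the set of
  denominators, \<open>L\<close> the local ring and \<open>frac a s\<close> its element represented by \<open>a\<close> and \<open>s\<close>.
\<close>

section \<open>The local ring of a quotient at the origin\<close>

locale local_quotient =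
  fixes I :: "('v::finite, 'k::field) mpoly set"
  assumes ideal_I: "ideal I mpoly_ring" and proper: "\<And>p. p \<in> I \<Longrightarrow> constant_term p = 0"
begin

lemma I_add: "a \<in> I \<Longrightarrow> b \<in> I \<Longrightarrow> a + b \<in> I" and I_mult: "b \<in> I \<Longrightarrow> a * b \<in> I" and I_zero: "0 \<in> I"
  using ideal_I unfolding ideal_mpoly_iff by blast+

lemma I_uminus: "a \<in> I \<Longrightarrow> - a \<in> I"
  using I_mult[of a "- 1"] by simp

definition coset :: "('v, 'k) mpoly \<Rightarrow> ('v, 'k) mpoly set" where
  "coset p = I +>\<^bsub>mpoly_ring\<^esub> p"

abbreviation R where "R \<equiv> mpoly_ring Quot I"

lemma coset_eq_iff: "coset p = coset q \<longleftrightarrow> p - q \<in> I"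
proof -
  have "p \<ominus>\<^bsub>mpoly_ring\<^esub> q = p - q" by (simp add: a_minus_def mpoly_a_inv)
  then show ?thesis
    unfolding coset_def using mpoly_cring.quotient_eq_iff_same_a_r_cos[OF ideal_I, of p q] by simp
qed

lemma carrier_R: "carrier R = range coset"
  unfolding FactRing_simps coset_def by auto

lemma mult_R: "coset p \<otimes>\<^bsub>R\<^esub> coset q = coset (p * q)"
  using ideal.rcoset_mult_add[OF ideal_I, of p q] by (simp add: FactRing_def coset_def)

lemma add_R: "coset p \<oplus>\<^bsub>R\<^esub> coset q = coset (p + q)"
  using ideal.a_rcos_sum[OF ideal_I, of p q] by (simp add: FactRing_def coset_def)

lemma one_R: "\<one>\<^bsub>R\<^esub> = coset 1"
  by (simp add: FactRing_def coset_def)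

lemma zero_R: "\<zero>\<^bsub>R\<^esub> = coset 0"
proof -
  have "I +>\<^bsub>mpoly_ring\<^esub> 0 = I" unfolding a_r_coset_def' by auto
  then show ?thesis by (simp add: FactRing_def coset_def)
qed

definition M where "M = coset ` vars_ideal UNIV"

lemma coset_in_M: "coset p \<in> M \<longleftrightarrow> constant_term p = 0"
proof
  assume "coset p \<in> M"
  then obtain q where q: "coset p = coset q" "constant_term q = 0"
    unfolding M_def vars_ideal_UNIV_iff[symmetric] by (rule imageE)
  then have "constant_term (p - q) = 0" using proper coset_eq_iff by blast
  then show "constant_term p = 0" using q(2) by (simp add: lookup_minus)
next
  assume "constant_term p = 0"
  then show "coset p \<in> M" unfolding M_def by (intro imageI) (simp add: vars_ideal_UNIV_iff)
qed

definition D where "D = carrier R - M"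

lemma coset_in_D: "coset p \<in> D \<longleftrightarrow> constant_term p \<noteq> 0"
  unfolding D_def using coset_in_M[of p] by (simp add: carrier_R)

lemma in_D: "A \<in> D \<Longrightarrow> \<exists>p. A = coset p \<and> constant_term p \<noteq> 0"
  using coset_in_D unfolding D_def carrier_R by blast

lemma ideal_preimage:
  assumes "ideal J R"
  shows "ideal {p. coset p \<in> J} mpoly_ring"
proof -
  interpret ideal J R by fact
  have sub: "additive_subgroup J R" by (rule ideal.axioms(1)[OF assms])
  show ?thesis
    unfolding ideal_mpoly_iff
  proof (intro conjI ballI allI)
    show "0 \<in> {p. coset p \<in> J}" using additive_subgroup.zero_closed[OF sub] by (simp add: zero_R)
  next
    fix a b assume "a \<in> {p. coset p \<in> J}" "b \<in> {p. coset p \<in> J}"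
    then show "a + b \<in> {p. coset p \<in> J}" using additive_subgroup.a_closed[OF sub, of "coset a" "coset b"] by (simp add: add_R)
  next
    fix a b assume "b \<in> {p. coset p \<in> J}"
    then show "a * b \<in> {p. coset p \<in> J}"
      using I_l_closed[of "coset b" "coset a"] by (simp add: mult_R carrier_R)
  qed
qed

lemma maximal_M:
  assumes "cring R"
  shows "maximalideal M R"
proof -
  interpret R: cring R by fact
  show ?thesis
  proof (rule maximalidealI)
    show "ideal M R"
    proof (rule idealI[OF R.ring_axioms])
      have inv: "inv\<^bsub>add_monoid R\<^esub> coset p = coset (- p)" for p
      proof -
        have "\<ominus>\<^bsub>R\<^esub> coset p = coset (- p)"
          by (rule R.minus_equality) (simp_all add: add_R zero_R carrier_R)
        then show ?thesis by (simp add: a_inv_def)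
      qed
      show "subgroup M (add_monoid R)"
      proof (rule subgroup.intro)
        show "M \<subseteq> carrier (add_monoid R)" by (auto simp: M_def carrier_R)
        fix x y assume "x \<in> M" "y \<in> M"
        then obtain p q where "x = coset p" "y = coset q" "p \<in> vars_ideal UNIV" "q \<in> vars_ideal UNIV"
          unfolding M_def by blast
        then show "x \<otimes>\<^bsub>add_monoid R\<^esub> y \<in> M"
          by (simp add: add_R M_def vars_ideal_add)
      next
        show "\<one>\<^bsub>add_monoid R\<^esub> \<in> M" by (simp add: zero_R coset_in_M)
        fix x assume "x \<in> M"
        then obtain p where p: "x = coset p" "p \<in> vars_ideal UNIV" unfolding M_def by blast
        have "coset (- p) \<in> M" unfolding M_def by (intro imageI vars_ideal_uminus p)
        then show "inv\<^bsub>add_monoid R\<^esub> x \<in> M" unfolding p(1) inv .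
      qed
      fix a x assume "a \<in> M" and "x \<in> carrier R"
      then obtain p q where pq: "a = coset p" "p \<in> vars_ideal UNIV" "x = coset q"
        unfolding M_def carrier_R by blast
      then have *: "coset (q * p) \<in> M" unfolding M_def by (intro imageI vars_ideal_mult)
      then show "x \<otimes>\<^bsub>R\<^esub> a \<in> M" by (simp add: pq mult_R)
      from * show "a \<otimes>\<^bsub>R\<^esub> x \<in> M" by (simp add: pq mult_R mult.commute)
    qed
    have "coset 1 \<notin> M" by (simp add: coset_in_M)
    moreover have "coset 1 \<in> carrier R" by (simp add: carrier_R)
    ultimately show "carrier R \<noteq> M" by blast
    fix J assume J: "ideal J R" "M \<subseteq> J" "J \<subseteq> carrier R"
    have J': "ideal {p. coset p \<in> J} mpoly_ring" by (rule ideal_preimage[OF J(1)])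
    show "J = M \<or> J = carrier R"
    proof (rule disjCI)
      assume "J \<noteq> carrier R"
      show "J = M"
      proof (rule ccontr)
        assume "J \<noteq> M"
        then obtain A where A: "A \<in> J" "A \<notin> M" using J(2) by blast
        then obtain p where p: "A = coset p" using J(3) carrier_R by blast
        define c where "c = constant_term p"
        have c: "c \<noteq> 0" using A(2) p coset_in_M[of p] by (simp add: c_def)
        have "constant_term (single 0 c - p) = 0" by (simp add: lookup_minus c_def)
        then have "coset (single 0 c - p) \<in> J" using J(2) coset_in_M by blast
        moreover have "coset p \<in> J" using A p by simp
        ultimately have "(single 0 c - p) + p \<in> {p. coset p \<in> J}"
          using J' unfolding ideal_mpoly_iff by blast
        then have "single 0 c \<in> {p. coset p \<in> J}" by simp
        then have "single 0 (inverse c) * single 0 c \<in> {p. coset p \<in> J}"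
          using J' unfolding ideal_mpoly_iff by blast
        then have "coset 1 \<in> J" using c by (simp add: mult_single)
        then have "J = carrier R" using ideal.one_imp_carrier[OF J(1)] by (simp add: one_R)
        with \<open>J \<noteq> carrier R\<close> show False by contradiction
      qed
    qed
  qed
qed

text \<open>
  Equality of the fractions \<open>a/s\<close> and \<open>b/t\<close> in the local ring, expressed in the polynomial ring.
\<close>

definition rel :: "('v, 'k) mpoly \<Rightarrow> ('v, 'k) mpoly \<Rightarrow> ('v, 'k) mpoly \<Rightarrow> ('v, 'k) mpoly \<Rightarrow> bool" where
  "rel a s b t \<longleftrightarrow> (\<exists>u. constant_term u \<noteq> 0 \<and> u * (a * t - b * s) \<in> I)"

lemma frac_rel_mem:
  "((A, S), (B, T)) \<in> frac_rel R D \<longleftrightarrow> A \<in> carrier R \<and> S \<in> D \<and> B \<in> carrier R \<and> T \<in> D \<and>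
     (\<exists>U\<in>D. U \<otimes>\<^bsub>R\<^esub> (A \<otimes>\<^bsub>R\<^esub> T) = U \<otimes>\<^bsub>R\<^esub> (B \<otimes>\<^bsub>R\<^esub> S))"
  unfolding frac_rel_def mem_Collect_eq by (simp only: prod.inject) (iprover)

lemma frac_rel_iff:
  "((coset a, coset s), (coset b, coset t)) \<in> frac_rel R D \<longleftrightarrow>
     constant_term s \<noteq> 0 \<and> constant_term t \<noteq> 0 \<and> rel a s b t"
proof -
  have "(\<exists>U\<in>D. U \<otimes>\<^bsub>R\<^esub> (coset a \<otimes>\<^bsub>R\<^esub> coset t) = U \<otimes>\<^bsub>R\<^esub> (coset b \<otimes>\<^bsub>R\<^esub> coset s)) \<longleftrightarrow> rel a s b t"
  proof
    assume "\<exists>U\<in>D. U \<otimes>\<^bsub>R\<^esub> (coset a \<otimes>\<^bsub>R\<^esub> coset t) = U \<otimes>\<^bsub>R\<^esub> (coset b \<otimes>\<^bsub>R\<^esub> coset s)"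
    then obtain U where U: "U \<in> D" "U \<otimes>\<^bsub>R\<^esub> (coset a \<otimes>\<^bsub>R\<^esub> coset t) = U \<otimes>\<^bsub>R\<^esub> (coset b \<otimes>\<^bsub>R\<^esub> coset s)" by blast
    obtain u where u: "U = coset u" "constant_term u \<noteq> 0" using in_D[OF U(1)] by blast
    have "u * (a * t) - u * (b * s) \<in> I" using U(2) by (simp add: u(1) mult_R coset_eq_iff)
    then show "rel a s b t" unfolding rel_def using u(2) by (auto simp: right_diff_distrib)
  next
    assume "rel a s b t"
    then obtain u where u: "constant_term u \<noteq> 0" "u * (a * t - b * s) \<in> I" unfolding rel_def by blast
    then have "coset (u * (a * t)) = coset (u * (b * s))" by (simp add: coset_eq_iff right_diff_distrib)
    then show "\<exists>U\<in>D. U \<otimes>\<^bsub>R\<^esub> (coset a \<otimes>\<^bsub>R\<^esub> coset t) = U \<otimes>\<^bsub>R\<^esub> (coset b \<otimes>\<^bsub>R\<^esub> coset s)"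
      using u(1) by (intro bexI[of _ "coset u"]) (simp_all add: mult_R coset_in_D)
  qed
  then show ?thesis
    unfolding frac_rel_mem by (simp add: carrier_R coset_in_D)
qed

lemma rel_refl: "rel a s a s"
  unfolding rel_def by (intro exI[of _ 1]) (simp add: I_zero)

lemma rel_sym: "rel a s b t \<Longrightarrow> rel b t a s"
proof -
  assume "rel a s b t"
  then obtain u where u: "constant_term u \<noteq> 0" "u * (a * t - b * s) \<in> I" unfolding rel_def by blast
  have "u * (b * s - a * t) = - (u * (a * t - b * s))" by (simp add: algebra_simps)
  then have "u * (b * s - a * t) \<in> I" using I_uminus[OF u(2)] by simp
  then show ?thesis unfolding rel_def using u(1) by blast
qed

lemma rel_trans:
  assumes "rel a s b t" "rel b t c w" "constant_term t \<noteq> 0"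
  shows "rel a s c w"
proof -
  obtain u where u: "constant_term u \<noteq> 0" "u * (a * t - b * s) \<in> I" using assms(1) unfolding rel_def by blast
  obtain v where v: "constant_term v \<noteq> 0" "v * (b * w - c * t) \<in> I" using assms(2) unfolding rel_def by blast
  have "(v * w) * (u * (a * t - b * s)) + (u * s) * (v * (b * w - c * t)) \<in> I"
    by (intro I_add I_mult u v)
  also have "(v * w) * (u * (a * t - b * s)) + (u * s) * (v * (b * w - c * t)) = (u * v * t) * (a * w - c * s)"
    by (simp add: algebra_simps)
  finally show ?thesis
    unfolding rel_def using constant_term_mult_neq_0[OF constant_term_mult_neq_0[OF u(1) v(1)] assms(3)] by blast
qed

definition frac :: "('v, 'k) mpoly \<Rightarrow> ('v, 'k) mpoly \<Rightarrow> (('v, 'k) mpoly set \<times> ('v, 'k) mpoly set) set" where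
  "frac a s = fraction R D (coset a) (coset s)"

abbreviation L where "L \<equiv> localization R D"

lemma frac_mem:
  "(A, T) \<in> frac a s \<longleftrightarrow>
    (\<exists>b t. A = coset b \<and> T = coset t \<and> constant_term s \<noteq> 0 \<and> constant_term t \<noteq> 0 \<and> rel a s b t)"
proof
  assume "(A, T) \<in> frac a s"
  then have *: "((coset a, coset s), (A, T)) \<in> frac_rel R D" unfolding frac_def fraction_def by simp
  then have "A \<in> carrier R" "T \<in> D" unfolding frac_rel_mem by blast+
  then obtain b t where "A = coset b" "T = coset t" using in_D unfolding carrier_R by blast
  with * show "\<exists>b t. A = coset b \<and> T = coset t \<and> constant_term s \<noteq> 0 \<and> constant_term t \<noteq> 0 \<and> rel a s b t"
    using frac_rel_iff by blast
next
  assume "\<exists>b t. A = coset b \<and> T = coset t \<and> constant_term s \<noteq> 0 \<and> constant_term t \<noteq> 0 \<and> rel a s b t"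
  then show "(A, T) \<in> frac a s" unfolding frac_def fraction_def using frac_rel_iff by auto
qed

lemma frac_eq_iff:
  assumes "constant_term s \<noteq> 0" "constant_term t \<noteq> 0"
  shows "frac a s = frac b t \<longleftrightarrow> rel a s b t"
proof
  assume eq: "frac a s = frac b t"
  have "(coset b, coset t) \<in> frac b t" unfolding frac_mem using assms rel_refl by blast
  then have "(coset b, coset t) \<in> frac a s" using eq by simp
  then have "((coset a, coset s), (coset b, coset t)) \<in> frac_rel R D"
    unfolding frac_def fraction_def by simp
  then show "rel a s b t" using frac_rel_iff by blast
next
  assume r: "rel a s b t"
  have "x \<in> frac a s \<longleftrightarrow> x \<in> frac b t" for x
  proof -
    obtain A T where x: "x = (A, T)" by (cases x)
    have "rel a s c w \<longleftrightarrow> rel b t c w" for c w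
      using rel_trans[OF r _ assms(2)] rel_trans[OF rel_sym[OF r] _ assms(1)] by blast
    then show ?thesis unfolding x frac_mem using assms by simp
  qed
  then show "frac a s = frac b t" by blast
qed

lemma carrier_L: "carrier L = {frac a s | a s. constant_term s \<noteq> 0}"
proof -
  have L: "carrier L = (carrier R \<times> D) // frac_rel R D" by (simp add: localization_def)
  show ?thesis
    unfolding L
  proof (intro equalityI subsetI)
    fix P assume "P \<in> (carrier R \<times> D) // frac_rel R D"
    then obtain x where x: "P = frac_rel R D `` {x}" "x \<in> carrier R \<times> D" by (rule quotientE)
    then obtain a where a: "fst x = coset a" unfolding carrier_R mem_Times_iff by blast
    obtain s where s: "snd x = coset s" "constant_term s \<noteq> 0"
      using in_D[of "snd x"] x(2) unfolding mem_Times_iff by blast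
    have "x = (coset a, coset s)" using a s(1) by (simp add: prod_eq_iff)
    then show "P \<in> {frac a s | a s. constant_term s \<noteq> 0}"
      using x(1) s(2) unfolding frac_def fraction_def by blast
  next
    fix P assume "P \<in> {frac a s | a s. constant_term s \<noteq> 0}"
    then obtain a s where P: "P = frac a s" "constant_term s \<noteq> 0" by blast
    then have "(coset a, coset s) \<in> carrier R \<times> D" by (simp add: carrier_R coset_in_D)
    then show "P \<in> (carrier R \<times> D) // frac_rel R D"
      unfolding P(1) frac_def fraction_def by (rule quotientI)
  qed
qed

lemma frac_in_L: "constant_term s \<noteq> 0 \<Longrightarrow> frac a s \<in> carrier L"
  unfolding carrier_L by blast

text \<open>
  The operations of the localization are unions over all representatives; they reduce to one
  representative when the outcome does not depend on it.
\<close>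

lemma UN_frac:
  assumes s: "constant_term s \<noteq> 0" and t: "constant_term t \<noteq> 0"
    and eq: "\<And>a' s' b' t'. constant_term s' \<noteq> 0 \<Longrightarrow> constant_term t' \<noteq> 0 \<Longrightarrow> rel a s a' s' \<Longrightarrow> rel b t b' t' \<Longrightarrow>
      F (coset a') (coset s') (coset b') (coset t') = Z"
  shows "(\<Union>(A, S)\<in>frac a s. \<Union>(B, T)\<in>frac b t. F A S B T) = Z"
proof (intro equalityI subsetI)
  fix z assume "z \<in> (\<Union>(A, S)\<in>frac a s. \<Union>(B, T)\<in>frac b t. F A S B T)"
  then obtain A S B T where "(A, S) \<in> frac a s" "(B, T) \<in> frac b t" "z \<in> F A S B T" by blast
  then show "z \<in> Z" using eq unfolding frac_mem by blast
next
  fix z assume "z \<in> Z"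
  then have "z \<in> F (coset a) (coset s) (coset b) (coset t)" using eq[OF s t rel_refl rel_refl] by simp
  moreover have "(coset a, coset s) \<in> frac a s" "(coset b, coset t) \<in> frac b t"
    unfolding frac_mem using s t rel_refl by blast+
  ultimately show "z \<in> (\<Union>(A, S)\<in>frac a s. \<Union>(B, T)\<in>frac b t. F A S B T)" by blast
qed

lemma mult_L:
  assumes st: "constant_term s \<noteq> 0" "constant_term t \<noteq> 0"
  shows "frac a s \<otimes>\<^bsub>L\<^esub> frac b t = frac (a * b) (s * t)"
proof -
  have "(\<Union>(A, S)\<in>frac a s. \<Union>(B, T)\<in>frac b t. fraction R D (A \<otimes>\<^bsub>R\<^esub> B) (S \<otimes>\<^bsub>R\<^esub> T)) = frac (a * b) (s * t)"
  proof (rule UN_frac[OF st])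
    fix a' s' b' t'
    assume c: "constant_term s' \<noteq> 0" "constant_term t' \<noteq> 0" and r: "rel a s a' s'" "rel b t b' t'"
    obtain u where u: "constant_term u \<noteq> 0" "u * (a * s' - a' * s) \<in> I" using r(1) unfolding rel_def by blast
    obtain v where v: "constant_term v \<noteq> 0" "v * (b * t' - b' * t) \<in> I" using r(2) unfolding rel_def by blast
    have "(v * b' * t) * (u * (a * s' - a' * s)) + (u * a * s') * (v * (b * t' - b' * t)) \<in> I"
      by (intro I_add I_mult u v)
    also have "(v * b' * t) * (u * (a * s' - a' * s)) + (u * a * s') * (v * (b * t' - b' * t)) =
        (u * v) * ((a * b) * (s' * t') - (a' * b') * (s * t))"
      by (simp add: algebra_simps)
    finally have "rel (a * b) (s * t) (a' * b') (s' * t')"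
      unfolding rel_def using constant_term_mult_neq_0[OF u(1) v(1)] by blast
    then have "frac (a' * b') (s' * t') = frac (a * b) (s * t)"
      using frac_eq_iff constant_term_mult_neq_0 st c rel_sym by blast
    then show "fraction R D (coset a' \<otimes>\<^bsub>R\<^esub> coset b') (coset s' \<otimes>\<^bsub>R\<^esub> coset t') = frac (a * b) (s * t)"
      by (simp add: mult_R frac_def)
  qed
  then show ?thesis by (simp add: localization_def)
qed

lemma add_L:
  assumes st: "constant_term s \<noteq> 0" "constant_term t \<noteq> 0"
  shows "frac a s \<oplus>\<^bsub>L\<^esub> frac b t = frac (a * t + b * s) (s * t)"
proof -
  have "(\<Union>(A, S)\<in>frac a s. \<Union>(B, T)\<in>frac b t.
      fraction R D ((A \<otimes>\<^bsub>R\<^esub> T) \<oplus>\<^bsub>R\<^esub> (B \<otimes>\<^bsub>R\<^esub> S)) (S \<otimes>\<^bsub>R\<^esub> T)) = frac (a * t + b * s) (s * t)"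
  proof (rule UN_frac[OF st])
    fix a' s' b' t'
    assume c: "constant_term s' \<noteq> 0" "constant_term t' \<noteq> 0" and r: "rel a s a' s'" "rel b t b' t'"
    obtain u where u: "constant_term u \<noteq> 0" "u * (a * s' - a' * s) \<in> I" using r(1) unfolding rel_def by blast
    obtain v where v: "constant_term v \<noteq> 0" "v * (b * t' - b' * t) \<in> I" using r(2) unfolding rel_def by blast
    have "(v * t * t') * (u * (a * s' - a' * s)) + (u * s * s') * (v * (b * t' - b' * t)) \<in> I"
      by (intro I_add I_mult u v)
    also have "(v * t * t') * (u * (a * s' - a' * s)) + (u * s * s') * (v * (b * t' - b' * t)) =
        (u * v) * ((a * t + b * s) * (s' * t') - (a' * t' + b' * s') * (s * t))"
      by (simp add: algebra_simps)
    finally have "rel (a * t + b * s) (s * t) (a' * t' + b' * s') (s' * t')"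
      unfolding rel_def using constant_term_mult_neq_0[OF u(1) v(1)] by blast
    then have "frac (a' * t' + b' * s') (s' * t') = frac (a * t + b * s) (s * t)"
      using frac_eq_iff constant_term_mult_neq_0 st c rel_sym by blast
    then show "fraction R D ((coset a' \<otimes>\<^bsub>R\<^esub> coset t') \<oplus>\<^bsub>R\<^esub> (coset b' \<otimes>\<^bsub>R\<^esub> coset s')) (coset s' \<otimes>\<^bsub>R\<^esub> coset t') =
        frac (a * t + b * s) (s * t)"
      by (simp add: mult_R add_R frac_def)
  qed
  then show ?thesis by (simp add: localization_def)
qed

lemma one_L: "\<one>\<^bsub>L\<^esub> = frac 1 1" and zero_L: "\<zero>\<^bsub>L\<^esub> = frac 0 1"
  by (simp_all add: localization_def frac_def one_R zero_R)

lemma frac_cancel: "constant_term s \<noteq> 0 \<Longrightarrow> constant_term t \<noteq> 0 \<Longrightarrow> frac (a * t) (s * t) = frac a s"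
  by (subst frac_eq_iff) (auto simp: constant_term_mult_neq_0 rel_def I_zero mult_ac intro!: exI[of _ 1])

end

section \<open>Depth and dimension of the local ring\<close>

lemma local_ideal_vars_ideal: "local_ideal (vars_ideal A :: ('v::finite, 'k::field) mpoly set)"
  unfolding local_ideal_def
proof (intro conjI allI impI)
  show "ideal (vars_ideal A :: ('v, 'k) mpoly set) mpoly_ring"
    unfolding ideal_mpoly_iff by (auto intro: vars_ideal_add vars_ideal_mult)
  fix u b :: "('v, 'k) mpoly" assume u: "constant_term u \<noteq> 0" and ub: "u * b \<in> vars_ideal A"
  have "0 \<in> keys u" using u by (simp add: in_keys_iff)
  then have "u \<notin> vars_ideal A" unfolding vars_ideal_def by force
  then show "b \<in> vars_ideal A" using vars_ideal_prime[OF ub] by blast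
qed

locale local_quotient_cring = local_quotient I for I :: "('v::finite, 'k::field) mpoly set" +
  assumes cring_L: "cring L"
begin

interpretation L: cring L by (rule cring_L)

lemma frac_split: "constant_term s \<noteq> 0 \<Longrightarrow> frac p 1 \<otimes>\<^bsub>L\<^esub> frac 1 s = frac p s"
  by (simp add: mult_L)

lemma frac_clear: "constant_term s \<noteq> 0 \<Longrightarrow> frac p s \<otimes>\<^bsub>L\<^esub> frac s 1 = frac p 1"
  using frac_cancel[of 1 s p] by (simp add: mult_L)

lemma frac_zero: "p \<in> I \<Longrightarrow> constant_term s \<noteq> 0 \<Longrightarrow> frac p s = \<zero>\<^bsub>L\<^esub>"
  unfolding zero_L by (subst frac_eq_iff) (auto simp: rel_def intro!: exI[of _ 1])

definition extend :: "('v, 'k) mpoly set \<Rightarrow> (('v, 'k) mpoly set \<times> ('v, 'k) mpoly set) set set" where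
  "extend J = {frac b t | b t. b \<in> J \<and> constant_term t \<noteq> 0}"

definition contract :: "(('v, 'k) mpoly set \<times> ('v, 'k) mpoly set) set set \<Rightarrow> ('v, 'k) mpoly set" where
  "contract A = {b. frac b 1 \<in> A}"

lemma frac_in_ideal_iff:
  assumes A: "ideal A L" and s: "constant_term s \<noteq> 0"
  shows "frac p s \<in> A \<longleftrightarrow> p \<in> contract A"
proof
  assume "frac p s \<in> A"
  then have "frac p s \<otimes>\<^bsub>L\<^esub> frac s 1 \<in> A" by (rule ideal.I_r_closed[OF A]) (rule frac_in_L, simp)
  then show "p \<in> contract A" by (simp add: contract_def frac_clear[OF s])
next
  assume "p \<in> contract A"
  then have "frac p 1 \<otimes>\<^bsub>L\<^esub> frac 1 s \<in> A"
    unfolding contract_def mem_Collect_eq by (rule ideal.I_r_closed[OF A]) (rule frac_in_L[OF s])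
  then show "frac p s \<in> A" by (simp add: frac_split[OF s])
qed

lemma I_subset_contract: "ideal A L \<Longrightarrow> I \<subseteq> contract A"
proof
  fix p assume A: "ideal A L" and "p \<in> I"
  then have "frac p 1 = \<zero>\<^bsub>L\<^esub>" by (intro frac_zero) simp_all
  then show "p \<in> contract A"
    using additive_subgroup.zero_closed[OF ideal.axioms(1)[OF A]] by (simp add: contract_def)
qed

lemma local_ideal_contract:
  assumes A: "ideal A L"
  shows "local_ideal (contract A)"
  unfolding local_ideal_def ideal_mpoly_iff
proof (intro conjI ballI allI impI)
  show "0 \<in> contract A" using I_subset_contract[OF A] I_zero by blast
next
  fix a b assume "a \<in> contract A" "b \<in> contract A"
  then have "frac a 1 \<oplus>\<^bsub>L\<^esub> frac b 1 \<in> A"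
    unfolding contract_def mem_Collect_eq by (rule additive_subgroup.a_closed[OF ideal.axioms(1)[OF A]])
  then show "a + b \<in> contract A" by (simp add: add_L contract_def)
next
  fix a b assume "b \<in> contract A"
  then have "frac a 1 \<otimes>\<^bsub>L\<^esub> frac b 1 \<in> A"
    unfolding contract_def mem_Collect_eq by (rule ideal.I_l_closed[OF A]) (rule frac_in_L, simp)
  then show "a * b \<in> contract A" by (simp add: mult_L contract_def)
next
  fix u b assume u: "constant_term u \<noteq> 0" and "u * b \<in> contract A"
  then have "frac (b * u) (1 * u) \<in> A" using frac_in_ideal_iff[OF A, of u "b * u"] by (simp add: mult.commute)
  then show "b \<in> contract A" using frac_cancel[of 1 u b] u by (simp add: contract_def)
qed

lemma ideal_extend:
  assumes J: "ideal J mpoly_ring"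
  shows "ideal (extend J) L"
proof -
  have J': "0 \<in> J" "\<And>a b. a \<in> J \<Longrightarrow> b \<in> J \<Longrightarrow> a + b \<in> J" "\<And>a b. b \<in> J \<Longrightarrow> a * b \<in> J"
    using J unfolding ideal_mpoly_iff by blast+
  have inv: "inv\<^bsub>add_monoid L\<^esub> frac a s = frac (- a) s" if s: "constant_term s \<noteq> 0" for a s
  proof -
    have "\<ominus>\<^bsub>L\<^esub> frac a s = frac (- a) s"
    proof (rule L.minus_equality)
      show "frac (- a) s \<oplus>\<^bsub>L\<^esub> frac a s = \<zero>\<^bsub>L\<^esub>"
        using frac_zero[OF I_zero constant_term_mult_neq_0[OF s s]] by (simp add: add_L s)
    qed (simp_all add: frac_in_L s)
    then show ?thesis by (simp add: a_inv_def)
  qed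
  show ?thesis
  proof (rule idealI[OF L.ring_axioms])
    show "subgroup (extend J) (add_monoid L)"
    proof (rule subgroup.intro)
      show "extend J \<subseteq> carrier (add_monoid L)" unfolding extend_def using frac_in_L by auto
      fix x y assume "x \<in> extend J" "y \<in> extend J"
      then obtain a s b t where x: "x = frac a s" "a \<in> J" "constant_term s \<noteq> 0"
          and y: "y = frac b t" "b \<in> J" "constant_term t \<noteq> 0"
        unfolding extend_def by blast
      have "t * a + s * b \<in> J" by (intro J' x y)
      then have "frac (a * t + b * s) (s * t) \<in> extend J"
        unfolding extend_def using constant_term_mult_neq_0[OF x(3) y(3)] by (auto simp: mult.commute)
      then show "x \<otimes>\<^bsub>add_monoid L\<^esub> y \<in> extend J" by (simp add: x(1) y(1) add_L x(3) y(3))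
    next
      have "frac 0 1 \<in> extend J" unfolding extend_def using J'(1) by (intro CollectI exI[of _ 0] exI[of _ 1]) simp
      then show "\<one>\<^bsub>add_monoid L\<^esub> \<in> extend J" by (simp add: zero_L)
      fix x assume "x \<in> extend J"
      then obtain a s where x: "x = frac a s" "a \<in> J" "constant_term s \<noteq> 0" unfolding extend_def by blast
      have "- a \<in> J" using J'(3)[OF x(2), of "- 1"] by simp
      then have "frac (- a) s \<in> extend J" unfolding extend_def using x(3) by blast
      then show "inv\<^bsub>add_monoid L\<^esub> x \<in> extend J" unfolding x(1) inv[OF x(3)] .
    qed
    fix a x assume "a \<in> extend J" "x \<in> carrier L"
    then obtain b s c t where a: "a = frac b s" "b \<in> J" "constant_term s \<noteq> 0"
        and x: "x = frac c t" "constant_term t \<noteq> 0"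
      unfolding extend_def carrier_L by blast
    have "frac (c * b) (t * s) \<in> extend J"
      unfolding extend_def using J'(3)[OF a(2)] constant_term_mult_neq_0[OF x(2) a(3)] by blast
    then show "x \<otimes>\<^bsub>L\<^esub> a \<in> extend J" by (simp add: a(1) x(1) mult_L a(3) x(2))
    then show "a \<otimes>\<^bsub>L\<^esub> x \<in> extend J"
      using L.m_comm[of a x] frac_in_L a x by simp
  qed
qed

lemma frac_in_extend_iff:
  assumes J: "local_ideal J" "I \<subseteq> J" and t: "constant_term t \<noteq> 0"
  shows "frac b t \<in> extend J \<longleftrightarrow> b \<in> J"
proof
  assume "frac b t \<in> extend J"
  then obtain c w where cw: "frac b t = frac c w" "c \<in> J" "constant_term w \<noteq> 0" unfolding extend_def by blast
  then have "rel b t c w" using frac_eq_iff[OF t cw(3)] by blast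
  then obtain u where u: "constant_term u \<noteq> 0" "u * (b * w - c * t) \<in> I" unfolding rel_def by blast
  have "u * (b * w - c * t) \<in> J" using J(2) u(2) by blast
  then have "u * (b * w - c * t) + (u * t) * c \<in> J"
    by (rule local_ideal_add[OF J(1)]) (rule local_ideal_mult[OF J(1) cw(2)])
  also have "u * (b * w - c * t) + (u * t) * c = (u * w) * b" by (simp add: algebra_simps)
  finally have "(u * w) * b \<in> J" .
  then show "b \<in> J" by (rule local_ideal_cancel[OF J(1) constant_term_mult_neq_0[OF u(1) cw(3)]])
next
  assume "b \<in> J"
  then show "frac b t \<in> extend J" unfolding extend_def using t by blast
qed

lemma contract_zero: "contract (Idl\<^bsub>L\<^esub> {}) = localize I"
proof -
  have id: "ideal (Idl\<^bsub>L\<^esub> {}) L" by (rule L.genideal_ideal) simp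
  have "Idl\<^bsub>L\<^esub> {} \<subseteq> {\<zero>\<^bsub>L\<^esub>}" by (rule L.genideal_minimal[OF L.zeroideal]) simp
  moreover have "\<zero>\<^bsub>L\<^esub> \<in> Idl\<^bsub>L\<^esub> {}" by (rule additive_subgroup.zero_closed[OF ideal.axioms(1)[OF id]])
  ultimately have eq: "Idl\<^bsub>L\<^esub> {} = {\<zero>\<^bsub>L\<^esub>}" by blast
  have "frac b 1 = \<zero>\<^bsub>L\<^esub> \<longleftrightarrow> b \<in> localize I" for b
    unfolding zero_L by (subst frac_eq_iff) (simp_all add: rel_def localize_def)
  then show ?thesis unfolding contract_def eq by simp
qed

text \<open>
  Generating an ideal in the local ring corresponds to \<open>adjoin\<close>; together with \<open>contract_zero\<close> this
  translates regular sequences of the local ring into the recursive notion \<open>local_regular\<close>.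
\<close>

lemma contract_insert:
  assumes A: "A \<subseteq> carrier L" and s: "constant_term s \<noteq> 0"
  shows "contract (Idl\<^bsub>L\<^esub> (insert (frac p s) A)) = adjoin (contract (Idl\<^bsub>L\<^esub> A)) p"
proof -
  define A1 where "A1 = Idl\<^bsub>L\<^esub> A"
  define A2 where "A2 = Idl\<^bsub>L\<^esub> (insert (frac p s) A)"
  have carr: "insert (frac p s) A \<subseteq> carrier L" using A frac_in_L[OF s] by blast
  have id1: "ideal A1 L" unfolding A1_def by (rule L.genideal_ideal[OF A])
  have id2: "ideal A2 L" unfolding A2_def by (rule L.genideal_ideal[OF carr])
  have in2: "insert (frac p s) A \<subseteq> A2" unfolding A2_def by (rule L.genideal_self[OF carr])
  have in1: "A \<subseteq> A1" unfolding A1_def by (rule L.genideal_self[OF A])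
  have sub: "A1 \<subseteq> A2" unfolding A1_def by (rule L.genideal_minimal[OF id2]) (use in2 in blast)
  have loc1: "local_ideal (contract A1)" by (rule local_ideal_contract[OF id1])
  have loc2: "local_ideal (contract A2)" by (rule local_ideal_contract[OF id2])
  define J where "J = adjoin (contract A1) p"
  have J: "local_ideal J" unfolding J_def by (rule local_ideal_adjoin[OF loc1])
  have c1J: "contract A1 \<subseteq> J" unfolding J_def using adjoin_superset by blast
  have IJ: "I \<subseteq> J" using I_subset_contract[OF id1] c1J by blast
  have "A2 \<subseteq> extend J"
    unfolding A2_def
  proof (rule L.genideal_minimal)
    show "ideal (extend J) L" using J unfolding local_ideal_def by (intro ideal_extend) blast
    have "p \<in> J" using adjoin_self[OF loc1, of 1 p] by (simp add: J_def)
    then have "frac p s \<in> extend J" using frac_in_extend_iff[OF J IJ s] by blast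
    moreover have "x \<in> extend J" if x: "x \<in> A" for x
    proof -
      obtain b t where bt: "x = frac b t" "constant_term t \<noteq> 0" using x A carrier_L by blast
      then have "b \<in> contract A1" using frac_in_ideal_iff[OF id1 bt(2)] x in1 by blast
      then show ?thesis using frac_in_extend_iff[OF J IJ bt(2)] c1J bt(1) by blast
    qed
    ultimately show "insert (frac p s) A \<subseteq> extend J" by blast
  qed
  then have "contract A2 \<subseteq> J"
    using frac_in_extend_iff[OF J IJ, of 1] unfolding contract_def by auto
  moreover have "J \<subseteq> contract A2"
  proof
    fix b assume "b \<in> J"
    then obtain u r where ur: "constant_term u \<noteq> 0" "u * b - r * p \<in> contract A1" unfolding J_def by (rule adjoinE)
    have "p \<in> contract A2" using frac_in_ideal_iff[OF id2 s] in2 by blast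
    moreover have "u * b - r * p \<in> contract A2" using ur(2) sub unfolding contract_def by blast
    ultimately have "(u * b - r * p) + r * p \<in> contract A2"
      by (intro local_ideal_add[OF loc2] local_ideal_mult[OF loc2])
    then have "u * b \<in> contract A2" by simp
    then show "b \<in> contract A2" by (rule local_ideal_cancel[OF loc2 ur(1)])
  qed
  ultimately show ?thesis unfolding A1_def A2_def J_def by blast
qed

text \<open>
  Denominators are units, so they can be dropped. A numerator with nonzero constant term would make its
  fraction a unit and the generated ideal the whole ring.
\<close>

lemma regular_sequence_numerators:
  assumes reg: "regular_sequence L xs"
  shows "\<exists>ps. length ps = length xs \<and> (\<forall>p\<in>set ps. constant_term p = 0) \<and> local_regular (localize I) ps"
proof -
  have carr: "set xs \<subseteq> carrier L"
    and nzd: "\<And>i b. i < length xs \<Longrightarrow> b \<in> carrier L \<Longrightarrow>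
      xs ! i \<otimes>\<^bsub>L\<^esub> b \<in> Idl\<^bsub>L\<^esub> (set (take i xs)) \<Longrightarrow> b \<in> Idl\<^bsub>L\<^esub> (set (take i xs))"
    and proper: "Idl\<^bsub>L\<^esub> (set xs) \<noteq> carrier L"
    using reg unfolding regular_sequence_def by blast+
  have "\<forall>x\<in>set xs. \<exists>q. x = frac (fst q) (snd q) \<and> constant_term (snd q) \<noteq> 0"
  proof
    fix x assume "x \<in> set xs"
    then obtain a s where "x = frac a s" "constant_term s \<noteq> 0" using carr carrier_L by blast
    then show "\<exists>q. x = frac (fst q) (snd q) \<and> constant_term (snd q) \<noteq> 0" by (intro exI[of _ "(a, s)"]) simp
  qed
  from bchoice[OF this] obtain q where
    q: "\<And>x. x \<in> set xs \<Longrightarrow> x = frac (fst (q x)) (snd (q x)) \<and> constant_term (snd (q x)) \<noteq> 0" by blast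
  define num where "num x = fst (q x)" for x
  define den where "den x = snd (q x)" for x
  have nd: "x = frac (num x) (den x)" "constant_term (den x) \<noteq> 0" if "x \<in> set xs" for x
    using q[OF that] by (simp_all add: num_def den_def)
  have nonunit: "constant_term (num x) = 0" if x: "x \<in> set xs" for x
  proof (rule ccontr)
    assume unit: "constant_term (num x) \<noteq> 0"
    have id: "ideal (Idl\<^bsub>L\<^esub> (set xs)) L" by (rule L.genideal_ideal[OF carr])
    have "x \<in> Idl\<^bsub>L\<^esub> (set xs)" using L.genideal_self[OF carr] x by blast
    then have "frac (num x) (den x) \<in> Idl\<^bsub>L\<^esub> (set xs)" by (subst nd(1)[OF x, symmetric])
    then have "num x \<in> contract (Idl\<^bsub>L\<^esub> (set xs))"
      by (rule iffD1[OF frac_in_ideal_iff[OF id nd(2)[OF x]]])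
    then have "num x * 1 \<in> contract (Idl\<^bsub>L\<^esub> (set xs))" by simp
    then have "1 \<in> contract (Idl\<^bsub>L\<^esub> (set xs))" by (rule local_ideal_cancel[OF local_ideal_contract[OF id] unit])
    then have "\<one>\<^bsub>L\<^esub> \<in> Idl\<^bsub>L\<^esub> (set xs)" by (simp add: contract_def one_L)
    then show False using ideal.one_imp_carrier[OF id] proper by blast
  qed
  have "local_regular (contract (Idl\<^bsub>L\<^esub> (set (take k xs)))) (map num (drop k xs))" if "k \<le> length xs" for k
    using that
  proof (induction k rule: inc_induct)
    case base
    show ?case by simp
  next
    case (step k)
    have k: "k < length xs" by (rule step.hyps(2))
    define x where "x = xs ! k"
    have x: "x \<in> set xs" using k by (simp add: x_def)
    note xe = nd(1)[OF x, symmetric]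
    define A where "A = Idl\<^bsub>L\<^esub> (set (take k xs))"
    have tc: "set (take k xs) \<subseteq> carrier L" by (rule order_trans[OF set_take_subset carr])
    have idA: "ideal A L" unfolding A_def by (rule L.genideal_ideal[OF tc])
    have "take (Suc k) xs = take k xs @ [x]" unfolding x_def by (rule take_Suc_conv_app_nth[OF k])
    then have set_Suc: "set (take (Suc k) xs) = insert x (set (take k xs))" by simp
    have adj: "contract (Idl\<^bsub>L\<^esub> (set (take (Suc k) xs))) = adjoin (contract A) (num x)"
      unfolding A_def set_Suc by (rule contract_insert[OF tc nd(2)[OF x], of "num x", unfolded xe])
    have "b \<in> contract A" if b: "num x * b \<in> contract A" for b
    proof -
      have "frac (num x * b) (den x) \<in> A" by (rule iffD2[OF frac_in_ideal_iff[OF idA nd(2)[OF x]] b])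
      then have "frac (num x) (den x) \<otimes>\<^bsub>L\<^esub> frac b 1 \<in> A" by (simp add: mult_L nd(2)[OF x])
      then have "x \<otimes>\<^bsub>L\<^esub> frac b 1 \<in> A" unfolding xe .
      then have "xs ! k \<otimes>\<^bsub>L\<^esub> frac b 1 \<in> Idl\<^bsub>L\<^esub> (set (take k xs))" unfolding x_def A_def .
      then have "frac b 1 \<in> Idl\<^bsub>L\<^esub> (set (take k xs))" by (rule nzd[OF k, rotated]) (rule frac_in_L, simp)
      then show ?thesis by (simp add: contract_def A_def)
    qed
    moreover have "local_regular (adjoin (contract A) (num x)) (map num (drop (Suc k) xs))"
      using step.IH unfolding adj .
    moreover have "map num (drop k xs) = num x # map num (drop (Suc k) xs)"
      by (simp add: x_def Cons_nth_drop_Suc[OF k, symmetric])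
    ultimately show ?case by (simp add: A_def)
  qed
  from this[of 0] have "local_regular (localize I) (map num xs)" by (simp add: contract_zero)
  then show ?thesis using nonunit by (intro exI[of _ "map num xs"]) simp
qed

lemma prime_extend:
  assumes IA: "I \<subseteq> vars_ideal A"
  shows "primeideal (extend (vars_ideal A)) L"
proof -
  have loc: "local_ideal (vars_ideal A :: ('v, 'k) mpoly set)" by (rule local_ideal_vars_ideal)
  then have idA: "ideal (vars_ideal A :: ('v, 'k) mpoly set) mpoly_ring" unfolding local_ideal_def by (rule conjunct1)
  note iff = frac_in_extend_iff[OF loc IA]
  show ?thesis
  proof (rule primeidealI[OF ideal_extend[OF idA] cring_L])
    have "frac 1 1 \<notin> extend (vars_ideal A)" using iff[of 1 1] by (simp add: vars_ideal_def)
    moreover have "frac 1 1 \<in> carrier L" by (rule frac_in_L) simp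
    ultimately show "carrier L \<noteq> extend (vars_ideal A)" by blast
    fix x y assume xy: "x \<in> carrier L" "y \<in> carrier L" "x \<otimes>\<^bsub>L\<^esub> y \<in> extend (vars_ideal A)"
    then obtain a s b t where x: "x = frac a s" "constant_term s \<noteq> 0" and y: "y = frac b t" "constant_term t \<noteq> 0"
      unfolding carrier_L by blast
    have "frac (a * b) (s * t) \<in> extend (vars_ideal A)" using xy(3) by (simp add: x y mult_L)
    then have "a * b \<in> vars_ideal A" using iff[OF constant_term_mult_neq_0[OF x(2) y(2)]] by blast
    then show "x \<in> extend (vars_ideal A) \<or> y \<in> extend (vars_ideal A)"
      using vars_ideal_prime iff[OF x(2)] iff[OF y(2)] unfolding x(1) y(1) by blast
  qed
qed

text \<open>
  Adding the variables outside \<open>A\<close> one by one gives a chain of primes.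
\<close>

lemma krull_dim_ge:
  assumes IA: "I \<subseteq> vars_ideal A"
  shows "enat (card (UNIV - A)) \<le> krull_dim L"
proof -
  obtain vs where vs: "distinct vs" "set vs = UNIV - A" using finite_distinct_list[of "UNIV - A"] by auto
  define C where "C i = A \<union> set (take i vs)" for i
  have mono: "vars_ideal A \<subseteq> (vars_ideal (C i) :: ('v, 'k) mpoly set)" for i
    unfolding vars_ideal_def C_def by blast
  have IC: "I \<subseteq> vars_ideal (C i)" for i using IA mono by blast
  define P where "P i = extend (vars_ideal (C i))" for i
  have prime: "primeideal (P i) L" for i unfolding P_def by (rule prime_extend[OF IC])
  have strict: "P i \<subset> P (Suc i)" if i: "i < length vs" for i
  proof
    have "vars_ideal (C i) \<subseteq> (vars_ideal (C (Suc i)) :: ('v, 'k) mpoly set)"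
      unfolding vars_ideal_def C_def take_Suc_conv_app_nth[OF i] by auto
    then show "P i \<subseteq> P (Suc i)" unfolding P_def extend_def by blast
    have in_iff: "frac b 1 \<in> P j \<longleftrightarrow> b \<in> vars_ideal (C j)" for b j
      unfolding P_def by (rule frac_in_extend_iff[OF local_ideal_vars_ideal IC]) simp
    have "vs ! i \<notin> set (take i vs)"
    proof
      assume "vs ! i \<in> set (take i vs)"
      then obtain j where "j < i" "vs ! j = vs ! i" using i by (auto simp: in_set_conv_nth)
      then show False using vs(1) i by (simp add: nth_eq_iff_index_eq)
    qed
    moreover have "vs ! i \<notin> A" using nth_mem[OF i] vs(2) by blast
    ultimately have "vs ! i \<notin> C i" by (simp add: C_def)
    then have "(pvar (vs ! i) :: ('v, 'k) mpoly) \<notin> vars_ideal (C i)"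
      unfolding vars_ideal_def pvar_def by (auto simp: lookup_single when_def)
    moreover have "(pvar (vs ! i) :: ('v, 'k) mpoly) \<in> vars_ideal (C (Suc i))"
      by (intro pvar_in_vars_ideal) (simp add: C_def take_Suc_conv_app_nth[OF i])
    ultimately have "frac (pvar (vs ! i)) 1 \<notin> P i" "frac (pvar (vs ! i)) 1 \<in> P (Suc i)"
      using in_iff by blast+
    then show "P i \<noteq> P (Suc i)" by blast
  qed
  have "enat (length vs) \<le> krull_dim L"
    unfolding krull_dim_def
  proof (rule Sup_upper)
    have "(\<forall>i\<le>length vs. primeideal (P i) L) \<and> (\<forall>i<length vs. P i \<subset> P (Suc i))"
      using prime strict by simp
    then show "enat (length vs) \<in> {enat n | n. \<exists>p. (\<forall>i\<le>n. primeideal (p i) L) \<and> (\<forall>i<n. p i \<subset> p (Suc i))}"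
      by (intro CollectI exI[of _ "length vs"] conjI refl exI[of _ P]) auto
  qed
  then show ?thesis using distinct_card[OF vs(1)] vs(2) by simp
qed

end

lemma cohen_macaulay_cover_card:
  fixes E :: "'v::finite set set"
  assumes simple: "\<And>e. e \<in> E \<Longrightarrow> \<exists>u v. u \<noteq> v \<and> e = {u, v}"
    and cm: "cohen_macaulay_graph TYPE('k::field) E"
    and C: "minimal_vertex_cover E C" and C': "minimal_vertex_cover E C'"
  shows "card (UNIV - C) \<le> card (UNIV - C')"
proof (rule ccontr)
  assume neg: "\<not> ?thesis"
  define I :: "('v, 'k) mpoly set" where "I = edge_ideal E"
  have I: "I = monomial_ideal (edge_monomials E)" unfolding I_def by (rule edge_ideal_eq)
  have cov: "I \<subseteq> vars_ideal C"
  proof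
    fix p assume p: "p \<in> I"
    have "\<exists>v\<in>C. lookup m v \<noteq> 0" if m: "m \<in> keys p" for m
    proof -
      obtain u v n where uv: "{u, v} \<in> E" "m = single u 1 + single v 1 + n"
        using p m unfolding I monomial_ideal_def edge_monomials_def by blast
      have "vertex_cover E C" using C unfolding minimal_vertex_cover_def by (rule conjunct1)
      then have "{u, v} \<inter> C \<noteq> {}" unfolding vertex_cover_def using uv(1) by (rule bspec)
      moreover have "lookup m u \<noteq> 0" "lookup m v \<noteq> 0"
        unfolding uv(2) by (simp_all add: lookup_add)
      ultimately show ?thesis by blast
    qed
    then show "p \<in> vars_ideal C" by (simp add: vars_ideal_def)
  qed
  have proper: "constant_term p = 0" if "p \<in> I" for p
  proof -
    have "p \<in> vars_ideal C" using that cov by blast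
    then have "p \<in> vars_ideal UNIV" unfolding vars_ideal_def by blast
    then show ?thesis by (simp add: vars_ideal_UNIV_iff)
  qed
  have idI: "ideal I mpoly_ring" unfolding I by (rule ideal_monomial_ideal)
  interpret local_quotient I by (rule local_quotient.intro[OF idI proper])
  have "cohen_macaulay R" using cm unfolding cohen_macaulay_graph_def I_def .
  then have "cring R" and loc: "\<And>N. maximalideal N R \<Longrightarrow> cohen_macaulay_local (localization R (carrier R - N))"
    unfolding cohen_macaulay_def by blast+
  have "cohen_macaulay_local L" unfolding D_def by (rule loc[OF maximal_M]) fact
  then obtain N where "cring L" and dep: "depth L N = krull_dim L"
    unfolding cohen_macaulay_local_def by blast
  interpret local_quotient_cring I
    by (intro local_quotient_cring.intro local_quotient_cring_axioms.intro local_quotient_axioms) fact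
  have "depth L N \<le> enat (card (UNIV - C'))"
    unfolding depth_def
  proof (rule Sup_least)
    fix l assume "l \<in> {enat (length xs) | xs. set xs \<subseteq> N \<and> regular_sequence L xs}"
    then obtain xs where xs: "l = enat (length xs)" "regular_sequence L xs" by blast
    obtain ps where ps: "length ps = length xs" "\<forall>p\<in>set ps. constant_term p = 0" "local_regular (localize I) ps"
      using regular_sequence_numerators[OF xs(2)] by blast
    have "length ps \<le> card (UNIV - C')"
    proof (rule regular_length_le)
      show "constant_term x = 0" if "x \<in> set ps" for x using ps(2) that by (rule bspec)
      show "local_regular (localize (edge_ideal E)) ps" using ps(3) unfolding I_def .
    qed (fact simple C')+
    then show "l \<le> enat (card (UNIV - C'))" by (simp add: xs(1) ps(1))
  qed
  moreover have "enat (card (UNIV - C)) \<le> krull_dim L" by (rule krull_dim_ge[OF cov])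
  ultimately have "enat (card (UNIV - C)) \<le> enat (card (UNIV - C'))" unfolding dep by (rule order_trans[rotated])
  then show False using neg by simp
qed

lemma cohen_macaulay_cover_card_eq:
  fixes E :: "'v::finite set set"
  assumes simple: "\<And>e. e \<in> E \<Longrightarrow> \<exists>u v. u \<noteq> v \<and> e = {u, v}"
    and cm: "cohen_macaulay_graph TYPE('k::field) E"
    and C: "minimal_vertex_cover E C" and C': "minimal_vertex_cover E C'"
  shows "card C = card C'"
proof -
  have "card (UNIV - C) = card (UNIV - C')"
    by (intro antisym cohen_macaulay_cover_card[OF simple cm] C C')
  moreover have "card W + card (UNIV - W) = card (UNIV :: 'v set)" for W :: "'v set"
    by (subst card_Un_disjoint[symmetric]) auto
  ultimately show ?thesis by (metis add_right_cancel)
qed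

section \<open>Unmixed Cameron-Walker graphs\<close>

lemma minimal_vertex_coverI:
  assumes "\<And>e. e \<in> E \<Longrightarrow> e \<inter> C \<noteq> {}"
    and "\<And>v. v \<in> C \<Longrightarrow> \<exists>e\<in>E. e \<inter> C = {v}"
  shows "minimal_vertex_cover E C"
proof -
  have "\<not> vertex_cover E C'" if sub: "C' \<subset> C" for C'
  proof -
    obtain v where v: "v \<in> C" "v \<notin> C'" using sub by blast
    obtain e where "e \<in> E" "e \<inter> C = {v}" using assms(2)[OF v(1)] by blast
    then have "e \<in> E" "e \<inter> C' = {}" using v sub by auto
    then show ?thesis unfolding vertex_cover_def by blast
  qed
  then show ?thesis using assms(1) by (simp add: minimal_vertex_cover_def vertex_cover_def)
qed

text \<open>
  Equivalently, all minimal primes of the edge ideal have the same height.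
\<close>

definition unmixed :: "'v set set \<Rightarrow> bool" where
  "unmixed E \<longleftrightarrow> (\<forall>C C'. minimal_vertex_cover E C \<longrightarrow> minimal_vertex_cover E C' \<longrightarrow> card C = card C')"

text \<open>
  The data hidden by the existential quantifiers in the definition of a Cameron-Walker graph.
\<close>

locale cameron_walker =
  fixes E B :: "'v::finite set set" and VX VY L :: "'v set" and f :: "'v \<Rightarrow> 'v"
    and T :: "'v set set" and h :: "'v set \<Rightarrow> 'v"
  assumes bip: "VX \<inter> VY = {}" "B \<subseteq> {{x, y} | x y. x \<in> VX \<and> y \<in> VY}"
    and con: "VX \<union> VY \<noteq> {}" "\<And>u v. u \<in> VX \<union> VY \<Longrightarrow> v \<in> VX \<union> VY \<Longrightarrow> (u, v) \<in> {(a, b). {a, b} \<in> B}\<^sup>*"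
    and f: "f ` L = VX"
    and T: "disjoint T" "\<And>t. t \<in> T \<Longrightarrow> card t = 2" and h: "h ` T \<subseteq> VY"
    and new: "L \<inter> (VX \<union> VY) = {}" "\<Union>T \<inter> (VX \<union> VY) = {}" "L \<inter> \<Union>T = {}"
      "VX \<union> VY \<union> L \<union> \<Union>T = UNIV"
    and E: "E = B \<union> {{l, f l} | l. l \<in> L} \<union> T \<union> {{h t, a} | t a. t \<in> T \<and> a \<in> t}"
begin

lemma same_triangle: "t \<in> T \<Longrightarrow> t' \<in> T \<Longrightarrow> a \<in> t \<Longrightarrow> a \<in> t' \<Longrightarrow> t = t'"
  using disjointD[OF T(1), of t t'] by auto

lemma edge_cases:
  assumes "e \<in> E"
  obtains (crossing) x y where "e = {x, y}" "x \<in> VX" "y \<in> VY" "e \<in> B"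
  | (leaf) l where "l \<in> L" "f l \<in> VX" "e = {l, f l}"
  | (base) "e \<in> T"
  | (side) t a where "t \<in> T" "a \<in> t" "h t \<in> VY" "e = {h t, a}"
proof -
  consider "e \<in> B" | l where "l \<in> L" "e = {l, f l}" | "e \<in> T"
    | t a where "t \<in> T" "a \<in> t" "e = {h t, a}"
    using assms unfolding E by auto
  then show thesis
  proof cases
    case 1
    then obtain x y where "e = {x, y}" "x \<in> VX" "y \<in> VY" using bip(2) by blast
    then show thesis using 1 crossing by blast
  next
    case 2
    then have "f l \<in> VX" using f by blast
    then show thesis using 2 leaf by blast
  next
    case 3
    then show thesis by (rule base)
  next
    case 4
    then have "h t \<in> VY" using h by blast
    then show thesis using 4 side by blast
  qed
qed

definition corner1 :: "'v set \<Rightarrow> 'v" where "corner1 t = (SOME a. a \<in> t)"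
definition corner2 :: "'v set \<Rightarrow> 'v" where "corner2 t = (SOME a. a \<in> t \<and> a \<noteq> corner1 t)"

lemma corners:
  assumes "t \<in> T"
  shows "t = {corner1 t, corner2 t}" "corner1 t \<noteq> corner2 t" "corner1 t \<in> t" "corner2 t \<in> t"
proof -
  obtain a b where ab: "t = {a, b}" "a \<noteq> b" using T(2)[OF assms] by (auto simp: card_2_iff)
  have r: "corner1 t \<in> t" unfolding corner1_def by (rule someI[of _ a]) (simp add: ab)
  have "a \<in> t" "b \<in> t" using ab by simp_all
  then have "\<exists>x. x \<in> t \<and> x \<noteq> corner1 t" using ab(2) by metis
  then have s: "corner2 t \<in> t \<and> corner2 t \<noteq> corner1 t" unfolding corner2_def by (rule someI_ex)
  have "{a, b} = {x, y}" if "x \<in> {a, b}" "y \<in> {a, b}" "y \<noteq> x" for x y using that by auto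
  then show "t = {corner1 t, corner2 t}" using r s unfolding ab(1)[symmetric] by blast
  show "corner1 t \<noteq> corner2 t" "corner1 t \<in> t" "corner2 t \<in> t" using r s by metis+
qed

lemma corners_in: "t \<in> T \<Longrightarrow> corner1 t \<in> t" "t \<in> T \<Longrightarrow> corner2 t \<in> t"
  by (fact corners(3), fact corners(4))

lemma corner2_notin: "t \<in> T \<Longrightarrow> corner2 t \<notin> corner1 ` T"
proof
  assume t: "t \<in> T" and "corner2 t \<in> corner1 ` T"
  then obtain t' where t': "t' \<in> T" "corner2 t = corner1 t'" by blast
  then have "t = t'" using same_triangle[OF t t'(1), of "corner2 t"] corners_in(2)[OF t] corners_in(1)[OF t'(1)] by simp
  then show False using corners(2)[OF t] t' by simp
qed

lemma inj_corner1: "inj_on corner1 T"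
proof (rule inj_onI)
  fix t t' assume t: "t \<in> T" "t' \<in> T" "corner1 t = corner1 t'"
  then show "t = t'" using same_triangle[OF t(1,2), of "corner1 t"] corners_in(1)[OF t(1)] corners_in(1)[OF t(2)] by simp
qed

lemma crossing_in_E: "e \<in> B \<Longrightarrow> e \<in> E" and leaf_in_E: "l \<in> L \<Longrightarrow> {l, f l} \<in> E" and triangle_in_E: "t \<in> T \<Longrightarrow> t \<in> E"
  and side_in_E: "t \<in> T \<Longrightarrow> a \<in> t \<Longrightarrow> {h t, a} \<in> E"
  unfolding E by auto

lemma corner1_new: "t \<in> T \<Longrightarrow> corner1 t \<notin> VX" "t \<in> T \<Longrightarrow> corner1 t \<notin> VY" "t \<in> T \<Longrightarrow> corner1 t \<notin> L"
proof -
  assume "t \<in> T"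
  then have "corner1 t \<in> \<Union>T" using corners_in(1)[of t] by blast
  then show "corner1 t \<notin> VX" "corner1 t \<notin> VY" "corner1 t \<notin> L" using new(2,3) by blast+
qed

text \<open>
  The hypothesis excludes only the graph with a single vertex. Otherwise, if \<open>VX\<close> is empty, then
  connectedness makes \<open>y\<close> the only vertex in \<open>VY\<close>, and all triangles are attached to it.
\<close>

lemma neighbour_or_triangle:
  assumes "VX \<noteq> {} \<or> T \<noteq> {}" "y \<in> VY"
  shows "(\<exists>x\<in>VX. {x, y} \<in> B) \<or> y \<in> h ` T"
proof (cases "VX = {}")
  case True
  then have "B = {}" using bip(2) by blast
  then have "u = y" if "u \<in> VY" for u using con(2)[of u y] assms(2) that by simp
  moreover obtain t where "t \<in> T" using assms(1) True by blast
  moreover from this have "h t \<in> VY" using h by blast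
  ultimately have "h t = y" "t \<in> T" by blast+
  then show ?thesis by blast
next
  case False
  then obtain x where x: "x \<in> VX" by blast
  then have path: "(y, x) \<in> {(a, b). {a, b} \<in> B}\<^sup>*" using con(2) assms(2) by blast
  have "\<exists>z. {y, z} \<in> B"
  proof (rule converse_rtranclE[OF path])
    assume "y = x"
    then show ?thesis using x assms(2) bip(1) by blast
  qed blast
  then obtain z where z: "{y, z} \<in> B" ..
  then obtain a b where ab: "{y, z} = {a, b}" "a \<in> VX" "b \<in> VY" using bip(2) by blast
  have "y \<noteq> a" using ab(2) assms(2) bip(1) by blast
  then have "z = a" using ab(1) by (metis doubleton_eq_iff)
  then show ?thesis using z ab(2) by (metis insert_commute)
qed

lemma cover_X_triangles: "minimal_vertex_cover E (VX \<union> \<Union>T)"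
proof (rule minimal_vertex_coverI)
  fix e assume "e \<in> E"
  then show "e \<inter> (VX \<union> \<Union>T) \<noteq> {}"
    by (cases rule: edge_cases) (use corners_in in auto)
next
  fix v assume "v \<in> VX \<union> \<Union>T"
  then consider l where "l \<in> L" "v = f l" "v \<in> VX" | t where "t \<in> T" "v \<in> t" using f by blast
  then show "\<exists>e\<in>E. e \<inter> (VX \<union> \<Union>T) = {v}"
  proof cases
    case 1
    then show ?thesis using leaf_in_E new by (intro bexI[of _ "{l, f l}"]) auto
  next
    case 2
    then have "h t \<notin> VX" "h t \<notin> \<Union>T" using h bip(1) new(2) by auto
    then show ?thesis using side_in_E[OF 2] 2 by (intro bexI[of _ "{h t, v}"]) auto
  qed
qed

lemma cover_X_Y_corners: "minimal_vertex_cover E (VX \<union> h ` T \<union> corner1 ` T)"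
proof (rule minimal_vertex_coverI)
  fix e assume "e \<in> E"
  then show "e \<inter> (VX \<union> h ` T \<union> corner1 ` T) \<noteq> {}"
  proof (cases rule: edge_cases)
    case (crossing x y)
    then show ?thesis by blast
  next
    case (leaf l)
    then show ?thesis by blast
  next
    case base
    then show ?thesis using corners_in(1)[OF base] by blast
  next
    case (side t a)
    then have "h t \<in> h ` T" by blast
    then show ?thesis by (simp add: side(4))
  qed
next
  fix v assume "v \<in> VX \<union> h ` T \<union> corner1 ` T"
  then consider l where "l \<in> L" "v = f l" "v \<in> VX" | t where "t \<in> T" "v = h t" | t where "t \<in> T" "v = corner1 t"
    using f by blast
  then show "\<exists>e\<in>E. e \<inter> (VX \<union> h ` T \<union> corner1 ` T) = {v}"
  proof cases
    case 1
    have "l \<notin> VX" "l \<notin> h ` T" "l \<notin> corner1 ` T" using 1 new h corner1_new by auto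
    then show ?thesis using leaf_in_E 1 by (intro bexI[of _ "{l, f l}"]) auto
  next
    case 2
    have "corner2 t \<notin> VX" "corner2 t \<notin> h ` T" using corners_in(2)[OF 2(1)] 2 new(2) h by auto
    then have "{h t, corner2 t} \<inter> (VX \<union> h ` T \<union> corner1 ` T) = {v}" using corner2_notin[OF 2(1)] 2 by blast
    then show ?thesis using side_in_E[OF 2(1) corners_in(2)[OF 2(1)]] by (rule bexI)
  next
    case 3
    have "corner2 t \<notin> VX" "corner2 t \<notin> h ` T" using corners_in(2)[OF 3(1)] 3 new(2) h by auto
    then have "{corner1 t, corner2 t} \<inter> (VX \<union> h ` T \<union> corner1 ` T) = {v}" using corner2_notin[OF 3(1)] 3 by auto
    then have "t \<inter> (VX \<union> h ` T \<union> corner1 ` T) = {v}" by (subst corners(1)[OF 3(1)])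
    then show ?thesis using triangle_in_E[OF 3(1)] by (rule bexI)
  qed
qed

lemma cover_L_Y_corners:
  assumes "VX \<noteq> {} \<or> T \<noteq> {}"
  shows "minimal_vertex_cover E (L \<union> VY \<union> corner1 ` T)"
proof (rule minimal_vertex_coverI)
  fix e assume "e \<in> E"
  then show "e \<inter> (L \<union> VY \<union> corner1 ` T) \<noteq> {}"
  proof (cases rule: edge_cases)
    case (crossing x y)
    then show ?thesis by blast
  next
    case (leaf l)
    then show ?thesis by blast
  next
    case base
    then show ?thesis using corners_in(1)[OF base] by blast
  next
    case (side t a)
    then show ?thesis by blast
  qed
next
  have x: "x \<notin> L \<union> VY \<union> corner1 ` T" if "x \<in> VX" for x
    using that new bip corner1_new by auto
  have s: "corner2 t \<notin> L \<union> VY \<union> corner1 ` T" if "t \<in> T" for t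
    using corner2_notin[OF that] corners_in(2)[OF that] that new by auto
  fix v assume "v \<in> L \<union> VY \<union> corner1 ` T"
  then consider "v \<in> L" | x where "v \<in> VY" "x \<in> VX" "{x, v} \<in> B" | t where "t \<in> T" "v = h t" | t where "t \<in> T" "v = corner1 t"
    using neighbour_or_triangle[OF assms] by blast
  then show "\<exists>e\<in>E. e \<inter> (L \<union> VY \<union> corner1 ` T) = {v}"
  proof cases
    case 1
    then show ?thesis using leaf_in_E x[of "f v"] f by (intro bexI[of _ "{v, f v}"]) auto
  next
    case 2
    then show ?thesis using crossing_in_E x[of x] by (intro bexI[of _ "{x, v}"]) auto
  next
    case 3
    then show ?thesis using side_in_E[OF 3(1) corners_in(2)[OF 3(1)]] s h by (intro bexI[of _ "{h t, corner2 t}"]) auto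
  next
    case 4
    then have "{corner1 t, corner2 t} \<inter> (L \<union> VY \<union> corner1 ` T) = {v}" using s[OF 4(1)] by auto
    then have "t \<inter> (L \<union> VY \<union> corner1 ` T) = {v}" by (subst corners(1)[OF 4(1)])
    then show ?thesis using triangle_in_E[OF 4(1)] by (rule bexI)
  qed
qed

text \<open>
  The three covers have the sizes \<open>|X| + 2 |T|\<close>, \<open>|X| + |h T| + |T|\<close> and \<open>|L| + |Y| + |T|\<close>. Equality of the
  first two makes \<open>h\<close> injective; then \<open>|L| + |Y| = |X| + |T|\<close>, where \<open>|X| \<le> |L|\<close> and \<open>|T| \<le> |Y|\<close>.
\<close>

lemma unmixed_imp_matching:
  assumes "unmixed E" "VX \<noteq> {} \<or> T \<noteq> {}"
  shows "inj_on f L" "inj_on h T" "h ` T = VY"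
proof -
  have cT: "card (\<Union>T) = 2 * card T"
  proof -
    have "card (\<Union>T) = sum card T" by (rule card_Union_disjoint[OF T(1)]) simp
    also have "\<dots> = (\<Sum>t\<in>T. 2)" by (intro sum.cong refl T(2))
    finally show ?thesis by simp
  qed
  have cR: "card (corner1 ` T) = card T" using inj_corner1 by (rule card_image)
  have c1: "card (VX \<union> \<Union>T) = card VX + 2 * card T"
    using cT new(2) by (subst card_Un_disjoint) auto
  have d2: "VX \<inter> h ` T = {}" "(VX \<union> h ` T) \<inter> corner1 ` T = {}"
  proof -
    show "VX \<inter> h ` T = {}" using h bip(1) by blast
    have "corner1 t \<notin> VX \<union> h ` T" if "t \<in> T" for t using corner1_new(1,2)[OF that] h by blast
    then show "(VX \<union> h ` T) \<inter> corner1 ` T = {}" by auto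
  qed
  have c2: "card (VX \<union> h ` T \<union> corner1 ` T) = card VX + card (h ` T) + card T"
    using cR d2 by (simp add: card_Un_disjoint)
  have c3: "card (L \<union> VY \<union> corner1 ` T) = card L + card VY + card T"
    using cR new corner1_new by (subst card_Un_disjoint; (subst card_Un_disjoint)?) auto
  have "card (VX \<union> \<Union>T) = card (VX \<union> h ` T \<union> corner1 ` T)" "card (VX \<union> \<Union>T) = card (L \<union> VY \<union> corner1 ` T)"
    using assms(1) cover_X_triangles cover_X_Y_corners cover_L_Y_corners[OF assms(2)] unfolding unmixed_def by metis+
  then have eq: "card T = card (h ` T)" "card VX + card T = card L + card VY"
    unfolding c1 c2 c3 by simp_all
  have "card VX \<le> card L" using f card_image_le[of L f] by simp
  moreover have "card (h ` T) \<le> card VY" using h by (intro card_mono) auto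
  ultimately have "card L = card VX" "card (h ` T) = card VY" using eq by linarith+
  note cards = this
  show "inj_on f L" using cards(1) f by (intro eq_card_imp_inj_on) simp_all
  show "h ` T = VY" by (rule card_subset_eq[OF _ h cards(2)]) simp
  show "inj_on h T" using eq by (intro eq_card_imp_inj_on) auto
qed

text \<open>
  The clique of a hub consists of the hub and its leaf, or of the three vertices of its triangle.
\<close>

lemma clique_partition:
  assumes inj: "inj_on f L" "inj_on h T" and onto: "h ` T = VY"
  shows "\<exists>c. clique_partitioned_graph E B c VX VY"
proof -
  define c where "c v = (if v \<in> L then f v else if v \<in> \<Union>T then h (THE t. t \<in> T \<and> v \<in> t) else v)" for v
  have cL: "c l = f l" if "l \<in> L" for l using that by (simp add: c_def)
  have cT: "c a = h t" if "t \<in> T" "a \<in> t" for t a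
  proof -
    have "(THE t. t \<in> T \<and> a \<in> t) = t"
      by (rule the_equality) (use that same_triangle[OF _ that(1) _ that(2)] in blast)+
    moreover have "a \<in> \<Union>T" using that by (rule UnionI)
    moreover from this have "a \<notin> L" using new(3) by blast
    ultimately show ?thesis by (simp add: c_def del: Union_iff)
  qed
  have cH: "c v = v" if "v \<in> VX \<union> VY" for v
  proof -
    have "v \<notin> L" "v \<notin> \<Union>T" using that new(1,2) by blast+
    then show ?thesis by (simp add: c_def del: Union_iff)
  qed
  have cases: "v \<in> VX \<union> VY \<or> v \<in> L \<or> (\<exists>t\<in>T. v \<in> t)" for v using new(4) by blast
  have fX: "f l \<in> VX" if "l \<in> L" for l using f that by blast
  have hY: "h t \<in> VY" if "t \<in> T" for t using h that by blast
  have fwd: "e \<in> {{u, v} | u v. u \<noteq> v \<and> c u = c v} \<union> B" if "e \<in> E" for e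
    using that
  proof (cases rule: edge_cases)
    case (leaf l)
    have "l \<noteq> f l" using leaf new(1) by auto
    moreover have "c l = c (f l)" using leaf cL[of l] cH[of "f l"] by simp
    ultimately have "{l, f l} \<in> {{u, v} | u v. u \<noteq> v \<and> c u = c v} \<union> B" by blast
    then show ?thesis by (simp only: leaf(3))
  next
    case base
    have "c (corner1 e) = c (corner2 e)" using cT[OF base] corners_in[OF base] by simp
    then have "{corner1 e, corner2 e} \<in> {{u, v} | u v. u \<noteq> v \<and> c u = c v} \<union> B" using corners(2)[OF base] by blast
    then show ?thesis by (subst corners(1)[OF base])
  next
    case (side t a)
    have "h t \<noteq> a" using side new(2) by auto
    moreover have "c (h t) = c a" using side cT[of t a] cH[of "h t"] by simp
    ultimately have "{h t, a} \<in> {{u, v} | u v. u \<noteq> v \<and> c u = c v} \<union> B" by blast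
    then show ?thesis by (simp only: side(4))
  next
    case (crossing x y)
    show ?thesis using crossing(4) by (rule UnI2)
  qed
  have half: "{u, v} \<in> E" if uv: "u \<noteq> v" "c u = c v" "u \<in> VX \<union> VY" for u v
  proof -
    consider "v \<in> VX \<union> VY" | "v \<in> L" | t where "t \<in> T" "v \<in> t" using cases[of v] by blast
    then show ?thesis
    proof cases
      case 1 then show ?thesis using uv cH by metis
    next
      case 2 then show ?thesis using uv cH cL leaf_in_E by (metis insert_commute)
    next
      case 3 then show ?thesis using uv cH cT side_in_E by metis
    qed
  qed
  have bwd: "{u, v} \<in> E" if uv: "u \<noteq> v" "c u = c v" for u v
  proof -
    have ne: "f l \<noteq> h t" if "l \<in> L" "t \<in> T" for l t using fX[OF that(1)] hY[OF that(2)] bip(1) by auto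
    consider "u \<in> VX \<union> VY" | "v \<in> VX \<union> VY" | "u \<in> L" "v \<in> L"
      | t where "u \<in> L" "v \<in> t" "t \<in> T" | t where "v \<in> L" "u \<in> t" "t \<in> T"
      | t t' where "u \<in> t" "t \<in> T" "v \<in> t'" "t' \<in> T"
      using cases[of u] cases[of v] by blast
    then show ?thesis
    proof cases
      case 1 then show ?thesis using half uv by blast
    next
      case 2 then show ?thesis using half[of v u] uv by (simp add: insert_commute)
    next
      case 3 then show ?thesis using uv cL inj(1) by (metis inj_onD)
    next
      case 4 then show ?thesis using uv cL cT ne by metis
    next
      case 5 then show ?thesis using uv cL cT ne by metis
    next
      case 6
      then have "h t = h t'" using uv cT by metis
      then have "t = t'" using inj(2) 6 by (metis inj_onD)
      have "{u, v} = {corner1 t, corner2 t}"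
      proof -
        have "x = corner1 t \<or> x = corner2 t" if "x \<in> t" for x using corners(1)[OF 6(2)] that by blast
        from this[of u] this[of v] show ?thesis using 6 \<open>t = t'\<close> uv(1) by blast
      qed
      also have "\<dots> = t" using corners(1)[OF 6(2)] ..
      finally have "{u, v} = t" .
      then show ?thesis using triangle_in_E 6 by simp
    qed
  qed
  have free: "\<exists>w. c w = c v \<and> w \<notin> VX \<union> VY" for v
  proof -
    consider "v \<in> VX" | "v \<in> VY" | "v \<in> L" | t where "t \<in> T" "v \<in> t"
      using cases[of v] by blast
    then show ?thesis
    proof cases
      case 1
      then have "v \<in> f ` L" using f by simp
      then obtain l where "v = f l" "l \<in> L" by (rule imageE)
      then show ?thesis using cL cH[of v] 1 new(1) by (intro exI[of _ l]) auto
    next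
      case 2
      then have "v \<in> h ` T" using onto by simp
      then obtain t where "v = h t" "t \<in> T" by (rule imageE)
      then show ?thesis using cT[of t "corner1 t"] cH[of v] 2 new(2) corners_in(1)[of t] by (intro exI[of _ "corner1 t"]) auto
    next
      case 3
      then have "v \<notin> VX \<union> VY" using new(1) by blast
      then show ?thesis by (intro exI[of _ v]) simp
    next
      case 4
      then have "v \<in> \<Union>T" by (rule UnionI)
      then have "v \<notin> VX \<union> VY" using new(2) by blast
      then show ?thesis by (intro exI[of _ v]) simp
    qed
  qed
  have "E = {{u, v} | u v. u \<noteq> v \<and> c u = c v} \<union> B"
  proof (intro equalityI subsetI)
    fix e assume "e \<in> {{u, v} | u v. u \<noteq> v \<and> c u = c v} \<union> B"
    then show "e \<in> E" using bwd crossing_in_E by auto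
  qed (rule fwd)
  then have "clique_partitioned_graph E B c VX VY"
    by (intro clique_partitioned_graph.intro bip cH free)
  then show ?thesis by blast
qed

lemma trivial_partition:
  assumes "VX = {}" "T = {}"
  shows "clique_partitioned_graph E {} id {} {}"
proof -
  have "B = {}" "L = {}" using assms bip f by auto
  then have "E = {}" using E assms by auto
  then show ?thesis by unfold_locales auto
qed

end

lemma cameron_walker_graph_obtain:
  assumes "cameron_walker_graph E"
  obtains VX VY B L f T h where "cameron_walker E B VX VY L f T h"
proof -
  obtain VX VY B L f T h where cw: "bipartite_graph VX VY B" "connected_graph (VX \<union> VY) B" "f ` L = VX"
      "disjoint T" "\<forall>t\<in>T. card t = 2" "h ` T \<subseteq> VY"
      "L \<inter> (VX \<union> VY) = {}" "\<Union>T \<inter> (VX \<union> VY) = {}" "L \<inter> \<Union>T = {}"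
      "VX \<union> VY \<union> L \<union> \<Union>T = UNIV"
      "E = B \<union> {{l, f l} | l. l \<in> L} \<union> T \<union> {{h t, a} | t a. t \<in> T \<and> a \<in> t}"
    using assms unfolding cameron_walker_graph_def by (elim exE conjE) (rule that)
  have "cameron_walker E B VX VY L f T h"
    using cw(1,2) cw(3-) unfolding bipartite_graph_def connected_graph_def cameron_walker_def by simp
  then show thesis by (rule that)
qed

lemma unmixed_cameron_walker_graph:
  assumes "cameron_walker_graph E" "unmixed E"
  shows "\<exists>B c VX VY. clique_partitioned_graph E B c VX VY"
proof -
  obtain VX VY B L f T h where *: "cameron_walker E B VX VY L f T h"
    using assms(1) by (rule cameron_walker_graph_obtain)
  then interpret cameron_walker E B VX VY L f T h .
  show ?thesis
  proof (cases "VX = {} \<and> T = {}")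
    case True
    then show ?thesis using trivial_partition by blast
  next
    case False
    then show ?thesis using clique_partition[OF unmixed_imp_matching[OF assms(2)]] by blast
  qed
qed

lemma cameron_walker_graph_simple:
  assumes "cameron_walker_graph E" "e \<in> E"
  shows "\<exists>u v. u \<noteq> v \<and> e = {u, v}"
proof -
  obtain VX VY B L f T h where *: "cameron_walker E B VX VY L f T h"
    using assms(1) by (rule cameron_walker_graph_obtain)
  then interpret cameron_walker E B VX VY L f T h .
  from assms(2) show ?thesis
  proof (cases rule: edge_cases)
    case (crossing x y)
    then have "x \<noteq> y" using bip(1) by blast
    then show ?thesis using crossing(1) by blast
  next
    case (leaf l)
    then have "l \<noteq> f l" using new(1) by auto
    then show ?thesis using leaf(3) by blast
  next
    case base
    then show ?thesis using corners(1,2)[OF base] by blast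
  next
    case (side t a)
    then have "h t \<noteq> a" using new(2) by auto
    then show ?thesis using side(4) by blast
  qed
qed

section \<open>Powers of the cover ideal of a Cohen-Macaulay Cameron-Walker graph\<close>

theorem corollary2p5:
  fixes E :: "'v::finite set set" and k :: nat
  assumes "cameron_walker_graph E"
    and "cohen_macaulay_graph TYPE('k::field) E"
    and "k \<ge> 1"
  shows "has_linear_resolution ((cover_ideal E :: ('v, 'k) mpoly set) [^]\<^bsub>ideals_set mpoly_ring\<^esub> k)"
proof -
  have "unmixed E"
    unfolding unmixed_def
    using cohen_macaulay_cover_card_eq[OF cameron_walker_graph_simple[OF assms(1)] assms(2)] by blast
  then obtain B c VX VY where "clique_partitioned_graph E B c VX VY"
    using unmixed_cameron_walker_graph[OF assms(1)] by blast
  then interpret clique_partitioned_graph E B c VX VY .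
  show ?thesis by (rule cover_ideal_power_linear_resolution)
qed

end
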